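(* Let $n\ge2$ be an integer, let $p$ be a place of $\mathbb Q$ (either a prime number or $p=\infty$), and let $\psi:[0,\infty)\to[0,\infty)$ be decreasing. If $$\sum_{q=1}^{\infty} q^{n-1}\psi(q)^{n-1}=\infty,$$ then $\mu_p(\mathcal W_p(\psi))=1$.
   Context: Places of $\mathbb Q$: primes $v$ and $v=\infty$, with $\mathbb Q_\infty=\mathbb R$. $|\cdot|_v$ is the standard $v$-adic absolute value ($|v|_v=v^{-1}$) for a prime $v$ and the usual absolute value for $v=\infty$. For $\mathbf x\in\mathbb Q_v^m$ put $|\mathbf x|_v=\max_i|x_i|_v$ if $v$ is a prime and $|\mathbf x|_\infty=(\sum_i x_i^2)^{1/2}$. For $\mathbf x,\mathbf y\in\mathbb Q_v^n$, $\mathbf x\wedge\mathbf y$ is the vector with coordinates $x_iy_j-x_jy_i$ ($1\le i<j\le n$), and for nonzero $\mathbf x,\mathbf y$, $\delta_v(\mathbf x,\mathbf y)=|\mathbf x\wedge\mathbf y|_v/(|\mathbf x|_v|\mathbf y|_v)$, a metric on $\mathbb P^{n-1}(\mathbb Q_v)$. Let $\phi:\mathbb Q_p^n\setminus\{\mathbf 0\}\to\mathbb P^{n-1}(\mathbb Q_p)$ be the quotient map. The height of $\mathbf y\in\mathbb P^{n-1}(\mathbb Q)$ is $H(\mathbf y)=\prod_v|\mathbf y|_v$ over all places $v$, for any representative $\mathbf y\in\mathbb Q^n\setminus\{0\}$ (for a representative in $\mathbb Z^n$ with coprime coordinates this is its Euclidean norm). Let $\beta_p^n$ be Lebesgue measure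 on $\mathbb R^n$ if $p=\infty$, and Haar measure on $\mathbb Q_p^n$ normalized by $\beta_p^n(\mathbb Z_p^n)=1$ if $p$ is prime. For $M\subseteq\mathbb P^{n-1}(\mathbb Q_p)$ with $\phi^{-1}(M)$ Borel, $\mu_p(M)=\beta_p^n(\phi^{-1}(M)\cap B(\mathbf 0,1))/\beta_p^n(B(\mathbf 0,1))$, where $B(\mathbf 0,1)=\{\mathbf x\in\mathbb Q_p^n:|\mathbf x|_p\le1\}$. For $\psi:[0,\infty)\to[0,\infty)$, $\mathcal W_p(\psi)$ is the set of $\mathbf x\in\mathbb P^{n-1}(\mathbb Q_p)$ for which there are infinitely many $\mathbf y\in\mathbb P^{n-1}(\mathbb Q)$ with $\delta_p(\mathbf x,\mathbf y)\le\psi(H(\mathbf y))$. *)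

theory Defs
  imports "HOL-Analysis.Analysis" "Berlekamp_Zassenhaus.Finite_Field"
begin

datatype place = Prime_place nat | Infinite_place

definition places :: "place set" where
  "places = insert Infinite_place (Prime_place ` {p. prime p})"

definition rat_valuation :: "nat \<Rightarrow> rat \<Rightarrow> int" where
  "rat_valuation p q = int (multiplicity (int p) (fst (quotient_of q)))
                     - int (multiplicity (int p) (snd (quotient_of q)))"

fun rat_abs :: "place \<Rightarrow> rat \<Rightarrow> real" where
  "rat_abs (Prime_place p) q = (if q = 0 then 0 else real p powi (- rat_valuation p q))"
| "rat_abs Infinite_place q = \<bar>of_rat q\<bar>"

lemma rat_valuation_frac:
  assumes "prime p" "a \<noteq> 0" "b \<noteq> 0"
  shows "rat_valuation p (of_int a / of_int b) =
         int (multiplicity (int p) a) - int (multiplicity (int p) b)"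
proof -
  obtain c d where cd: "quotient_of (of_int a / of_int b) = (c, d)" by fastforce
  have d: "d > 0" using quotient_of_denom_pos[OF cd] .
  have "(of_int a / of_int b :: rat) = of_int c / of_int d" using quotient_of_div[OF cd] .
  hence "of_int (a * d) = (of_int (c * b) :: rat)" using assms d by (simp add: field_simps)
  hence eq: "a * d = c * b" by (simp only: of_int_eq_iff)
  hence c: "c \<noteq> 0" using assms d by auto
  have p: "prime_elem (int p)" using assms by simp
  have "multiplicity (int p) (a * d) = multiplicity (int p) (c * b)" using eq by simp
  hence "multiplicity (int p) a + multiplicity (int p) d
       = multiplicity (int p) c + multiplicity (int p) b"
    using prime_elem_multiplicity_mult_distrib[OF p] assms c d by simp
  thus ?thesis by (simp add: rat_valuation_def cd)
qed

lemma rat_fracE: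
  obtains a b where "(q::rat) = of_int a / of_int b" "b > 0"
proof (cases "quotient_of q")
  case (Pair a b)
  show ?thesis
    by (rule that[of a b]) (use Pair quotient_of_div quotient_of_denom_pos in auto)
qed

lemma rat_valuation_mult:
  assumes "prime p" "q \<noteq> 0" "r \<noteq> 0"
  shows "rat_valuation p (q * r) = rat_valuation p q + rat_valuation p r"
proof -
  obtain a b where q: "q = of_int a / of_int b" "b > 0" by (rule rat_fracE)
  obtain c d where r: "r = of_int c / of_int d" "d > 0" by (rule rat_fracE)
  have nz: "a \<noteq> 0" "c \<noteq> 0" "b \<noteq> 0" "d \<noteq> 0" using assms q r by auto
  have p: "prime_elem (int p)" using assms by simp
  have "q * r = of_int (a * c) / of_int (b * d)" using q r by simp
  hence "rat_valuation p (q * r)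
      = int (multiplicity (int p) (a * c)) - int (multiplicity (int p) (b * d))"
    using rat_valuation_frac[OF assms(1), of "a * c" "b * d"] nz by simp
  moreover have "rat_valuation p q = int (multiplicity (int p) a) - int (multiplicity (int p) b)"
    unfolding q(1) by (rule rat_valuation_frac[OF assms(1) nz(1) nz(3)])
  moreover have "rat_valuation p r = int (multiplicity (int p) c) - int (multiplicity (int p) d)"
    unfolding r(1) by (rule rat_valuation_frac[OF assms(1) nz(2) nz(4)])
  ultimately show ?thesis
    using prime_elem_multiplicity_mult_distrib[OF p] nz by simp
qed

lemma rat_valuation_add:
  assumes "prime p" "q \<noteq> 0" "r \<noteq> 0" "q + r \<noteq> 0"
  shows "min (rat_valuation p q) (rat_valuation p r) \<le> rat_valuation p (q + r)"
proof -
  obtain a b where q: "q = of_int a / of_int b" "b > 0" by (rule rat_fracE)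
  obtain c d where r: "r = of_int c / of_int d" "d > 0" by (rule rat_fracE)
  have nz: "a \<noteq> 0" "c \<noteq> 0" "b \<noteq> 0" "d \<noteq> 0" using assms q r by auto
  have p: "prime_elem (int p)" using assms by simp
  have nu: "\<not> is_unit (int p)" using assms by (metis prime_nat_int_transfer not_prime_unit)
  have qr: "q + r = of_int (a * d + c * b) / of_int (b * d)" using q r by (simp add: field_simps)
  have nz': "a * d + c * b \<noteq> 0"
  proof
    assume "a * d + c * b = 0"
    hence "q + r = 0" unfolding qr by simp
    thus False using assms by simp
  qed
  let ?m = "\<lambda>x. multiplicity (int p) x"
  have "int p ^ min (?m (a * d)) (?m (c * b)) dvd a * d + c * b"
    by (meson dvd_add multiplicity_dvd' min.cobounded1 min.cobounded2)
  hence "min (?m (a * d)) (?m (c * b)) \<le> ?m (a * d + c * b)"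
    using multiplicity_geI nz' nu by blast
  moreover have "rat_valuation p q = int (?m a) - int (?m b)"
    unfolding q(1) by (rule rat_valuation_frac[OF assms(1) nz(1) nz(3)])
  moreover have "rat_valuation p r = int (?m c) - int (?m d)"
    unfolding r(1) by (rule rat_valuation_frac[OF assms(1) nz(2) nz(4)])
  moreover have "rat_valuation p (q + r) = int (?m (a * d + c * b)) - int (?m (b * d))"
    unfolding qr by (rule rat_valuation_frac[OF assms(1) nz']) (use nz in simp)
  ultimately show ?thesis
    using prime_elem_multiplicity_mult_distrib[OF p] nz by (simp add: min_def split: if_splits)
qed

lemma rat_abs_nonneg [simp]: "0 \<le> rat_abs v q"
  by (cases v) (auto intro: zero_le_power_int)

lemma rat_abs_0 [simp]: "rat_abs v 0 = 0"
  by (cases v) auto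

lemma places_cases:
  assumes "v \<in> places"
  obtains "v = Infinite_place" | p where "v = Prime_place p" "prime p"
  using assms by (auto simp: places_def)

lemma rat_abs_eq_0_iff [simp]: "v \<in> places \<Longrightarrow> rat_abs v q = 0 \<longleftrightarrow> q = 0"
  by (elim places_cases) auto

lemma rat_abs_mult: "v \<in> places \<Longrightarrow> rat_abs v (q * r) = rat_abs v q * rat_abs v r"
proof (elim places_cases)
  fix p assume v: "v = Prime_place p" "prime p"
  show ?thesis
  proof (cases "q = 0 \<or> r = 0")
    case False
    have "real p \<noteq> 0" using v by auto
    moreover have "rat_valuation p (q * r) = rat_valuation p q + rat_valuation p r"
      using False v by (intro rat_valuation_mult) auto
    ultimately show ?thesis using False v
      by (simp add: power_int_diff power_int_minus field_simps)
  qed (use v in auto)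
qed (auto simp: of_rat_mult abs_mult)

lemma rat_abs_1 [simp]: "v \<in> places \<Longrightarrow> rat_abs v 1 = 1"
  by (elim places_cases) (auto simp: rat_valuation_def)

lemma rat_abs_minus [simp]: "v \<in> places \<Longrightarrow> rat_abs v (- q) = rat_abs v q"
proof -
  assume v: "v \<in> places"
  have "rat_abs v (-1) * rat_abs v (-1) = 1"
    using rat_abs_mult[OF v, of "-1" "-1"] v by simp
  hence "rat_abs v (-1) = 1"
    using rat_abs_nonneg[of v "-1"] by (auto simp: square_eq_1_iff simp del: rat_abs.simps)
  thus ?thesis using rat_abs_mult[OF v, of "-1" q] by simp
qed

lemma rat_abs_prime_add:
  assumes "prime p"
  shows "rat_abs (Prime_place p) (q + r)
       \<le> max (rat_abs (Prime_place p) q) (rat_abs (Prime_place p) r)"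
proof (cases "q = 0 \<or> r = 0 \<or> q + r = 0")
  case False
  have p: "real p \<ge> 1" using assms prime_ge_1_nat by force
  have "- rat_valuation p (q + r) \<le> max (- rat_valuation p q) (- rat_valuation p r)"
    using rat_valuation_add[of p q r] False assms by auto
  hence "real p powi (- rat_valuation p (q + r))
       \<le> real p powi (max (- rat_valuation p q) (- rat_valuation p r))"
    using p by (intro power_int_increasing) auto
  also have "\<dots> \<le> max (real p powi (- rat_valuation p q)) (real p powi (- rat_valuation p r))"
    by (simp add: max_def)
  finally show ?thesis using False by simp
next
  case True
  have "rat_abs (Prime_place p) q \<ge> 0" "rat_abs (Prime_place p) r \<ge> 0"
    by (rule rat_abs_nonneg)+
  with True show ?thesis by (auto simp del: rat_abs.simps(1) simp: le_max_iff_disj)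
qed

lemma rat_abs_triangle: "v \<in> places \<Longrightarrow> rat_abs v (q + r) \<le> rat_abs v q + rat_abs v r"
proof (elim places_cases)
  fix p assume v: "v = Prime_place p" "prime p"
  show ?thesis
    using rat_abs_prime_add[OF v(2), of q r] rat_abs_nonneg[of v q] rat_abs_nonneg[of v r]
    unfolding v(1) by linarith
next
  assume "v = Infinite_place"
  thus ?thesis by (metis abs_triangle_ineq of_rat_add rat_abs.simps(2))
qed

declare rat_abs.simps [simp del]

lemma rat_abs_diff_triangle:
  "v \<in> places \<Longrightarrow> \<bar>rat_abs v q - rat_abs v r\<bar> \<le> rat_abs v (q - r)"
  using rat_abs_triangle[of v "q - r" r] rat_abs_triangle[of v "r - q" q]
    rat_abs_minus[of v "q - r"] by simp

lemma rat_abs_inverse: "v \<in> places \<Longrightarrow> rat_abs v (inverse q) = inverse (rat_abs v q)"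
proof (cases "q = 0")
  case False
  assume v: "v \<in> places"
  have "rat_abs v (inverse q) * rat_abs v q = 1"
    using rat_abs_mult[OF v, of "inverse q" q] False v by simp
  thus ?thesis using inverse_unique by (metis mult.commute)
qed auto

text \<open>
  Completions of the rationals at a place: complete fields with a multiplicative absolute value that
  extends the one of the place and for which the rationals are dense. The instances are the reals
  and the \<open>p\<close>-adic numbers constructed below.
\<close>

class rat_completion = field_char_0 + complete_space +
  fixes place_of :: "'a itself \<Rightarrow> place"
    and vabs :: "'a \<Rightarrow> real"
  assumes place_of: "place_of TYPE('a) \<in> places"
    and vabs_mult: "vabs (x * y) = vabs x * vabs y"
    and dist_vabs: "dist x y = vabs (x - y)"
    and vabs_of_rat: "vabs (of_rat q) = rat_abs (place_of TYPE('a)) q"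
    and completion_dense: "0 < e \<Longrightarrow> \<exists>q. dist x (of_rat q) < e"

lemma vabs_nonneg [simp]: "0 \<le> vabs (x :: 'a :: rat_completion)"
  using dist_vabs[of x 0] zero_le_dist[of x 0] by simp

lemma vabs_eq_0_iff [simp]: "vabs (x :: 'a :: rat_completion) = 0 \<longleftrightarrow> x = 0"
  using dist_vabs[of x 0] by (metis diff_zero dist_eq_0_iff)

instantiation real :: rat_completion
begin

definition place_of_real :: "real itself \<Rightarrow> place" where
  "place_of_real _ = Infinite_place"

definition vabs_real :: "real \<Rightarrow> real" where
  "vabs_real x = \<bar>x\<bar>"

instance
proof
  fix x e :: real assume "0 < e"
  then obtain q where "x < of_rat q" "of_rat q < x + e"
    using of_rat_dense[of x "x + e"] by auto
  thus "\<exists>q. dist x (of_rat q) < e" by (intro exI[of _ q]) (auto simp: dist_real_def)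
qed (auto simp: places_def place_of_real_def vabs_real_def abs_mult dist_real_def rat_abs.simps)

end

definition cauchy_at :: "place \<Rightarrow> (nat \<Rightarrow> rat) \<Rightarrow> bool" where
  "cauchy_at v X \<longleftrightarrow> (\<forall>e>0. \<exists>N. \<forall>m\<ge>N. \<forall>n\<ge>N. rat_abs v (X m - X n) < e)"

text \<open>
  The field of \<open>p\<close>-adic numbers is the quotient of the ring of \<open>p\<close>-adic Cauchy sequences of
  rationals by the null sequences. The prime \<open>p\<close> is the cardinality of the type \<open>'p\<close>, so that
  generality in \<open>'p\<close> is generality in \<open>p\<close>.
\<close>

typedef ('p :: prime_card) rat_cauchy =
  "{X. cauchy_at (Prime_place CARD('p)) X}"
  by (rule exI[of _ "\<lambda>_. 0"]) (simp add: cauchy_at_def)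

setup_lifting type_definition_rat_cauchy

abbreviation pplace :: "'p :: prime_card itself \<Rightarrow> place" where
  "pplace _ \<equiv> Prime_place CARD('p)"

lemma pplace [simp]: "pplace TYPE('p :: prime_card) \<in> places"
  using prime_card[where 'a = 'p] by (simp add: places_def)

lemma rat_cauchy_convergent:
  fixes v
  assumes v: "v \<in> places"
    and X: "cauchy_at v X"
  shows "convergent (\<lambda>n. rat_abs v (X n))"
proof -
  have "Cauchy (\<lambda>n. rat_abs v (X n))"
    unfolding Cauchy_def dist_real_def
    using X[unfolded cauchy_at_def] rat_abs_diff_triangle[OF v] by (meson le_less_trans)
  thus ?thesis by (simp add: Cauchy_convergent_iff)
qed

lemma rat_cauchy_add:
  assumes v: "v \<in> places"
    and X: "cauchy_at v X"
    and Y: "cauchy_at v Y"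
  shows "cauchy_at v (\<lambda>n. X n + Y n)"
  unfolding cauchy_at_def
proof (intro allI impI)
  fix e :: real assume "e > 0"
  hence "e / 2 > 0" by simp
  then obtain M N where M: "\<forall>m\<ge>M. \<forall>n\<ge>M. rat_abs v (X m - X n) < e / 2"
    and N: "\<forall>m\<ge>N. \<forall>n\<ge>N. rat_abs v (Y m - Y n) < e / 2"
    using X Y unfolding cauchy_at_def by meson
  show "\<exists>N. \<forall>m\<ge>N. \<forall>n\<ge>N. rat_abs v ((X m + Y m) - (X n + Y n)) < e"
  proof (intro exI[of _ "max M N"] allI impI)
    fix m n assume "max M N \<le> m" "max M N \<le> n"
    hence "rat_abs v (X m - X n) < e / 2" "rat_abs v (Y m - Y n) < e / 2"
      using M[rule_format, of m n] N[rule_format, of m n] by simp_all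
    thus "rat_abs v ((X m + Y m) - (X n + Y n)) < e"
      using rat_abs_triangle[OF v, of "X m - X n" "Y m - Y n"] by (simp add: algebra_simps)
  qed
qed

lemma rat_cauchy_minus:
  assumes v: "v \<in> places"
    and X: "cauchy_at v X"
  shows "cauchy_at v (\<lambda>n. - X n)"
proof -
  have "rat_abs v (- X m - - X n) = rat_abs v (X m - X n)" for m n
    using rat_abs_minus[OF v, of "X m - X n"] by (simp add: algebra_simps)
  thus ?thesis using X by (simp add: cauchy_at_def)
qed

lemma rat_cauchy_bounded:
  assumes v: "v \<in> places"
    and X: "cauchy_at v X"
  shows "\<exists>B>0. \<forall>n. rat_abs v (X n) \<le> B"
proof -
  have "Bseq (\<lambda>n. rat_abs v (X n))"
    using rat_cauchy_convergent[OF v X] by (rule convergent_imp_Bseq)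
  then obtain B where "B > 0" "\<And>n. norm (rat_abs v (X n)) \<le> B" by (rule BseqE) auto
  thus ?thesis by auto
qed

lemma rat_cauchy_mult:
  assumes v: "v \<in> places"
    and X: "cauchy_at v X"
    and Y: "cauchy_at v Y"
  shows "cauchy_at v (\<lambda>n. X n * Y n)"
  unfolding cauchy_at_def
proof (intro allI impI)
  fix e :: real assume e: "e > 0"
  obtain A where A: "A > 0" "\<And>n. rat_abs v (X n) \<le> A" using rat_cauchy_bounded[OF v X] by blast
  obtain B where B: "B > 0" "\<And>n. rat_abs v (Y n) \<le> B" using rat_cauchy_bounded[OF v Y] by blast
  have "e / (2 * B) > 0" "e / (2 * A) > 0" using e A B by auto
  then obtain M N where M: "\<forall>m\<ge>M. \<forall>n\<ge>M. rat_abs v (X m - X n) < e / (2 * B)"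
    and N: "\<forall>m\<ge>N. \<forall>n\<ge>N. rat_abs v (Y m - Y n) < e / (2 * A)"
    using X Y unfolding cauchy_at_def by meson
  show "\<exists>N. \<forall>m\<ge>N. \<forall>n\<ge>N. rat_abs v (X m * Y m - X n * Y n) < e"
  proof (intro exI[of _ "max M N"] allI impI)
    fix m n assume mn: "max M N \<le> m" "max M N \<le> n"
    have "rat_abs v (X m * (Y m - Y n)) \<le> A * rat_abs v (Y m - Y n)"
      unfolding rat_abs_mult[OF v] using A by (intro mult_right_mono) simp_all
    also have "\<dots> < A * (e / (2 * A))"
      by (rule mult_strict_left_mono[OF N[rule_format] A(1)]) (use mn in simp_all)
    also have "\<dots> = e / 2" using A(1) by simp
    finally have 1: "rat_abs v (X m * (Y m - Y n)) < e / 2" .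
    have "rat_abs v ((X m - X n) * Y n) \<le> rat_abs v (X m - X n) * B"
      unfolding rat_abs_mult[OF v] using B by (intro mult_left_mono) simp_all
    also have "\<dots> < (e / (2 * B)) * B"
      by (rule mult_strict_right_mono[OF M[rule_format] B(1)]) (use mn in simp_all)
    also have "\<dots> = e / 2" using B(1) by simp
    finally have 2: "rat_abs v ((X m - X n) * Y n) < e / 2" .
    have "X m * Y m - X n * Y n = X m * (Y m - Y n) + (X m - X n) * Y n"
      by (simp add: algebra_simps)
    hence "rat_abs v (X m * Y m - X n * Y n) = rat_abs v (X m * (Y m - Y n) + (X m - X n) * Y n)"
      by (rule arg_cong)
    thus "rat_abs v (X m * Y m - X n * Y n) < e"
      using 1 2 rat_abs_triangle[OF v, of "X m * (Y m - Y n)" "(X m - X n) * Y n"] by linarith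
  qed
qed

lemma rat_cauchy_inverse:
  assumes v: "v \<in> places"
    and X: "cauchy_at v X"
    and nz: "\<not> (\<lambda>n. rat_abs v (X n)) \<longlonglongrightarrow> 0"
  shows "cauchy_at v (\<lambda>n. inverse (X n))"
  unfolding cauchy_at_def
proof (intro allI impI)
  fix e :: real assume e: "e > 0"
  obtain L where L: "(\<lambda>n. rat_abs v (X n)) \<longlonglongrightarrow> L"
    using rat_cauchy_convergent[OF v X] by (auto simp: convergent_def)
  have "L \<ge> 0" by (rule LIMSEQ_le_const[OF L]) simp
  moreover have "L \<noteq> 0" using L nz by auto
  ultimately have L0: "L > 0" by simp
  hence "\<forall>\<^sub>F n in sequentially. rat_abs v (X n) > L / 2"
    by (intro order_tendstoD(1)[OF L]) simp
  then obtain M where M: "\<And>n. n \<ge> M \<Longrightarrow> rat_abs v (X n) > L / 2"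
    by (auto simp: eventually_sequentially)
  have "e * (L / 2 * (L / 2)) > 0" using e L0 by simp
  then obtain N where N: "\<forall>m\<ge>N. \<forall>n\<ge>N. rat_abs v (X m - X n) < e * (L / 2 * (L / 2))"
    using X unfolding cauchy_at_def by meson
  show "\<exists>N. \<forall>m\<ge>N. \<forall>n\<ge>N. rat_abs v (inverse (X m) - inverse (X n)) < e"
  proof (intro exI[of _ "max M N"] allI impI)
    fix m n assume mn: "max M N \<le> m" "max M N \<le> n"
    have Lm: "rat_abs v (X m) > L / 2" and Ln: "rat_abs v (X n) > L / 2" using M mn by auto
    hence nz: "X m \<noteq> 0" "X n \<noteq> 0" using L0 by auto
    have "inverse (X m) - inverse (X n) = - (X m - X n) * inverse (X m * X n)"
      using nz by (simp add: field_simps)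
    hence "rat_abs v (inverse (X m) - inverse (X n))
         = rat_abs v (X m - X n) * inverse (rat_abs v (X m) * rat_abs v (X n))"
      by (simp only: rat_abs_mult[OF v] rat_abs_inverse[OF v] rat_abs_minus[OF v])
    hence "rat_abs v (inverse (X m) - inverse (X n))
         = rat_abs v (X m - X n) / (rat_abs v (X m) * rat_abs v (X n))"
      by (simp only: divide_inverse)
    moreover have "rat_abs v (X m - X n) < e * (L / 2 * (L / 2))" using N mn by auto
    moreover have "e * (L / 2 * (L / 2)) < e * (rat_abs v (X m) * rat_abs v (X n))"
      using Lm Ln L0 e by (intro mult_strict_left_mono mult_strict_mono) auto
    moreover have "rat_abs v (X m) * rat_abs v (X n) > 0"
      using Lm Ln L0 by (intro mult_pos_pos) linarith+
    ultimately show "rat_abs v (inverse (X m) - inverse (X n)) < e"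
      by (simp add: divide_less_eq)
  qed
qed

instantiation rat_cauchy :: (prime_card) comm_ring_1
begin

lift_definition zero_rat_cauchy :: "'a rat_cauchy" is "\<lambda>_. 0" by (simp add: cauchy_at_def)
lift_definition one_rat_cauchy :: "'a rat_cauchy" is "\<lambda>_. 1" by (simp add: cauchy_at_def)
lift_definition plus_rat_cauchy :: "'a rat_cauchy \<Rightarrow> 'a rat_cauchy \<Rightarrow> 'a rat_cauchy"
  is "\<lambda>X Y n. X n + Y n" by (rule rat_cauchy_add[OF pplace])
lift_definition uminus_rat_cauchy :: "'a rat_cauchy \<Rightarrow> 'a rat_cauchy"
  is "\<lambda>X n. - X n" by (rule rat_cauchy_minus[OF pplace])
lift_definition times_rat_cauchy :: "'a rat_cauchy \<Rightarrow> 'a rat_cauchy \<Rightarrow> 'a rat_cauchy"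
  is "\<lambda>X Y n. X n * Y n" by (rule rat_cauchy_mult[OF pplace])

definition minus_rat_cauchy :: "'a rat_cauchy \<Rightarrow> 'a rat_cauchy \<Rightarrow> 'a rat_cauchy" where
  "minus_rat_cauchy X Y = X + - Y"

instance
proof
  fix a b c :: "'a rat_cauchy"
  show "a * b * c = a * (b * c)" by transfer (simp add: algebra_simps)
  show "a * b = b * a" by transfer (simp add: algebra_simps)
  show "1 * a = a" by transfer simp
  show "a + b + c = a + (b + c)" by transfer (simp add: algebra_simps)
  show "a + b = b + a" by transfer (simp add: algebra_simps)
  show "0 + a = a" by transfer simp
  show "- a + a = 0" by transfer simp
  show "a - b = a + - b" by (rule minus_rat_cauchy_def)
  show "(a + b) * c = a * c + b * c" by transfer (simp add: algebra_simps)
  show "(0 :: 'a rat_cauchy) \<noteq> 1" by transfer (simp add: fun_eq_iff)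
qed

end

lemma rep_rat_cauchy [simp]:
  "Rep_rat_cauchy 0 n = 0" "Rep_rat_cauchy 1 n = 1"
  "Rep_rat_cauchy (X + Y) n = Rep_rat_cauchy X n + Rep_rat_cauchy Y n"
  "Rep_rat_cauchy (- X) n = - Rep_rat_cauchy X n"
  "Rep_rat_cauchy (X - Y) n = Rep_rat_cauchy X n - Rep_rat_cauchy Y n"
  "Rep_rat_cauchy (X * Y) n = Rep_rat_cauchy X n * Rep_rat_cauchy Y n"
  using plus_rat_cauchy.rep_eq[of X "- Y"]
  by (simp_all add: zero_rat_cauchy.rep_eq one_rat_cauchy.rep_eq plus_rat_cauchy.rep_eq
      uminus_rat_cauchy.rep_eq times_rat_cauchy.rep_eq)

lift_definition rc_const :: "rat \<Rightarrow> 'p :: prime_card rat_cauchy" is "\<lambda>q _. q" by (simp add: cauchy_at_def)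

definition rc_abs :: "'p :: prime_card rat_cauchy \<Rightarrow> nat \<Rightarrow> real" where
  "rc_abs X n = rat_abs (pplace TYPE('p)) (Rep_rat_cauchy X n)"

definition rc_null :: "'p :: prime_card rat_cauchy \<Rightarrow> bool" where
  "rc_null X \<longleftrightarrow> rc_abs X \<longlonglongrightarrow> 0"

lift_definition rc_inverse :: "'p :: prime_card rat_cauchy \<Rightarrow> 'p rat_cauchy" is
  "\<lambda>X. if (\<lambda>n. rat_abs (pplace TYPE('p)) (X n)) \<longlonglongrightarrow> 0 then (\<lambda>_. 0) else (\<lambda>n. inverse (X n))"
  by (simp add: rat_cauchy_inverse cauchy_at_def[of _ "\<lambda>_. 0"])

lemma rc_inverse: "rc_inverse X = 0" if "rc_null X"
  using that unfolding rc_null_def rc_abs_def by transfer simp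

lemma rc_inverse': "Rep_rat_cauchy (rc_inverse X) n = inverse (Rep_rat_cauchy X n)"
  if "\<not> rc_null X"
  using that unfolding rc_null_def rc_abs_def by (simp add: rc_inverse.rep_eq)

lemma rc_abs_nonneg [simp]: "0 \<le> rc_abs X n"
  by (simp add: rc_abs_def)

lemma rc_abs_simps [simp]:
  "rc_abs 0 n = 0" "rc_abs 1 n = 1" "rc_abs (X * Y) n = rc_abs X n * rc_abs Y n"
  "rc_abs (- X) n = rc_abs X n"
  "rc_abs (rc_const q :: 'p :: prime_card rat_cauchy) n = rat_abs (pplace TYPE('p)) q"
  by (simp_all add: rc_abs_def rat_abs_mult[OF pplace] rat_abs_minus[OF pplace] rat_abs_1[OF pplace]
      rc_const.rep_eq)

lemma rc_abs_minus_commute: "rc_abs (X - Y) n = rc_abs (Y - X) n"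
  using rc_abs_simps(4)[of "X - Y" n] by simp

lemma rc_abs_triangle: "rc_abs (X + Y) n \<le> rc_abs X n + rc_abs Y n"
  by (simp add: rc_abs_def rat_abs_triangle[OF pplace])

lemma rc_abs_diff: "\<bar>rc_abs X n - rc_abs Y n\<bar> \<le> rc_abs (X - Y) n"
  by (simp add: rc_abs_def rat_abs_diff_triangle[OF pplace])

lemma rc_abs_convergent: "convergent (rc_abs X)"
  unfolding rc_abs_def
  by (rule rat_cauchy_convergent[OF pplace]) (use Rep_rat_cauchy[of X] in simp)

lemma rc_abs_lim: "rc_abs X \<longlonglongrightarrow> lim (rc_abs X)"
  using rc_abs_convergent by (simp add: convergent_LIMSEQ_iff)

lemma rc_null_iff_lim: "rc_null X \<longleftrightarrow> lim (rc_abs X) = 0"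
  unfolding rc_null_def using rc_abs_lim[of X] LIMSEQ_unique[of "rc_abs X" _ 0] by auto

lemma rc_null_add: "rc_null X \<Longrightarrow> rc_null Y \<Longrightarrow> rc_null (X + Y)"
  unfolding rc_null_def
  by (rule tendsto_sandwich[where f = "\<lambda>_. 0" and h = "\<lambda>n. rc_abs X n + rc_abs Y n"])
     (auto simp: rc_abs_triangle intro: tendsto_add[where a = 0 and b = 0, simplified])

lemma rc_null_minus [simp]: "rc_null (- X) \<longleftrightarrow> rc_null X"
proof -
  have "rc_abs (- X) = rc_abs X" by (rule ext) simp
  thus ?thesis by (simp add: rc_null_def)
qed

lemma rc_null_0 [simp]: "rc_null (0 :: 'p :: prime_card rat_cauchy)"
proof -
  have "rc_abs (0 :: 'p rat_cauchy) = (\<lambda>_. 0)" by (rule ext) simp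
  thus ?thesis by (simp add: rc_null_def)
qed

lemma rc_null_mult: "rc_null X \<Longrightarrow> rc_null (X * Y)"
proof -
  assume "rc_null X"
  hence "(\<lambda>n. rc_abs X n * rc_abs Y n) \<longlonglongrightarrow> 0 * lim (rc_abs Y)"
    unfolding rc_null_def by (intro tendsto_mult rc_abs_lim)
  moreover have "rc_abs (X * Y) = (\<lambda>n. rc_abs X n * rc_abs Y n)" by (rule ext) simp
  ultimately show ?thesis by (simp add: rc_null_def)
qed

lemma rc_lim_cong:
  assumes "rc_null (X - Y)"
  shows "lim (rc_abs X) = lim (rc_abs Y)"
proof -
  have "(\<lambda>n. rc_abs X n - rc_abs Y n) \<longlonglongrightarrow> 0"
  proof (rule Lim_null_comparison)
    show "\<forall>\<^sub>F n in sequentially. norm (rc_abs X n - rc_abs Y n) \<le> rc_abs (X - Y) n"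
      using rc_abs_diff[of X _ Y] by simp
    show "rc_abs (X - Y) \<longlonglongrightarrow> 0" using assms by (simp add: rc_null_def)
  qed
  moreover have "(\<lambda>n. rc_abs X n - rc_abs Y n) \<longlonglongrightarrow> lim (rc_abs X) - lim (rc_abs Y)"
    by (intro tendsto_diff rc_abs_lim)
  ultimately have "lim (rc_abs X) - lim (rc_abs Y) = 0" using LIMSEQ_unique by blast
  thus ?thesis by simp
qed

lemma rc_null_cong: "rc_null (X - Y) \<Longrightarrow> rc_null X \<longleftrightarrow> rc_null Y"
  by (simp add: rc_null_iff_lim rc_lim_cong)

lemma rc_null_eventually:
  assumes "\<And>e. e > 0 \<Longrightarrow> \<forall>\<^sub>F n in sequentially. rc_abs X n < e"
  shows "rc_null X"
  unfolding rc_null_def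
proof (rule tendstoI)
  fix e :: real assume "e > 0"
  thus "\<forall>\<^sub>F n in sequentially. dist (rc_abs X n) 0 < e" using assms by simp
qed

lemma rc_inverse_mult:
  assumes "\<not> rc_null X"
  shows "rc_null (X * rc_inverse X - 1)"
proof (rule rc_null_eventually)
  fix e :: real assume "e > 0"
  have "lim (rc_abs X) \<ge> 0" by (rule LIMSEQ_le_const[OF rc_abs_lim]) simp
  hence "lim (rc_abs X) > 0" using assms by (simp add: rc_null_iff_lim)
  hence "\<forall>\<^sub>F n in sequentially. rc_abs X n > 0" by (rule order_tendstoD(1)[OF rc_abs_lim])
  thus "\<forall>\<^sub>F n in sequentially. rc_abs (X * rc_inverse X - 1) n < e"
  proof eventually_elim
    case (elim n)
    hence "Rep_rat_cauchy X n \<noteq> 0" by (auto simp: rc_abs_def)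
    thus ?case using \<open>e > 0\<close> assms by (simp add: rc_abs_def rc_inverse')
  qed
qed

lemma rc_inverse_cong:
  assumes "rc_null (X - Y)"
  shows "rc_null (rc_inverse X - rc_inverse Y)"
proof (cases "rc_null X")
  case True
  thus ?thesis using rc_null_cong[OF assms] by (simp add: rc_inverse)
next
  case False
  let ?X = "rc_inverse X" and ?Y = "rc_inverse Y"
  have nY: "\<not> rc_null Y" using False rc_null_cong[OF assms] by simp
  have eq: "?X - ?Y = (X * ?X - 1) * ?Y - (Y * ?Y - 1) * ?X - (X - Y) * (?X * ?Y)"
    by (simp add: algebra_simps)
  have "rc_null ((X * ?X - 1) * ?Y)" "rc_null ((Y * ?Y - 1) * ?X)" "rc_null ((X - Y) * (?X * ?Y))"
    using rc_inverse_mult[OF False] rc_inverse_mult[OF nY] assms by (blast intro: rc_null_mult)+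
  hence "rc_null ((X * ?X - 1) * ?Y + - ((Y * ?Y - 1) * ?X) + - ((X - Y) * (?X * ?Y)))"
    by (intro rc_null_add) (simp_all only: rc_null_minus)
  thus ?thesis unfolding eq by simp
qed

quotient_type 'p padic = "('p :: prime_card) rat_cauchy" / "\<lambda>X Y. rc_null (X - Y)"
proof (rule equivpI)
  show "reflp (\<lambda>X Y :: 'p rat_cauchy. rc_null (X - Y))" by (simp add: reflp_def)
  show "symp (\<lambda>X Y :: 'p rat_cauchy. rc_null (X - Y))"
    by (metis (mono_tags, lifting) minus_diff_eq rc_null_minus sympI)
  show "transp (\<lambda>X Y :: 'p rat_cauchy. rc_null (X - Y))"
  proof (rule transpI)
    fix X Y Z :: "'p rat_cauchy" assume "rc_null (X - Y)" "rc_null (Y - Z)"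
    from rc_null_add[OF this] show "rc_null (X - Z)" by simp
  qed
qed

instantiation padic :: (prime_card) field
begin

lift_definition zero_padic :: "'a padic" is 0 .
lift_definition one_padic :: "'a padic" is 1 .

lift_definition plus_padic :: "'a padic \<Rightarrow> 'a padic \<Rightarrow> 'a padic" is "(+)"
proof -
  fix X X' Y Y' :: "'a rat_cauchy" assume "rc_null (X - X')" "rc_null (Y - Y')"
  from rc_null_add[OF this] show "rc_null ((X + Y) - (X' + Y'))" by (simp add: algebra_simps)
qed

lift_definition uminus_padic :: "'a padic \<Rightarrow> 'a padic" is uminus
proof -
  fix X Y :: "'a rat_cauchy" assume "rc_null (X - Y)"
  hence "rc_null (- (X - Y))" by (simp only: rc_null_minus)
  thus "rc_null (- X - - Y)" by (simp add: algebra_simps)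
qed

lift_definition times_padic :: "'a padic \<Rightarrow> 'a padic \<Rightarrow> 'a padic" is "(*)"
proof -
  fix X X' Y Y' :: "'a rat_cauchy" assume "rc_null (X - X')" "rc_null (Y - Y')"
  hence "rc_null ((X - X') * Y + (Y - Y') * X')" by (intro rc_null_add rc_null_mult)
  thus "rc_null (X * Y - X' * Y')" by (simp add: algebra_simps)
qed

lift_definition inverse_padic :: "'a padic \<Rightarrow> 'a padic" is rc_inverse
  by (rule rc_inverse_cong)

definition minus_padic :: "'a padic \<Rightarrow> 'a padic \<Rightarrow> 'a padic" where
  "minus_padic x y = x + - y"

definition divide_padic :: "'a padic \<Rightarrow> 'a padic \<Rightarrow> 'a padic" where
  "divide_padic x y = x * inverse y"

instance
proof
  fix a b c :: "'a padic"
  show "a * b * c = a * (b * c)" by transfer (simp add: algebra_simps)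
  show "a * b = b * a" by transfer (simp add: algebra_simps)
  show "1 * a = a" by transfer simp
  show "(a + b) * c = a * c + b * c" by transfer (simp add: algebra_simps)
  show "a + b + c = a + (b + c)" by transfer (simp add: algebra_simps)
  show "a + b = b + a" by transfer (simp add: algebra_simps)
  show "0 + a = a" by transfer simp
  show "- a + a = 0" by transfer simp
  show "a - b = a + - b" by (rule minus_padic_def)
  show "a div b = a * inverse b" by (rule divide_padic_def)
  show "inverse (0 :: 'a padic) = 0" by transfer (simp add: rc_inverse)
  show "(0 :: 'a padic) \<noteq> 1"
  proof transfer
    have "rc_abs (1 :: 'a rat_cauchy) = (\<lambda>_. 1)" by (rule ext) simp
    hence "\<not> rc_null (1 :: 'a rat_cauchy)" by (simp add: rc_null_def LIMSEQ_const_iff)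
    thus "\<not> rc_null (0 - 1 :: 'a rat_cauchy)" by simp
  qed
  show "a \<noteq> 0 \<Longrightarrow> inverse a * a = 1"
    by transfer (use rc_inverse_mult in \<open>auto simp: mult.commute\<close>)
qed

end

lift_definition padic_const :: "rat \<Rightarrow> 'p :: prime_card padic" is rc_const .

lemma rc_const_hom: "rc_const (q + r) = rc_const q + rc_const r"
  "rc_const (q * r) = rc_const q * rc_const r" "rc_const 0 = 0" "rc_const 1 = 1"
  by (simp_all add: Rep_rat_cauchy_inject[symmetric] fun_eq_iff rc_const.rep_eq)

lemma padic_const_hom: "padic_const (q + r) = padic_const q + padic_const r"
  "padic_const (q * r) = padic_const q * padic_const r" "padic_const 0 = 0" "padic_const 1 = 1"
  by (transfer, simp add: rc_const_hom)+

lemma rc_null_const: "rc_null (rc_const q :: 'a :: prime_card rat_cauchy) \<longleftrightarrow> q = 0"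
proof -
  have "rc_abs (rc_const q :: 'a rat_cauchy) = (\<lambda>_. rat_abs (pplace TYPE('a)) q)"
    by (rule ext) (simp)
  thus ?thesis
    by (simp add: rc_null_def LIMSEQ_const_iff rat_abs_eq_0_iff[OF pplace])
qed

lemma padic_const_eq_0: "padic_const q = (0 :: 'a :: prime_card padic) \<longleftrightarrow> q = 0"
  by transfer (simp add: rc_null_const)

lemma padic_const_of_nat: "padic_const (of_nat n) = of_nat n"
  by (induction n) (simp_all add: padic_const_hom)

instance padic :: (prime_card) field_char_0
proof
  show "inj (of_nat :: nat \<Rightarrow> 'a padic)"
  proof (rule injI)
    have *: False if "m < n" "(of_nat m :: 'a padic) = of_nat n" for m n
    proof -
      have "(of_nat (n - m) :: 'a padic) = 0" using that by simp
      hence "(of_nat (n - m) :: rat) = 0"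
        using padic_const_of_nat[of "n - m"] padic_const_eq_0 by metis
      thus False using that by simp
    qed
    fix m n :: nat assume "(of_nat m :: 'a padic) = of_nat n"
    thus "m = n" using *[of m n] *[of n m] by (metis linorder_neqE_nat)
  qed
qed

lemma padic_const_of_rat: "padic_const q = (of_rat q :: 'a :: prime_card padic)"
proof -
  have minus: "padic_const (- r) = - (padic_const r :: 'a padic)" for r
    using padic_const_hom(1)[of r "- r", where 'a = 'a]
    by (simp add: padic_const_hom(3) add_eq_0_iff)
  have int: "padic_const (of_int z) = (of_int z :: 'a padic)" for z
    by (cases z) (simp_all add: padic_const_of_nat minus del: of_nat_Suc)
  obtain a b where q: "q = of_int a / of_int b" "b > 0" by (rule rat_fracE)
  have "padic_const q * padic_const (of_int b) = (padic_const (of_int a) :: 'a padic)"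
    using q by (simp add: padic_const_hom(2)[symmetric])
  hence "padic_const q = (of_int a / of_int b :: 'a padic)"
    unfolding int using q(2) by (subst nonzero_eq_divide_eq) simp_all
  thus ?thesis using q by (simp add: of_rat_divide)
qed

lift_definition padic_abs :: "'p :: prime_card padic \<Rightarrow> real" is "\<lambda>X. lim (rc_abs X)"
  by (rule rc_lim_cong)

lemma padic_abs_eq_0: "padic_abs x = 0 \<longleftrightarrow> x = (0 :: 'a :: prime_card padic)"
  by transfer (simp add: rc_null_iff_lim)

lemma padic_abs_mult: "padic_abs (x * y) = padic_abs x * padic_abs (y :: 'a :: prime_card padic)"
proof transfer
  fix X Y :: "'a rat_cauchy"
  have "(\<lambda>n. rc_abs X n * rc_abs Y n) \<longlonglongrightarrow> lim (rc_abs X) * lim (rc_abs Y)"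
    by (intro tendsto_mult rc_abs_lim)
  moreover have "rc_abs (X * Y) = (\<lambda>n. rc_abs X n * rc_abs Y n)" by (rule ext) simp
  ultimately show "lim (rc_abs (X * Y)) = lim (rc_abs X) * lim (rc_abs Y)" by (simp add: limI)
qed

lemma padic_abs_triangle: "padic_abs (x + y) \<le> padic_abs x + padic_abs (y :: 'a :: prime_card padic)"
proof transfer
  fix X Y :: "'a rat_cauchy"
  show "lim (rc_abs (X + Y)) \<le> lim (rc_abs X) + lim (rc_abs Y)"
    by (rule LIMSEQ_le[OF rc_abs_lim tendsto_add[OF rc_abs_lim rc_abs_lim]])
       (auto intro: rc_abs_triangle)
qed

lemma padic_abs_of_rat: "padic_abs (of_rat q :: 'a :: prime_card padic) = rat_abs (Prime_place CARD('a)) q"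
  unfolding padic_const_of_rat[symmetric]
proof transfer
  fix q
  have "rc_abs (rc_const q :: 'a rat_cauchy) = (\<lambda>_. rat_abs (pplace TYPE('a)) q)"
    by (rule ext) (simp)
  thus "lim (rc_abs (rc_const q :: 'a rat_cauchy)) = rat_abs (Prime_place CARD('a)) q" by simp
qed

lemma padic_abs_minus: "padic_abs (- x) = padic_abs (x :: 'a :: prime_card padic)"
proof transfer
  fix X :: "'a rat_cauchy"
  have "rc_abs (- X) = rc_abs X" by (rule ext) simp
  thus "lim (rc_abs (- X)) = lim (rc_abs X)" by simp
qed

lemma padic_approx:
  fixes X :: "nat \<Rightarrow> rat"
  assumes "cauchy_at (pplace TYPE('a)) X" and "e > 0"
  shows "\<exists>N. \<forall>n\<ge>N. padic_abs (abs_padic (Abs_rat_cauchy X) - of_rat (X n) :: 'a :: prime_card padic) < e"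
proof -
  have "e / 2 > 0" using assms by simp
  then obtain N
    where N: "\<And>m n. m \<ge> N \<Longrightarrow> n \<ge> N \<Longrightarrow> rat_abs (pplace TYPE('a)) (X m - X n) < e / 2"
    using assms unfolding cauchy_at_def by meson
  show ?thesis
  proof (intro exI[of _ N] allI impI)
    fix n assume n: "n \<ge> N"
    let ?Z = "Abs_rat_cauchy X - rc_const (X n) :: 'a rat_cauchy"
    have Z: "rc_abs ?Z m = rat_abs (pplace TYPE('a)) (X m - X n)" for m
      using assms by (simp add: rc_abs_def Abs_rat_cauchy_inverse rc_const.rep_eq)
    have "rc_abs ?Z m \<le> e / 2" if "m \<ge> N" for m
      unfolding Z using N[OF that n] by (rule less_imp_le)
    hence "lim (rc_abs ?Z) \<le> e / 2" by (intro LIMSEQ_le_const2[OF rc_abs_lim]) blast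
    moreover have "abs_padic (Abs_rat_cauchy X) - of_rat (X n) = (abs_padic ?Z :: 'a padic)"
      by (simp add: padic_const_of_rat[symmetric] padic_const.abs_eq minus_padic_def
          uminus_padic.abs_eq plus_padic.abs_eq)
    ultimately show "padic_abs (abs_padic (Abs_rat_cauchy X) - of_rat (X n) :: 'a padic) < e"
      using assms by (simp add: padic_abs.abs_eq)
  qed
qed

instantiation padic :: (prime_card) metric_space
begin

definition dist_padic :: "'a padic \<Rightarrow> 'a padic \<Rightarrow> real" where
  "dist_padic x y = padic_abs (x - y)"

definition uniformity_padic :: "('a padic \<times> 'a padic) filter" where
  "uniformity_padic = (INF e\<in>{0 <..}. principal {(x, y). dist x y < e})"

definition open_padic :: "'a padic set \<Rightarrow> bool" where
  "open_padic U \<longleftrightarrow> (\<forall>x\<in>U. eventually (\<lambda>(x', y). x' = x \<longrightarrow> y \<in> U) uniformity)"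

instance
proof
  fix x y z :: "'a padic"
  show "dist x y = 0 \<longleftrightarrow> x = y" by (simp add: dist_padic_def padic_abs_eq_0)
  show "dist x y \<le> dist x z + dist y z"
    using padic_abs_triangle[of "x - z" "z - y"] padic_abs_minus[of "y - z"]
    by (simp add: dist_padic_def)
qed (simp_all add: uniformity_padic_def open_padic_def)

end

lemma padic_dense: "e > 0 \<Longrightarrow> \<exists>q. dist x (of_rat q) < e" for x :: "'a :: prime_card padic"
proof -
  assume e: "e > 0"
  obtain X where X: "x = abs_padic X" by (induct x rule: padic.abs_induct) blast
  have "cauchy_at (pplace TYPE('a)) (Rep_rat_cauchy X)" using Rep_rat_cauchy[of X] by simp
  from padic_approx[OF this e] obtain N
    where "padic_abs (abs_padic (Abs_rat_cauchy (Rep_rat_cauchy X)) - of_rat (Rep_rat_cauchy X N)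
             :: 'a padic) < e" by blast
  thus ?thesis
    unfolding X dist_padic_def Rep_rat_cauchy_inverse by blast
qed

instance padic :: (prime_card) complete_space
proof
  fix S :: "nat \<Rightarrow> 'a padic" assume S: "Cauchy S"
  show "convergent S"
  proof -
    have "\<exists>q. dist (S n) (of_rat q) < inverse (real (Suc n))" for n by (rule padic_dense) simp
    then obtain q where q: "\<And>n. dist (S n) (of_rat (q n)) < inverse (real (Suc n))" by metis
    have "cauchy_at (pplace TYPE('a)) q"
      unfolding cauchy_at_def
    proof (intro allI impI)
      fix e :: real assume "e > 0"
      hence e: "e / 3 > 0" by simp
      obtain M where M: "\<And>m n. m \<ge> M \<Longrightarrow> n \<ge> M \<Longrightarrow> dist (S m) (S n) < e / 3"
        using S e unfolding Cauchy_def by meson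
      obtain K where K: "inverse (real (Suc K)) < e / 3" using reals_Archimedean[OF e] by blast
      have K': "dist (S n) (of_rat (q n)) < e / 3" if "n \<ge> K" for n
      proof -
        have "inverse (real (Suc n)) \<le> inverse (real (Suc K))" using that by simp
        with q[of n] K show ?thesis by linarith
      qed
      show "\<exists>N. \<forall>m\<ge>N. \<forall>n\<ge>N. rat_abs (pplace TYPE('a)) (q m - q n) < e"
      proof (intro exI[of _ "max M K"] allI impI)
        fix m n assume mn: "max M K \<le> m" "max M K \<le> n"
        have "dist (of_rat (q m)) (of_rat (q n) :: 'a padic)
            \<le> dist (of_rat (q m)) (S m) + dist (of_rat (q n)) (S m)" by (rule dist_triangle2)
        also have "dist (of_rat (q n)) (S m) \<le> dist (of_rat (q n)) (S n) + dist (S m) (S n)"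
          by (rule dist_triangle2)
        finally have "dist (of_rat (q m)) (of_rat (q n) :: 'a padic) < e"
          using M[of m n] K'[of m] K'[of n] mn by (simp add: dist_commute)
        thus "rat_abs (pplace TYPE('a)) (q m - q n) < e"
          by (simp add: dist_padic_def padic_abs_of_rat of_rat_diff[symmetric])
      qed
    qed
    note qC = padic_approx[OF this]
    define x :: "'a padic" where "x = abs_padic (Abs_rat_cauchy q)"
    show ?thesis
    proof -
      have "\<exists>N. \<forall>n\<ge>N. dist (S n) x < e" if "e > 0" for e
      proof -
        have e: "e / 2 > 0" using that by simp
        obtain M where M: "\<And>n. n \<ge> M \<Longrightarrow> dist x (of_rat (q n)) < e / 2"
          using qC[OF e] unfolding x_def dist_padic_def by blast
        obtain K where K: "inverse (real (Suc K)) < e / 2" using reals_Archimedean[OF e] by blast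
        show ?thesis
        proof (intro exI[of _ "max M K"] allI impI)
          fix n assume n: "max M K \<le> n"
          have "inverse (real (Suc n)) \<le> inverse (real (Suc K))" using n by simp
          thus "dist (S n) x < e"
            using dist_triangle2[of "S n" x "of_rat (q n)"] q[of n] K M[of n] n by linarith
        qed
      qed
      thus ?thesis unfolding convergent_def lim_sequentially by blast
    qed
  qed
qed

instantiation padic :: (prime_card) rat_completion
begin

definition place_of_padic :: "'a padic itself \<Rightarrow> place" where
  "place_of_padic _ = Prime_place CARD('a)"

definition vabs_padic :: "'a padic \<Rightarrow> real" where
  "vabs_padic x = padic_abs x"

instance
proof
  fix x y :: "'a padic" and e :: real
  show "0 < e \<Longrightarrow> \<exists>q. dist x (of_rat q) < e" by (rule padic_dense)
qed (auto simp: place_of_padic_def vabs_padic_def padic_abs_mult padic_abs_of_rat dist_padic_def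
    )

end

text \<open>
  The element 0 only makes the maximum meaningful for an empty index set, which occurs for the
  wedge product of vectors with one coordinate.
\<close>

definition place_norm :: "place \<Rightarrow> ('k \<Rightarrow> real) \<Rightarrow> 'i set \<Rightarrow> ('i \<Rightarrow> 'k) \<Rightarrow> real" where
  "place_norm v a I x = (case v of
     Prime_place p \<Rightarrow> Max (insert 0 ((\<lambda>i. a (x i)) ` I))
   | Infinite_place \<Rightarrow> L2_set (\<lambda>i. a (x i)) I)"

lemma place_norm_scale:
  assumes "finite I" "\<And>x. a (c * x) = a c * a x" "a c \<ge> 0"
  shows "place_norm v a I (\<lambda>i. c * x i) = a c * place_norm v a I x"
proof (cases v)
  case (Prime_place p)
  have "mono ((*) (a c))" using assms by (auto intro!: monoI mult_left_mono)
  from mono_Max_commute[OF this, of "insert 0 ((\<lambda>i. a (x i)) ` I)"] assms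
  show ?thesis by (simp add: place_norm_def Prime_place image_image)
next
  case Infinite_place
  thus ?thesis using assms by (simp add: place_norm_def L2_set_right_distrib)
qed

definition rat_vec_norm :: "place \<Rightarrow> rat ^ 'n \<Rightarrow> real" where
  "rat_vec_norm v y = place_norm v (rat_abs v) UNIV (($) y)"

definition vec_vabs :: "('k :: rat_completion) ^ 'n \<Rightarrow> real" where
  "vec_vabs x = place_norm (place_of TYPE('k)) vabs UNIV (($) x)"

definition wedge_vabs :: "('k :: rat_completion, 'n :: {finite, linorder}) vec \<Rightarrow> ('k, 'n) vec \<Rightarrow> real" where
  "wedge_vabs x y = place_norm (place_of TYPE('k)) vabs {(i, j). i < j}
                      (\<lambda>(i, j). x $ i * y $ j - x $ j * y $ i)"

lemma vec_vabs_scale: "vec_vabs (c *s x) = vabs c * vec_vabs x"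
proof -
  have "($) (c *s x) = (\<lambda>i. c * x $ i)" by (simp add: fun_eq_iff)
  thus ?thesis
    using place_norm_scale[of UNIV vabs c _ "($) x"] by (simp add: vec_vabs_def vabs_mult)
qed

lemma wedge_vabs_scale: "wedge_vabs (c *s x) (d *s y) = vabs c * vabs d * wedge_vabs x y"
proof -
  let ?w = "\<lambda>(i, j). x $ i * y $ j - x $ j * y $ i"
  have eq: "(\<lambda>(i, j). (c *s x) $ i * (d *s y) $ j - (c *s x) $ j * (d *s y) $ i)
          = (\<lambda>ij. (c * d) * ?w ij)"
    by (auto simp: fun_eq_iff algebra_simps)
  have "finite {(i :: 'b, j). i < j}" by (rule finite_subset[OF subset_UNIV]) simp
  thus ?thesis
    unfolding wedge_vabs_def eq by (subst place_norm_scale) (simp_all add: vabs_mult)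
qed

quotient_type (overloaded) ('k, 'n) proj = "('k :: field) ^ ('n :: finite)" / partial:
  "\<lambda>x y. x \<noteq> 0 \<and> y \<noteq> 0 \<and> (\<exists>c. c \<noteq> 0 \<and> y = c *s x)"
proof (rule part_equivpI)
  let ?R = "\<lambda>x y :: 'k ^ 'n. x \<noteq> 0 \<and> y \<noteq> 0 \<and> (\<exists>c. c \<noteq> 0 \<and> y = c *s x)"
  show "\<exists>x. ?R x x" by (intro exI[of _ 1]) (auto intro!: exI[of _ 1])
  show "symp ?R"
  proof (rule sympI)
    fix x y :: "'k ^ 'n" assume "?R x y"
    then obtain c where c: "x \<noteq> 0" "y \<noteq> 0" "c \<noteq> 0" "y = c *s x" by auto
    hence "x = inverse c *s y" by (simp add: vector_smult_assoc)
    with c show "?R y x" by (metis inverse_zero_imp_zero)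
  qed
  show "transp ?R"
    by (rule transpI) (metis mult_eq_0_iff vector_smult_assoc)
qed

lift_definition proj_dist :: "('k :: rat_completion, 'n :: {finite, linorder}) proj \<Rightarrow> ('k, 'n) proj \<Rightarrow> real"
  is "\<lambda>x y. wedge_vabs x y / (vec_vabs x * vec_vabs y)"
  by (auto simp: wedge_vabs_scale vec_vabs_scale)

lift_definition proj_of_rat :: "(rat, 'n :: finite) proj \<Rightarrow> ('k :: field_char_0, 'n) proj"
  is "\<lambda>y. \<chi> i. of_rat (y $ i)"
proof -
  fix x y :: "rat ^ 'n"
  assume "x \<noteq> 0 \<and> y \<noteq> 0 \<and> (\<exists>c. c \<noteq> 0 \<and> y = c *s x)"
  then obtain c where c: "x \<noteq> 0" "y \<noteq> 0" "c \<noteq> 0" "y = c *s x" by auto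
  show "(\<chi> i. of_rat (x $ i) :: 'k ^ 'n) \<noteq> 0 \<and> (\<chi> i. of_rat (y $ i) :: 'k ^ 'n) \<noteq> 0 \<and>
    (\<exists>c. c \<noteq> 0 \<and> (\<chi> i. of_rat (y $ i) :: 'k ^ 'n) = c *s (\<chi> i. of_rat (x $ i)))"
  proof (intro conjI exI[of _ "of_rat c"])
    show "(\<chi> i. of_rat (y $ i) :: 'k ^ 'n) = of_rat c *s (\<chi> i. of_rat (x $ i))"
      using c by (simp add: vec_eq_iff of_rat_mult)
  qed (use c(1-3) in \<open>auto simp: vec_eq_iff\<close>)
qed

text \<open>
  The product over all places, restricted to the finitely many factors different from 1
  (see \<open>finite_rat_vec_norm_neq_1\<close>).
\<close>

definition rat_vec_height :: "rat ^ 'n \<Rightarrow> real" where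
  "rat_vec_height y = (\<Prod>v | v \<in> places \<and> rat_vec_norm v y \<noteq> 1. rat_vec_norm v y)"

lemma prod_prime_power_multiplicity:
  assumes "a \<noteq> 0" "finite T" "\<And>p. p \<in> T \<Longrightarrow> prime p" "prime_factors a \<subseteq> int ` T"
  shows "(\<Prod>p\<in>T. real p ^ multiplicity (int p) a) = \<bar>real_of_int a\<bar>"
proof -
  have "(\<Prod>p\<in>int ` T. p ^ multiplicity p a) = (\<Prod>p\<in>prime_factors a. p ^ multiplicity p a)"
  proof (rule prod.mono_neutral_right)
    show "\<forall>p\<in>int ` T - prime_factors a. p ^ multiplicity p a = 1"
    proof
      fix p assume p: "p \<in> int ` T - prime_factors a"
      hence "prime p" using assms(3) by auto
      hence "\<not> p dvd a" using p assms(1) by (auto simp: prime_factors_dvd)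
      thus "p ^ multiplicity p a = 1" by (simp add: not_dvd_imp_multiplicity_0)
    qed
  qed (use assms in auto)
  also have "\<dots> = \<bar>a\<bar>" using prod_prime_factors[OF assms(1)] by simp
  finally have "real_of_int (\<Prod>p\<in>int ` T. p ^ multiplicity p a) = \<bar>real_of_int a\<bar>" by simp
  thus ?thesis by (simp add: prod.reindex inj_on_def)
qed

lemma rat_abs_exceptional:
  assumes "q \<noteq> 0"
  obtains T where "finite T" "\<And>p. p \<in> T \<Longrightarrow> prime p"
    "\<And>p. prime p \<Longrightarrow> p \<notin> T \<Longrightarrow> rat_abs (Prime_place p) q = 1"
    "\<And>T'. finite T' \<Longrightarrow> T \<subseteq> T' \<Longrightarrow> (\<And>p. p \<in> T' \<Longrightarrow> prime p) \<Longrightarrow>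
       (\<Prod>p\<in>T'. rat_abs (Prime_place p) q) * \<bar>of_rat q\<bar> = 1"
proof -
  obtain a b where q: "q = of_int a / of_int b" "b > 0" by (rule rat_fracE)
  have nz: "a \<noteq> 0" "b \<noteq> 0" using assms q by auto
  define T where "T = {p. prime p \<and> (int p dvd a \<or> int p dvd b)}"
  have sub: "prime_factors c \<subseteq> int ` T" if "c = a \<or> c = b" for c
  proof
    fix p assume "p \<in> prime_factors c"
    hence p: "prime p" "p dvd c" by auto
    hence "p = int (nat p)" "prime (nat p)" using prime_ge_0_int by auto
    thus "p \<in> int ` T" using that p by (auto simp: T_def intro!: image_eqI[of _ _ "nat p"])
  qed
  have "T \<subseteq> nat ` (prime_factors a \<union> prime_factors b)"
  proof
    fix p assume "p \<in> T"
    hence "int p \<in> prime_factors a \<union> prime_factors b"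
      using nz by (auto simp: T_def prime_factors_dvd)
    thus "p \<in> nat ` (prime_factors a \<union> prime_factors b)"
      by (rule image_eqI[rotated]) simp
  qed
  hence fin: "finite T" by (rule finite_subset) simp
  have val: "rat_abs (Prime_place p) q
           = real p ^ multiplicity (int p) b / real p ^ multiplicity (int p) a" if "prime p" for p
  proof -
    have "real p \<noteq> 0" using that by auto
    thus ?thesis
      using rat_valuation_frac[OF that nz] assms q(1)
      by (simp add: rat_abs.simps power_int_diff)
  qed
  show ?thesis
  proof (rule that[of T])
    fix p assume "prime p" "p \<notin> T"
    thus "rat_abs (Prime_place p) q = 1"
      by (simp add: val T_def not_dvd_imp_multiplicity_0)
  next
    fix T' assume T': "finite T'" "T \<subseteq> T'" "\<And>p. p \<in> T' \<Longrightarrow> prime p"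
    have sub': "prime_factors c \<subseteq> int ` T'" if "c = a \<or> c = b" for c
      using sub[OF that] T'(2) by blast
    have "(\<Prod>p\<in>T'. rat_abs (Prime_place p) q)
        = (\<Prod>p\<in>T'. real p ^ multiplicity (int p) b / real p ^ multiplicity (int p) a)"
      using T' by (intro prod.cong) (auto simp: val)
    also have "\<dots> = \<bar>real_of_int b\<bar> / \<bar>real_of_int a\<bar>"
      using prod_prime_power_multiplicity[of a T'] prod_prime_power_multiplicity[of b T']
        sub' T' nz by (simp add: prod_dividef)
    finally show "(\<Prod>p\<in>T'. rat_abs (Prime_place p) q) * \<bar>of_rat q\<bar> = 1"
      using nz q(1) by (simp add: of_rat_divide abs_divide)
  qed (use fin in \<open>auto simp: T_def\<close>)
qed

lemma finite_rat_vec_norm_neq_1: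
  assumes "(y :: rat ^ 'n) \<noteq> 0"
  shows "finite {v \<in> places. rat_vec_norm v y \<noteq> 1}"
proof -
  have "\<exists>T. finite T \<and> (\<forall>p. prime p \<longrightarrow> p \<notin> T \<longrightarrow> rat_abs (Prime_place p) (y $ i) = 1)"
    if "y $ i \<noteq> 0" for i
    using rat_abs_exceptional[OF that] by metis
  then obtain T where T: "\<And>i. y $ i \<noteq> 0 \<Longrightarrow> finite (T i)"
    "\<And>i p. y $ i \<noteq> 0 \<Longrightarrow> prime p \<Longrightarrow> p \<notin> T i \<Longrightarrow> rat_abs (Prime_place p) (y $ i) = 1"
    by metis
  let ?U = "\<Union>i\<in>{i. y $ i \<noteq> 0}. T i"
  obtain k where k: "y $ k \<noteq> 0" using assms by (auto simp: vec_eq_iff)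
  have "rat_vec_norm (Prime_place p) y = 1" if p: "prime p" "p \<notin> ?U" for p
  proof -
    have 1: "rat_abs (Prime_place p) (y $ i) = 1" if "y $ i \<noteq> 0" for i
      using T(2)[OF that p(1)] p(2) that by blast
    have "Max (insert 0 (range (\<lambda>i. rat_abs (Prime_place p) (y $ i)))) = 1"
    proof (rule Max_eqI)
      fix t assume "t \<in> insert 0 (range (\<lambda>i. rat_abs (Prime_place p) (y $ i)))"
      then consider "t = 0" | i where "t = rat_abs (Prime_place p) (y $ i)" by auto
      thus "t \<le> 1"
      proof cases
        case (2 i)
        thus ?thesis using 1[of i] by (cases "y $ i = 0") auto
      qed simp
    next
      show "1 \<in> insert 0 (range (\<lambda>i. rat_abs (Prime_place p) (y $ i)))"
        using 1[OF k] by (metis insertI2 rangeI)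
    qed simp
    thus ?thesis by (simp add: rat_vec_norm_def place_norm_def)
  qed
  hence "{v \<in> places. rat_vec_norm v y \<noteq> 1} \<subseteq> insert Infinite_place (Prime_place ` ?U)"
    by (auto simp: places_def)
  moreover have "finite ?U" using T(1) by (intro finite_UN_I) auto
  ultimately show ?thesis using finite_subset by blast
qed

lemma rat_vec_norm_scale: "v \<in> places \<Longrightarrow> rat_vec_norm v (c *s y) = rat_abs v c * rat_vec_norm v y"
proof -
  assume "v \<in> places"
  moreover have "($) (c *s y) = (\<lambda>i. c * y $ i)" by (simp add: fun_eq_iff)
  ultimately show ?thesis
    using place_norm_scale[of UNIV "rat_abs v" c v "($) y"]
    by (simp add: rat_vec_norm_def rat_abs_mult)
qed

lemma rat_vec_height_scale:
  assumes "c \<noteq> 0" "y \<noteq> 0"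
  shows "rat_vec_height (c *s y) = rat_vec_height y"
proof -
  have cy: "c *s y \<noteq> 0" using assms by (auto simp: vec_eq_iff)
  obtain T where T: "finite T" "\<And>p. p \<in> T \<Longrightarrow> prime p"
    "\<And>T'. finite T' \<Longrightarrow> T \<subseteq> T' \<Longrightarrow> (\<And>p. p \<in> T' \<Longrightarrow> prime p) \<Longrightarrow>
       (\<Prod>p\<in>T'. rat_abs (Prime_place p) c) * \<bar>of_rat c\<bar> = 1"
    by (rule rat_abs_exceptional[OF assms(1)]) blast
  define E where "E = {v \<in> places. rat_vec_norm v y \<noteq> 1} \<union> {v \<in> places. rat_vec_norm v (c *s y) \<noteq> 1}"
  define U where "U = T \<union> {p. Prime_place p \<in> E}"
  let ?S = "insert Infinite_place (Prime_place ` U)"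
  have finE: "finite E"
    unfolding E_def using finite_rat_vec_norm_neq_1 assms cy by blast
  have "{p. Prime_place p \<in> E} = Prime_place -` E" by auto
  moreover have "finite (Prime_place -` E)"
    using finE by (intro finite_vimageI) (auto simp: inj_on_def)
  ultimately have finU: "finite U" using T by (simp add: U_def)
  have primeU: "prime p" if "p \<in> U" for p
    using that T(2) by (auto simp: U_def E_def places_def)
  have S: "?S \<subseteq> places" using primeU by (auto simp: places_def)
  have ES: "E \<subseteq> ?S" by (auto simp: U_def E_def places_def)
  have finS: "finite ?S" using finU by simp
  have H: "rat_vec_height z = (\<Prod>v\<in>?S. rat_vec_norm v z)"
    if "{v \<in> places. rat_vec_norm v z \<noteq> 1} \<subseteq> E" for z :: "rat ^ 'a"
    unfolding rat_vec_height_def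
    using that S ES finS by (intro prod.mono_neutral_left) auto
  have "rat_vec_height (c *s y) = (\<Prod>v\<in>?S. rat_vec_norm v (c *s y))" by (rule H) (auto simp: E_def)
  also have "\<dots> = (\<Prod>v\<in>?S. rat_abs v c) * (\<Prod>v\<in>?S. rat_vec_norm v y)"
    unfolding prod.distrib[symmetric] using S by (intro prod.cong) (auto simp: rat_vec_norm_scale)
  also have "(\<Prod>v\<in>?S. rat_abs v c) = rat_abs Infinite_place c * (\<Prod>p\<in>U. rat_abs (Prime_place p) c)"
    using finU by (subst prod.insert) (auto simp: prod.reindex inj_on_def)
  also have "\<dots> = 1" using T(3)[OF finU _ primeU] by (simp add: U_def rat_abs.simps mult.commute)
  also have "(\<Prod>v\<in>?S. rat_vec_norm v y) = rat_vec_height y" by (rule H[symmetric]) (auto simp: E_def)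
  finally show ?thesis by simp
qed

lift_definition proj_height :: "(rat, 'n :: finite) proj \<Rightarrow> real" is rat_vec_height
  by (auto simp: rat_vec_height_scale)

definition unit_ball :: "('k :: rat_completion ^ 'n :: finite) set" where
  "unit_ball = {x. vec_vabs x \<le> 1}"

text \<open>\<open>abs_proj\<close> is the quotient map; it is meaningful only on nonzero vectors.\<close>

definition proj_measure ::
  "('k :: rat_completion ^ 'n :: finite) measure \<Rightarrow> ('k, 'n) proj set \<Rightarrow> real" where
  "proj_measure \<beta> M =
     measure \<beta> ({x. x \<noteq> 0 \<and> abs_proj x \<in> M} \<inter> unit_ball) / measure \<beta> unit_ball"

text \<open>
  Translation invariant Borel measures that give the compact open subgroup of integral vectors
  measure 1. By Haar's theorem there is exactly one, so the definite description below denotes.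
\<close>

definition is_haar_measure :: "('p :: prime_card padic ^ 'n :: finite) measure \<Rightarrow> bool" where
  "is_haar_measure \<beta> \<longleftrightarrow>
     sets \<beta> = sets borel \<and>
     (\<forall>a. \<forall>A\<in>sets borel. emeasure \<beta> ((\<lambda>x. a + x) ` A) = emeasure \<beta> A) \<and>
     emeasure \<beta> {x. \<forall>i. vabs (x $ i) \<le> 1} = 1"

definition padic_haar :: "('p :: prime_card padic ^ 'n :: finite) measure" where
  "padic_haar = (THE \<beta>. is_haar_measure \<beta>)"

definition approximable ::
  "(real \<Rightarrow> real) \<Rightarrow> ('k :: rat_completion, 'n :: {finite, linorder}) proj set" where
  "approximable \<psi> =
     {x. infinite {y :: (rat, 'n) proj. proj_dist x (proj_of_rat y) \<le> \<psi> (proj_height y)}}"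

end

theory Submission
  imports Defs
begin

text \<open>
  Write \<open>m = n - 1\<close> and \<open>b = 2\<close> at the real place, \<open>b = p\<close> at a prime \<open>p\<close>. In the chart
  \<open>x \<mapsto> x / x\<^sub>i\<close> the measure of a ball of radius \<open>r\<close> is comparable to \<open>r ^ m\<close>. By the pigeonhole
  principle every point is within \<open>c / (H(y) * N powr (1 / m))\<close> (real place), respectively within
  \<open>c * N powr (- n / m)\<close> up to powers of \<open>p\<close> dividing \<open>y\<close> (prime place), of an integral
  vector \<open>y\<close> of height at most \<open>N = b ^ (m * t)\<close>. Counting shows that the \<open>y\<close> of much smaller height,
  or highly divisible by \<open>p\<close>, account for little of any given ball once \<open>t\<close> is large. Hence a fixed
  proportion of the ball is covered by the balls of radius \<open>\<rho> = A * b ^ (- n * t)\<close> around the points of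
  height at most \<open>N\<close>, and a maximal separated subset provides about \<open>\<rho> ^ (- m)\<close> of them per
  unit of measure. Their separation makes the unions of the balls of radius
  \<open>min (\<psi> N) \<rho>\<close> quasi-independent for different \<open>t\<close>, so the Chung--Erdos inequality gives a
  limsup set occupying a fixed proportion of every ball, and a density argument completes the proof.
\<close>

section \<open>Limsup sets of balls around ubiquitous points\<close>

lemma (in finite_measure) chung_erdos:
  fixes A :: "'i \<Rightarrow> 'a set"
  assumes fin: "finite I" and A: "\<And>i. i \<in> I \<Longrightarrow> A i \<in> sets M"
  shows "(\<Sum>i\<in>I. measure M (A i))\<^sup>2
    \<le> measure M (\<Union>i\<in>I. A i) * (\<Sum>i\<in>I. \<Sum>j\<in>I. measure M (A i \<inter> A j))"
proof -
  let ?U = "\<Union>i\<in>I. A i"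
  define S where "S = (\<Sum>i\<in>I. measure M (A i))"
  define D where "D = (\<Sum>i\<in>I. \<Sum>j\<in>I. measure M (A i \<inter> A j))"
  define u where "u = measure M ?U"
  have U: "?U \<in> sets M" using fin A by auto
  have key: "0 \<le> D - 2 * l * S + l\<^sup>2 * u" for l
  proof -
    let ?f = "\<lambda>x. (\<Sum>i\<in>I. indicator (A i) x :: real)"
    have "0 \<le> (\<integral>x. (?f x - l * indicator ?U x)\<^sup>2 \<partial>M)" by simp
    also have "(\<lambda>x. (?f x - l * indicator ?U x)\<^sup>2)
      = (\<lambda>x. (\<Sum>i\<in>I. \<Sum>j\<in>I. indicator (A i \<inter> A j) x) - 2 * l * ?f x + l\<^sup>2 * indicator ?U x)"
    proof
      fix x
      have 1: "?f x * ?f x = (\<Sum>i\<in>I. \<Sum>j\<in>I. indicator (A i \<inter> A j) x)"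
        by (simp add: sum_product indicator_inter_arith)
      have 2: "?f x * indicator ?U x = ?f x"
      proof (cases "x \<in> ?U")
        case False
        hence "?f x = 0" by (intro sum.neutral) (auto simp: indicator_def)
        thus ?thesis by simp
      next
        case True
        hence "indicator ?U x = (1 :: real)" by (rule indicator_simps(1))
        thus ?thesis by (simp only: mult_1_right)
      qed
      have 3: "indicator V x * indicator V x = (indicator V x :: real)" for V
        by (simp add: indicator_def)
      have "(?f x - l * indicator ?U x)\<^sup>2 = ?f x * ?f x - 2 * l * (?f x * indicator ?U x)
         + l\<^sup>2 * (indicator ?U x * indicator ?U x)"
        by (simp only: power2_eq_square) (simp add: algebra_simps)
      thus "(?f x - l * indicator ?U x)\<^sup>2 = (\<Sum>i\<in>I. \<Sum>j\<in>I. indicator (A i \<inter> A j) x) - 2 * l * ?f x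
         + l\<^sup>2 * indicator ?U x" by (simp only: 1 2 3)
    qed
    also have "(\<integral>x. ((\<Sum>i\<in>I. \<Sum>j\<in>I. indicator (A i \<inter> A j) x) - 2 * l * ?f x
         + l\<^sup>2 * indicator ?U x) \<partial>M) = D - 2 * l * S + l\<^sup>2 * u"
      unfolding D_def S_def u_def using A U
      by (simp add: Bochner_Integration.integral_sum integrable_real_indicator emeasure_eq_measure)
    finally show ?thesis .
  qed
  have "S\<^sup>2 \<le> u * D"
  proof (cases "u = 0")
    case True
    have "measure M (A i) = 0" if "i \<in> I" for i
    proof -
      have "measure M (A i) \<le> u" unfolding u_def using that U by (intro finite_measure_mono) auto
      thus ?thesis using True measure_nonneg[of M "A i"] by linarith
    qed
    hence "S = 0" by (simp add: S_def)
    thus ?thesis using True by simp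
  next
    case False
    hence u: "u > 0" by (simp add: u_def zero_less_measure_iff)
    from key[of "S / u"] u have "0 \<le> (D * u - S\<^sup>2) / u"
      by (simp add: power2_eq_square field_simps)
    thus ?thesis using u by (simp add: zero_le_divide_iff mult.commute)
  qed
  thus ?thesis by (simp add: S_def D_def u_def)
qed

lemma sum_geometric_le:
  fixes l :: real
  assumes "0 < l" "l < 1"
  shows "(\<Sum>s\<in>{s\<in>I. s \<le> t}. l ^ (t - s)) \<le> 1 / (1 - l)"
proof -
  have "(\<Sum>s\<in>{s\<in>I. s \<le> t}. l ^ (t - s)) \<le> (\<Sum>s\<le>t. l ^ (t - s))"
    using assms by (intro sum_mono2) auto
  also have "\<dots> = (\<Sum>s\<le>t. l ^ s)"
    by (rule sum.reindex_bij_witness[of _ "\<lambda>s. t - s" "\<lambda>s. t - s"]) auto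
  also have "\<dots> \<le> (\<Sum>s. l ^ s)"
    using assms by (intro sum_le_suminf summable_geometric) auto
  also have "\<dots> = 1 / (1 - l)" using assms by (intro suminf_geometric) auto
  finally show ?thesis .
qed

lemma (in finite_measure) limsup_lower_bound:
  fixes A :: "nat \<Rightarrow> 'a set" and a :: "nat \<Rightarrow> real"
  assumes A: "\<And>t. A t \<in> sets M" and pos: "0 < c" "0 < C" "0 < V" "0 < l" "l < 1"
    and a: "\<And>t. 0 \<le> a t" "\<not> summable a"
    and lower: "\<And>t. t0 \<le> t \<Longrightarrow> c * V * a t \<le> measure M (A t)"
    and overlap: "\<And>s t. t0 \<le> s \<Longrightarrow> s \<le> t \<Longrightarrow>
      measure M (A s \<inter> A t) \<le> C * V * (a s * a t + l ^ (t - s) * a t)"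
  shows "c\<^sup>2 * (1 - l) / (3 * C) * V \<le> measure M (\<Inter>n. \<Union>t\<in>{n..}. A t)"
proof -
  let ?B = "\<lambda>n. \<Union>t\<in>{n..}. A t"
  have B: "?B n \<in> sets M" for n using A by auto
  have bound: "c\<^sup>2 * (1 - l) / (3 * C) * V \<le> measure M (?B n)" for n
  proof -
    define k where "k = max n t0"
    obtain T where T: "1 < (\<Sum>t\<in>{k..<T}. a t)"
    proof -
      have "\<not> summable (\<lambda>t. a (t + k))" using a(2) by (simp add: summable_iff_shift)
      then obtain N where N: "\<not> (\<Sum>t<N. a (t + k)) \<le> 1"
        using bounded_imp_summable[of "\<lambda>t. a (t + k)" 1] a(1)
        by (metis lessThan_Suc_atMost)
      have "(\<Sum>t<N. a (t + k)) = (\<Sum>t\<in>{k..<N + k}. a t)"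
        by (rule sum.reindex_bij_witness[of _ "\<lambda>t. t - k" "\<lambda>t. t + k"]) auto
      with N have "1 < (\<Sum>t\<in>{k..<N + k}. a t)" by linarith
      thus ?thesis by (rule that)
    qed
    define I where "I = {k..<T}"
    define S where "S = (\<Sum>t\<in>I. a t)"
    have S: "1 < S" using T by (simp add: S_def I_def)
    have I: "finite I" "\<And>t. t \<in> I \<Longrightarrow> t0 \<le> t" "\<And>t. t \<in> I \<Longrightarrow> n \<le> t"
      by (auto simp: I_def k_def)
    let ?h = "\<lambda>s t. if s \<le> t then l ^ (t - s) * a t else 0"
    have ov: "measure M (A s \<inter> A t) \<le> C * V * (a s * a t + ?h s t + ?h t s)" if "s \<in> I" "t \<in> I" for s t
    proof (cases "s \<le> t")
      case True
      have "measure M (A s \<inter> A t) \<le> C * V * (a s * a t + l ^ (t - s) * a t)"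
        using overlap[of s t] True I that by auto
      also have "\<dots> \<le> C * V * (a s * a t + ?h s t + ?h t s)"
        using pos a(1)[of s] True by (intro mult_left_mono) auto
      finally show ?thesis .
    next
      case False
      have "measure M (A t \<inter> A s) \<le> C * V * (a t * a s + l ^ (s - t) * a s)"
        using overlap[of t s] False I that by auto
      thus ?thesis using False by (simp add: Int_commute mult.commute)
    qed
    have hsum: "(\<Sum>s\<in>I. \<Sum>t\<in>I. ?h s t) \<le> S / (1 - l)"
    proof -
      have "(\<Sum>s\<in>I. \<Sum>t\<in>I. ?h s t) = (\<Sum>t\<in>I. \<Sum>s\<in>I. ?h s t)" by (rule sum.swap)
      also have "\<dots> = (\<Sum>t\<in>I. a t * (\<Sum>s\<in>{s\<in>I. s \<le> t}. l ^ (t - s)))"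
        using I(1) by (intro sum.cong refl)
          (auto simp: sum_distrib_left sum.inter_filter mult.commute intro!: sum.cong)
      also have "\<dots> \<le> (\<Sum>t\<in>I. a t * (1 / (1 - l)))"
        using a(1) pos by (intro sum_mono mult_left_mono sum_geometric_le) auto
      also have "\<dots> = S / (1 - l)" by (simp add: S_def sum_divide_distrib)
      finally show ?thesis .
    qed
    have hsum2: "(\<Sum>s\<in>I. \<Sum>t\<in>I. ?h t s) \<le> S / (1 - l)"
      by (subst sum.swap) (rule hsum)
    have "(\<Sum>s\<in>I. \<Sum>t\<in>I. measure M (A s \<inter> A t))
      \<le> (\<Sum>s\<in>I. \<Sum>t\<in>I. C * V * (a s * a t + ?h s t + ?h t s))"
      using ov by (intro sum_mono)
    also have "\<dots> = C * V * (S * S + (\<Sum>s\<in>I. \<Sum>t\<in>I. ?h s t) + (\<Sum>s\<in>I. \<Sum>t\<in>I. ?h t s))"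
      by (simp add: sum_distrib_left[symmetric] sum.distrib S_def sum_product del: mult_eq_0_iff)
    also have "\<dots> \<le> C * V * (S\<^sup>2 * (3 / (1 - l)))"
    proof -
      have "S * S + S / (1 - l) + S / (1 - l) \<le> S\<^sup>2 * (3 / (1 - l))"
      proof -
        have "S * 1 \<le> S * S" using S by (intro mult_left_mono) auto
        hence "S / (1 - l) \<le> S * S / (1 - l)" using pos by (intro divide_right_mono) auto
        moreover have "S * S * 1 \<le> S * S * (1 / (1 - l))"
          using pos by (intro mult_left_mono) (auto simp: field_simps)
        moreover have "S\<^sup>2 * (3 / (1 - l)) = S * S / (1 - l) + S * S / (1 - l) + S * S / (1 - l)"
          unfolding power2_eq_square by simp
        ultimately show ?thesis unfolding power2_eq_square by linarith
      qed
      thus ?thesis using hsum hsum2 pos by (intro mult_left_mono) auto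
    qed
    finally have D: "(\<Sum>s\<in>I. \<Sum>t\<in>I. measure M (A s \<inter> A t)) \<le> C * V * (S\<^sup>2 * (3 / (1 - l)))" .
    define u where "u = measure M (\<Union>t\<in>I. A t)"
    have "(c * V * S)\<^sup>2 \<le> (\<Sum>t\<in>I. measure M (A t))\<^sup>2"
    proof (rule power_mono)
      show "c * V * S \<le> (\<Sum>t\<in>I. measure M (A t))"
        unfolding S_def sum_distrib_left using lower I by (intro sum_mono) auto
    qed (use pos S in auto)
    also have "\<dots> \<le> u * (\<Sum>s\<in>I. \<Sum>t\<in>I. measure M (A s \<inter> A t))"
      unfolding u_def by (rule chung_erdos) (use I A in auto)
    also have "\<dots> \<le> u * (C * V * (S\<^sup>2 * (3 / (1 - l))))"
      using D by (intro mult_left_mono) (auto simp: u_def)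
    finally have "(V * S\<^sup>2) * (c\<^sup>2 * V) \<le> (V * S\<^sup>2) * (u * C * (3 / (1 - l)))"
      by (simp add: power2_eq_square algebra_simps)
    moreover have "V * S\<^sup>2 > 0" using pos S by auto
    ultimately have "c\<^sup>2 * V \<le> u * C * (3 / (1 - l))" by (simp only: mult_le_cancel_left_pos)
    hence "c\<^sup>2 * (1 - l) / (3 * C) * V \<le> u" using pos by (simp add: field_simps)
    also have "u \<le> measure M (?B n)"
      unfolding u_def using I B by (intro finite_measure_mono) auto
    finally show ?thesis .
  qed
  have "(\<lambda>n. measure M (?B n)) \<longlonglongrightarrow> measure M (\<Inter>n. ?B n)"
  proof (rule finite_Lim_measure_decseq)
    show "range ?B \<subseteq> sets M" using B by auto
    show "decseq ?B" by (auto simp: decseq_def intro: order_trans)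
  qed
  thus ?thesis using bound by (intro LIMSEQ_le_const) auto
qed

lemma maximal_separated:
  fixes F :: "'a :: metric_space set"
  assumes "finite F" "0 \<le> d"
  obtains J where "J \<subseteq> F" "\<And>x y. x \<in> J \<Longrightarrow> y \<in> J \<Longrightarrow> x \<noteq> y \<Longrightarrow> d < dist x y"
    "\<And>x. x \<in> F \<Longrightarrow> \<exists>y\<in>J. dist x y \<le> d"
proof -
  have "\<exists>J\<subseteq>F. (\<forall>x\<in>J. \<forall>y\<in>J. x \<noteq> y \<longrightarrow> d < dist x y) \<and> (\<forall>x\<in>F. \<exists>y\<in>J. dist x y \<le> d)"
    using assms(1)
  proof (induction F)
    case (insert x F)
    then obtain J where J: "J \<subseteq> F" "\<forall>x\<in>J. \<forall>y\<in>J. x \<noteq> y \<longrightarrow> d < dist x y"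
      "\<forall>x\<in>F. \<exists>y\<in>J. dist x y \<le> d" by blast
    show ?case
    proof (cases "\<exists>y\<in>J. dist x y \<le> d")
      case True
      with J show ?thesis by (intro exI[of _ J]) auto
    next
      case False
      with J assms(2) show ?thesis
        by (intro exI[of _ "insert x J"]) (auto simp: dist_commute not_le)
    qed
  qed simp
  then obtain J where "J \<subseteq> F" "\<forall>x\<in>J. \<forall>y\<in>J. x \<noteq> y \<longrightarrow> d < dist x y"
    "\<forall>x\<in>F. \<exists>y\<in>J. dist x y \<le> d" by blast
  thus ?thesis by (intro that) auto
qed

text \<open>
  A weak form of the Lebesgue density theorem: a compact piece of the complement of \<open>L\<close> is covered
  with few overlaps by balls inside a slightly larger open set, each containing a fixed portion of \<open>L\<close>.
\<close>

lemma full_measure_if_positive_in_balls: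
  fixes M :: "'a :: {second_countable_topology, complete_space} measure"
  assumes "finite_measure M" and M: "sets M = sets borel"
    and X: "X \<in> sets borel" and L: "L \<in> sets borel" and pos: "0 < C" "0 < k"
    and upper: "\<And>x r. x \<in> X \<Longrightarrow> 0 < r \<Longrightarrow> measure M (cball x r) \<le> C * r ^ m"
    and local: "\<And>x r. x \<in> X \<Longrightarrow> 0 < r \<Longrightarrow> r \<le> 1 \<Longrightarrow> k * r ^ m \<le> measure M (cball x r \<inter> L)"
  shows "measure M (X - L) = 0"
proof (rule ccontr)
  interpret finite_measure M by fact
  assume "measure M (X - L) \<noteq> 0"
  hence "emeasure M (X - L) > 0" by (simp add: emeasure_eq_measure zero_less_measure_iff)
  also have "emeasure M (X - L) = (SUP K\<in>{K. K \<subseteq> X - L \<and> compact K}. emeasure M K)"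
    by (rule inner_regular) (use M X L in \<open>auto simp: emeasure_eq_measure\<close>)
  finally obtain K where K: "K \<subseteq> X - L" "compact K" "emeasure M K > 0"
    by (auto simp: less_SUP_iff)
  have Kset: "K \<in> sets borel" using K(2) by (simp add: borel_closed compact_imp_closed)
  define d where "d = measure M K"
  have d: "d > 0" using K(3) by (simp add: d_def emeasure_eq_measure)
  define e where "e = k * d / (2 * C * 3 ^ m)"
  have e: "e > 0" using pos d by (simp add: e_def)
  have "emeasure M K = (INF U\<in>{U. K \<subseteq> U \<and> open U}. emeasure M U)"
    by (rule outer_regular) (use M Kset in \<open>auto simp: emeasure_eq_measure\<close>)
  moreover have "emeasure M K < ennreal (d + e)" using e by (simp add: emeasure_eq_measure d_def ennreal_less_iff)
  ultimately obtain U where U: "K \<subseteq> U" "open U" "emeasure M U < ennreal (d + e)"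
    by (auto simp: INF_less_iff)
  have Uset: "U \<in> sets borel" using U by auto
  have Um: "measure M U < d + e" using U(3) by (simp add: emeasure_eq_measure ennreal_less_iff del: ennreal_plus)
  obtain s where s: "s > 0" "(\<Union>x\<in>K. ball x s) \<subseteq> U"
    using compact_subset_open_imp_ball_epsilon_subset[OF K(2) U(2) U(1)] by blast
  define r where "r = min (s / 2) 1"
  have r: "0 < r" "r \<le> 1" "r < s" using s by (auto simp: r_def)
  obtain F where F: "finite F" "F \<subseteq> K" "K \<subseteq> (\<Union>x\<in>F. ball x r)"
  proof (rule compactE_image[OF K(2), of K "\<lambda>x. ball x r"])
    show "K \<subseteq> (\<Union>x\<in>K. ball x r)" using r by auto
  qed (use that in auto)
  obtain J where J: "J \<subseteq> F" "\<And>x y. x \<in> J \<Longrightarrow> y \<in> J \<Longrightarrow> x \<noteq> y \<Longrightarrow> 2 * r < dist x y"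
    "\<And>x. x \<in> F \<Longrightarrow> \<exists>y\<in>J. dist x y \<le> 2 * r"
    using maximal_separated[OF F(1), of "2 * r"] r by auto
  have JX: "x \<in> X" "x \<in> K" if "x \<in> J" for x using that J F K by auto
  have finJ: "finite J" using J(1) F(1) finite_subset by blast
  have "K \<subseteq> (\<Union>x\<in>J. cball x (3 * r))"
  proof
    fix z assume "z \<in> K"
    then obtain x where x: "x \<in> F" "dist x z < r" using F by auto
    obtain y where y: "y \<in> J" "dist x y \<le> 2 * r" using J(3)[OF x(1)] by blast
    have "dist y z \<le> 3 * r" using dist_triangle3[of y z x] x(2) y(2) by linarith
    thus "z \<in> (\<Union>x\<in>J. cball x (3 * r))" using y(1) by (auto simp: mem_cball)
  qed
  moreover have cb: "cball x s \<in> sets M" for x s by (simp add: M borel_closed)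
  ultimately have "d \<le> measure M (\<Union>x\<in>J. cball x (3 * r))"
    unfolding d_def using finJ by (intro finite_measure_mono sets.finite_UN)
  also have "\<dots> \<le> (\<Sum>x\<in>J. measure M (cball x (3 * r)))"
    using finJ cb by (intro finite_measure_subadditive_finite) blast+
  also have "\<dots> \<le> (\<Sum>x\<in>J. C * (3 * r) ^ m)" using JX r by (intro sum_mono upper) auto
  finally have 1: "d \<le> real (card J) * r ^ m * (C * 3 ^ m)"
    by (simp add: power_mult_distrib algebra_simps)
  have "real (card J) * (k * r ^ m) = (\<Sum>x\<in>J. k * r ^ m)" by simp
  also have "\<dots> \<le> (\<Sum>x\<in>J. measure M (cball x r \<inter> L))" using JX r by (intro sum_mono local) auto
  also have "\<dots> = measure M (\<Union>x\<in>J. cball x r \<inter> L)"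
  proof (rule finite_measure_finite_Union[symmetric])
    show "disjoint_family_on (\<lambda>x. cball x r \<inter> L) J"
      unfolding disjoint_family_on_def
    proof (intro ballI impI, rule ccontr)
      fix x y assume xy: "x \<in> J" "y \<in> J" "x \<noteq> y" "cball x r \<inter> L \<inter> (cball y r \<inter> L) \<noteq> {}"
      then obtain z where "dist x z \<le> r" "dist y z \<le> r" by auto
      thus False using J(2)[OF xy(1-3)] dist_triangle2[of x y z] by linarith
    qed
  qed (use finJ L cb M in \<open>blast intro: sets.Int\<close>)+
  also have "\<dots> \<le> measure M (U - K)"
  proof (rule finite_measure_mono)
    show "(\<Union>x\<in>J. cball x r \<inter> L) \<subseteq> U - K"
    proof
      fix z assume "z \<in> (\<Union>x\<in>J. cball x r \<inter> L)"
      then obtain x where "x \<in> J" "dist x z \<le> r" "z \<in> L" by auto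
      hence "z \<in> ball x s" "x \<in> K" "z \<notin> K" using r JX K by auto
      thus "z \<in> U - K" using s(2) by blast
    qed
  qed (use M Uset Kset in auto)
  also have "\<dots> = measure M U - d"
    unfolding d_def using M Uset Kset U by (intro finite_measure_Diff) auto
  also have "\<dots> < e" using Um by simp
  finally have 2: "real (card J) * r ^ m < e / k" using pos by (simp add: field_simps)
  have "real (card J) * r ^ m * (C * 3 ^ m) \<le> e / k * (C * 3 ^ m)"
    using 2 pos by (intro mult_right_mono) auto
  also have "\<dots> = d / 2" using pos by (simp add: e_def field_simps)
  finally show False using 1 d by simp
qed

locale ubiquitous = finite_measure M
  for M :: "'a :: {second_countable_topology, complete_space} measure" +
  fixes X :: "'a set" and Q :: "nat \<Rightarrow> 'a set" and C c A l k :: real and m :: nat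
  assumes sets_M: "sets M = sets borel" and X_borel: "X \<in> sets borel"
    and params: "0 < C" "0 < c" "0 < A" "0 < l" "l < 1" "0 < k" "0 < m"
    and upper: "\<And>x r. x \<in> X \<Longrightarrow> 0 < r \<Longrightarrow> measure M (cball x r) \<le> C * r ^ m"
    and lower: "\<And>x r. x \<in> X \<Longrightarrow> 0 < r \<Longrightarrow> r \<le> 1 \<Longrightarrow> c * r ^ m \<le> measure M (cball x r)"
    and Q: "finite (Q t)" "Q t \<subseteq> X"
    and ubiquity: "\<And>x r. x \<in> X \<Longrightarrow> 0 < r \<Longrightarrow> r \<le> 1 \<Longrightarrow>
      \<forall>\<^sub>F t in sequentially. k * r ^ m \<le> measure M (cball x r \<inter> (\<Union>y\<in>Q t. cball y (A * l ^ t)))"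
begin

lemma cball_sets [simp]: "cball x r \<in> sets M"
  by (simp add: sets_M borel_closed)

lemma point_null:
  assumes "x \<in> X"
  shows "measure M {x} = 0"
proof (rule ccontr)
  let ?d = "measure M {x}"
  assume "?d \<noteq> 0"
  hence d: "?d > 0" using zero_less_measure_iff by blast
  define r where "r = min 1 (?d / (2 * C))"
  have r: "0 < r" "r \<le> 1" "r \<le> ?d / (2 * C)" using d params by (auto simp: r_def)
  have "?d \<le> measure M (cball x r)" using r by (intro finite_measure_mono) auto
  also have "\<dots> \<le> C * r ^ m" by (rule upper[OF assms r(1)])
  also have "\<dots> \<le> C * r ^ 1"
    using r params by (intro mult_left_mono power_decreasing) auto
  also have "\<dots> \<le> C * (?d / (2 * C))" using r params by (intro mult_left_mono) auto
  also have "\<dots> = ?d / 2" using params by simp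
  finally show False using d by simp
qed

lemma upper0: "x \<in> X \<Longrightarrow> 0 \<le> r \<Longrightarrow> measure M (cball x r) \<le> C * r ^ m"
  using upper[of x r] point_null[of x] params by (cases "r = 0") auto

lemma separated_card_le:
  assumes "x \<in> X" "finite J" "J \<subseteq> X" "0 < d" "d \<le> 1" "0 \<le> R"
    and sep: "\<And>y z. y \<in> J \<Longrightarrow> z \<in> J \<Longrightarrow> y \<noteq> z \<Longrightarrow> 2 * d < dist y z"
    and sub: "\<And>y. y \<in> J \<Longrightarrow> dist x y \<le> R"
  shows "real (card J) * d ^ m \<le> C / c * (R + d) ^ m"
proof -
  have "real (card J) * (c * d ^ m) = (\<Sum>y\<in>J. c * d ^ m)" by simp
  also have "\<dots> \<le> (\<Sum>y\<in>J. measure M (cball y d))" using assms by (intro sum_mono lower) auto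
  also have "\<dots> = measure M (\<Union>y\<in>J. cball y d)"
  proof (rule finite_measure_finite_Union[symmetric])
    show "disjoint_family_on (\<lambda>y. cball y d) J"
      unfolding disjoint_family_on_def
    proof (intro ballI impI, rule ccontr)
      fix y z assume yz: "y \<in> J" "z \<in> J" "y \<noteq> z" "cball y d \<inter> cball z d \<noteq> {}"
      then obtain w where "dist y w \<le> d" "dist z w \<le> d" by auto
      thus False using sep[OF yz(1-3)] dist_triangle2[of y z w] by linarith
    qed
  qed (use assms in auto)
  also have "\<dots> \<le> measure M (cball x (R + d))"
  proof (rule finite_measure_mono)
    show "(\<Union>y\<in>J. cball y d) \<subseteq> cball x (R + d)"
    proof
      fix w assume "w \<in> (\<Union>y\<in>J. cball y d)"
      then obtain y where y: "y \<in> J" "dist y w \<le> d" by auto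
      have "dist x w \<le> R + d" using sub[OF y(1)] y(2) dist_triangle[of x w y] by linarith
      thus "w \<in> cball x (R + d)" by simp
    qed
  qed simp
  also have "\<dots> \<le> C * (R + d) ^ m" by (rule upper) (use assms in auto)
  finally show ?thesis using params by (simp add: field_simps)
qed

lemma limsup_in_ball:
  assumes psi: "\<And>t. 0 \<le> \<psi> t" and div: "\<not> summable (\<lambda>t. (\<psi> t / (A * l ^ t)) ^ m)"
    and x: "x \<in> X" and r: "0 < r" "r \<le> 1"
  defines "\<theta> \<equiv> \<lambda>t. min (\<psi> t) (A * l ^ t)"
  shows "(k * c / (C * 8 ^ m))\<^sup>2 * (1 - l) / (3 * ((C / c)\<^sup>2 * C * 8 ^ m)) * r ^ m
    \<le> measure M (cball x r \<inter> (\<Inter>n. \<Union>t\<in>{n..}. \<Union>y\<in>Q t. cball y (\<theta> t)))"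
proof -
  define \<rho> where "\<rho> = (\<lambda>t. A * l ^ t)"
  have rho: "\<rho> t > 0" for t using params by (simp add: \<rho>_def)
  have theta: "0 \<le> \<theta> t" "\<theta> t \<le> \<rho> t" for t using psi rho[of t] by (auto simp: \<theta>_def \<rho>_def)
  define a where "a = (\<lambda>t. (\<theta> t / \<rho> t) ^ m)"
  have a0: "0 \<le> a t" for t using theta[of t] rho[of t] by (simp add: a_def)
  have a_div: "\<not> summable a"
  proof
    assume sa: "summable a"
    hence "a \<longlonglongrightarrow> 0" by (rule summable_LIMSEQ_zero)
    hence "\<forall>\<^sub>F t in sequentially. a t < 1" by (rule order_tendstoD) simp
    hence "\<forall>\<^sub>F t in sequentially. a t = (\<psi> t / (A * l ^ t)) ^ m"
    proof eventually_elim
      case (elim t)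
      have "\<theta> t \<noteq> \<rho> t" using elim rho[of t] by (auto simp: a_def)
      thus ?case by (auto simp: a_def \<theta>_def \<rho>_def min_def)
    qed
    hence "summable a = summable (\<lambda>t. (\<psi> t / (A * l ^ t)) ^ m)" by (rule summable_cong)
    thus False using sa div by blast
  qed
  have rho_lim: "\<rho> \<longlonglongrightarrow> 0"
    unfolding \<rho>_def using params by (intro tendsto_mult_right_zero LIMSEQ_realpow_zero) auto
  have "\<forall>\<^sub>F t in sequentially. \<rho> t < r / 4" by (rule order_tendstoD(2)[OF rho_lim]) (use r in simp)
  moreover have "\<forall>\<^sub>F t in sequentially.
      k * (r / 2) ^ m \<le> measure M (cball x (r / 2) \<inter> (\<Union>y\<in>Q t. cball y (\<rho> t)))"
    unfolding \<rho>_def by (rule ubiquity) (use x r in auto)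
  ultimately have "\<forall>\<^sub>F t in sequentially. \<rho> t < r / 4 \<and>
      k * (r / 2) ^ m \<le> measure M (cball x (r / 2) \<inter> (\<Union>y\<in>Q t. cball y (\<rho> t)))"
    by eventually_elim simp
  then obtain t0 where t0: "\<And>t. t0 \<le> t \<Longrightarrow> \<rho> t < r / 4"
    "\<And>t. t0 \<le> t \<Longrightarrow> k * (r / 2) ^ m \<le> measure M (cball x (r / 2) \<inter> (\<Union>y\<in>Q t. cball y (\<rho> t)))"
    by (auto simp: eventually_sequentially)
  define P where "P = (\<lambda>t. {y \<in> Q t. cball y (\<rho> t) \<inter> cball x (r / 2) \<noteq> {}})"
  have P: "finite (P t)" for t using Q(1) by (simp add: P_def)
  have "\<exists>J. J \<subseteq> P t \<and> (\<forall>y\<in>J. \<forall>z\<in>J. y \<noteq> z \<longrightarrow> 3 * \<rho> t < dist y z) \<and> (\<forall>y\<in>P t. \<exists>z\<in>J. dist y z \<le> 3 * \<rho> t)" for t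
    using maximal_separated[OF P, of "3 * \<rho> t" t] rho[of t] by (smt (verit, best))
  then obtain J where J: "\<And>t. J t \<subseteq> P t" "\<And>t y z. y \<in> J t \<Longrightarrow> z \<in> J t \<Longrightarrow> y \<noteq> z \<Longrightarrow> 3 * \<rho> t < dist y z"
    "\<And>t y. y \<in> P t \<Longrightarrow> \<exists>z\<in>J t. dist y z \<le> 3 * \<rho> t" by metis
  have finJ: "finite (J t)" for t using J(1) P finite_subset by blast
  have JX: "J t \<subseteq> X" "J t \<subseteq> Q t" for t using J(1) Q(2) by (fastforce simp: P_def)+
  have Jx: "dist x y \<le> r / 2 + \<rho> t" if "y \<in> J t" for y t
  proof -
    have "y \<in> P t" using that J(1) by blast
    then obtain w where "dist y w \<le> \<rho> t" "dist x w \<le> r / 2" by (auto simp: P_def)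
    thus ?thesis using dist_triangle2[of x y w] by linarith
  qed
  define E where "E = (\<lambda>t. \<Union>y\<in>J t. cball y (\<theta> t))"
  have E: "E t \<in> sets M" for t using finJ by (auto simp: E_def)
  have r3: "2 * \<rho> t < dist y z" if "y \<in> J t" "z \<in> J t" "y \<noteq> z" for t y z
    using J(2)[OF that] rho[of t] by linarith
  have J_upper: "real (card (J t)) \<le> C / c * (2 * r) ^ m / \<rho> t ^ m" if "t0 \<le> t" for t
  proof -
    have "real (card (J t)) * \<rho> t ^ m \<le> C / c * ((r / 2 + \<rho> t) + \<rho> t) ^ m"
      by (rule separated_card_le[OF x]) (use finJ JX Jx r3 rho[of t] t0(1)[OF that] r in simp_all)
    also have "\<dots> \<le> C / c * (2 * r) ^ m"
      using rho[of t] t0(1)[OF that] r params by (intro mult_left_mono power_mono) auto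
    finally show ?thesis using rho[of t] by (subst pos_le_divide_eq) simp_all
  qed
  have J_lower: "k * (r / 2) ^ m / (C * (4 * \<rho> t) ^ m) \<le> real (card (J t))" if "t0 \<le> t" for t
  proof -
    have "k * (r / 2) ^ m \<le> measure M (cball x (r / 2) \<inter> (\<Union>y\<in>Q t. cball y (\<rho> t)))"
      by (rule t0(2)[OF that])
    also have "\<dots> \<le> measure M (\<Union>z\<in>J t. cball z (4 * \<rho> t))"
    proof (rule finite_measure_mono)
      show "cball x (r / 2) \<inter> (\<Union>y\<in>Q t. cball y (\<rho> t)) \<subseteq> (\<Union>z\<in>J t. cball z (4 * \<rho> t))"
      proof
        fix w assume "w \<in> cball x (r / 2) \<inter> (\<Union>y\<in>Q t. cball y (\<rho> t))"
        then obtain y where y: "y \<in> Q t" "w \<in> cball y (\<rho> t)" "w \<in> cball x (r / 2)" by blast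
        hence "y \<in> P t" by (auto simp: P_def)
        then obtain z where z: "z \<in> J t" "dist y z \<le> 3 * \<rho> t" using J(3) by blast
        have "dist z w \<le> 4 * \<rho> t" using z(2) y(2) dist_triangle[of z w y] by (simp add: dist_commute)
        thus "w \<in> (\<Union>z\<in>J t. cball z (4 * \<rho> t))" using z(1) by auto
      qed
    qed (use finJ in auto)
    also have "\<dots> \<le> (\<Sum>z\<in>J t. measure M (cball z (4 * \<rho> t)))"
      using finJ by (intro finite_measure_subadditive_finite) auto
    also have "\<dots> \<le> (\<Sum>z\<in>J t. C * (4 * \<rho> t) ^ m)" using JX rho by (intro sum_mono upper) auto
    also have "\<dots> = real (card (J t)) * (C * (4 * \<rho> t) ^ m)" by simp
    finally show ?thesis using rho[of t] params by (simp add: divide_le_eq)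
  qed
  have E_lower: "k * c / (C * 8 ^ m) * r ^ m * a t \<le> measure M (E t)" if t: "t0 \<le> t" for t
  proof (cases "\<theta> t = 0")
    case True
    thus ?thesis using params by (simp add: a_def zero_power)
  next
    case False
    hence th: "\<theta> t > 0" using theta(1)[of t] by simp
    have "k * c / (C * 8 ^ m) * r ^ m * a t = k * (r / 2) ^ m / (C * (4 * \<rho> t) ^ m) * (c * \<theta> t ^ m)"
      using rho[of t] params by (simp add: a_def power_divide power_mult_distrib field_simps
          flip: power_mult_distrib[of 2 4])
    also have "\<dots> \<le> real (card (J t)) * (c * \<theta> t ^ m)"
      using J_lower[OF t] th params by (intro mult_right_mono) auto
    also have "\<dots> = (\<Sum>y\<in>J t. c * \<theta> t ^ m)" by simp
    also have "\<dots> \<le> (\<Sum>y\<in>J t. measure M (cball y (\<theta> t)))"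
      using JX th theta(2)[of t] t0(1)[OF t] r by (intro sum_mono lower) auto
    also have "\<dots> = measure M (E t)"
      unfolding E_def
    proof (rule finite_measure_finite_Union[symmetric])
      show "disjoint_family_on (\<lambda>y. cball y (\<theta> t)) (J t)"
        unfolding disjoint_family_on_def
      proof (intro ballI impI, rule ccontr)
        fix y z assume yz: "y \<in> J t" "z \<in> J t" "y \<noteq> z" "cball y (\<theta> t) \<inter> cball z (\<theta> t) \<noteq> {}"
        then obtain w where "dist y w \<le> \<theta> t" "dist z w \<le> \<theta> t" by auto
        thus False using J(2)[OF yz(1-3)] dist_triangle2[of y z w] theta(2)[of t] rho[of t] by linarith
      qed
    qed (use finJ in auto)
    finally show ?thesis .
  qed
  have overlap: "measure M (E s \<inter> E t) \<le> (C / c)\<^sup>2 * C * 8 ^ m * r ^ m * (a s * a t + l ^ (t - s) * a t)"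
    if st: "t0 \<le> s" "s \<le> t" for s t
  proof -
    define N where "N = (\<lambda>y. {z \<in> J t. dist y z \<le> \<theta> s + \<theta> t})"
    have finN: "finite (N y)" for y using finJ by (simp add: N_def)
    have NJ: "z \<in> J t" "dist y z \<le> \<theta> s + \<theta> t" if "z \<in> N y" for y z
      using that by (auto simp: N_def)
    have NX: "N y \<subseteq> X" for y using JX(1)[of t] by (auto simp: N_def)
    have t: "t0 \<le> t" using st by simp
    have N: "real (card (N y)) \<le> C / c * 4 ^ m * (\<theta> s ^ m + \<rho> t ^ m) / \<rho> t ^ m" if "y \<in> J s" for y
    proof -
      have "real (card (N y)) * \<rho> t ^ m \<le> C / c * ((\<theta> s + \<theta> t) + \<rho> t) ^ m"
        by (rule separated_card_le[of y])
          (use subsetD[OF JX(1) that] NX finN NJ r3[of _ t] rho[of t] t0(1)[OF t] r theta[of s] theta[of t]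
            in simp_all)
      also have "\<dots> \<le> C / c * (4 * max (\<theta> s) (\<rho> t)) ^ m"
        using rho[of t] theta[of s] theta[of t] params by (intro mult_left_mono power_mono) auto
      also have "\<dots> \<le> C / c * (4 ^ m * (\<theta> s ^ m + \<rho> t ^ m))"
        unfolding power_mult_distrib
        using rho[of t] theta[of s] params by (intro mult_left_mono) (auto simp: max_def)
      finally show ?thesis using rho[of t] by (subst pos_le_divide_eq) simp_all
    qed
    have "measure M (E s \<inter> E t) \<le> measure M (\<Union>y\<in>J s. \<Union>z\<in>N y. cball z (\<theta> t))"
    proof (rule finite_measure_mono)
      show "E s \<inter> E t \<subseteq> (\<Union>y\<in>J s. \<Union>z\<in>N y. cball z (\<theta> t))"
      proof
        fix w assume "w \<in> E s \<inter> E t"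
        then obtain y z where yz: "y \<in> J s" "dist y w \<le> \<theta> s" "z \<in> J t" "dist z w \<le> \<theta> t"
          by (auto simp: E_def)
        hence "z \<in> N y" using dist_triangle2[of y z w] by (auto simp: N_def)
        thus "w \<in> (\<Union>y\<in>J s. \<Union>z\<in>N y. cball z (\<theta> t))" using yz by auto
      qed
    qed (use finJ finN in \<open>intro sets.finite_UN cball_sets\<close>)
    also have "\<dots> \<le> (\<Sum>y\<in>J s. measure M (\<Union>z\<in>N y. cball z (\<theta> t)))"
      using finJ finN by (intro finite_measure_subadditive_finite) auto
    also have "\<dots> \<le> (\<Sum>y\<in>J s. \<Sum>z\<in>N y. measure M (cball z (\<theta> t)))"
      using finN by (intro sum_mono finite_measure_subadditive_finite) auto
    also have "\<dots> \<le> (\<Sum>y\<in>J s. \<Sum>z\<in>N y. C * \<theta> t ^ m)"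
      using JX theta by (intro sum_mono upper0) (auto simp: N_def)
    also have "\<dots> = (\<Sum>y\<in>J s. real (card (N y)) * (C * \<theta> t ^ m))" by simp
    also have "\<dots> \<le> (\<Sum>y\<in>J s. C / c * 4 ^ m * (\<theta> s ^ m + \<rho> t ^ m) / \<rho> t ^ m * (C * \<theta> t ^ m))"
      using N theta params by (intro sum_mono mult_right_mono) auto
    also have "\<dots> = real (card (J s)) * (C / c * 4 ^ m * (\<theta> s ^ m + \<rho> t ^ m) / \<rho> t ^ m * (C * \<theta> t ^ m))"
      by simp
    also have "\<dots> \<le> C / c * (2 * r) ^ m / \<rho> s ^ m * (C / c * 4 ^ m * (\<theta> s ^ m + \<rho> t ^ m) / \<rho> t ^ m * (C * \<theta> t ^ m))"
      using J_upper[OF st(1)] rho[of t] theta[of s] theta[of t] params by (intro mult_right_mono) auto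
    also have "\<dots> = (C / c)\<^sup>2 * C * 8 ^ m * r ^ m * (a s * a t + (\<rho> t / \<rho> s) ^ m * a t)"
    proof -
      have e: "(8 :: real) ^ m = 2 ^ m * 4 ^ m" by (simp flip: power_mult_distrib)
      show ?thesis unfolding a_def e power_divide power_mult_distrib power2_eq_square
        using rho[of t] rho[of s] params by (simp add: field_simps)
    qed
    also have "\<dots> \<le> (C / c)\<^sup>2 * C * 8 ^ m * r ^ m * (a s * a t + l ^ (t - s) * a t)"
    proof -
      have "\<rho> t / \<rho> s = l ^ (t - s)"
        unfolding \<rho>_def using params st(2) by (simp add: power_diff)
      hence "(\<rho> t / \<rho> s) ^ m \<le> (l ^ (t - s)) ^ 1"
        unfolding \<open>\<rho> t / \<rho> s = l ^ (t - s)\<close> using params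
        by (intro power_decreasing) (auto intro: power_le_one)
      thus ?thesis using params r a0[of t] by (intro mult_left_mono add_mono mult_right_mono) auto
    qed
    finally show ?thesis .
  qed
  have "(k * c / (C * 8 ^ m))\<^sup>2 * (1 - l) / (3 * ((C / c)\<^sup>2 * C * 8 ^ m)) * r ^ m
    \<le> measure M (\<Inter>n. \<Union>t\<in>{n..}. E t)"
    by (rule limsup_lower_bound[where a = a and ?t0.0 = t0])
      (use E params r a0 a_div E_lower overlap in \<open>auto\<close>)
  also have "\<dots> \<le> measure M (cball x r \<inter> (\<Inter>n. \<Union>t\<in>{n..}. \<Union>y\<in>Q t. cball y (\<theta> t)))"
  proof (rule finite_measure_mono)
    show "(\<Inter>n. \<Union>t\<in>{n..}. E t) \<subseteq> cball x r \<inter> (\<Inter>n. \<Union>t\<in>{n..}. \<Union>y\<in>Q t. cball y (\<theta> t))"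
    proof (intro Int_greatest)
      show "(\<Inter>n. \<Union>t\<in>{n..}. E t) \<subseteq> cball x r"
      proof
        fix w assume "w \<in> (\<Inter>n. \<Union>t\<in>{n..}. E t)"
        then obtain t where t: "t0 \<le> t" "w \<in> E t" by blast
        then obtain y where y: "y \<in> J t" "dist y w \<le> \<theta> t" by (auto simp: E_def)
        have "dist x w \<le> r"
          using dist_triangle[of x w y] y(2) Jx[OF y(1)] theta(2)[of t] t0(1)[OF t(1)] by linarith
        thus "w \<in> cball x r" by simp
      qed
      have "E t \<subseteq> (\<Union>y\<in>Q t. cball y (\<theta> t))" for t
        unfolding E_def using JX(2) by (rule UN_mono) simp
      thus "(\<Inter>n. \<Union>t\<in>{n..}. E t) \<subseteq> (\<Inter>n. \<Union>t\<in>{n..}. \<Union>y\<in>Q t. cball y (\<theta> t))"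
        by (intro INF_mono' UN_mono order_refl)
    qed
    have "(\<Union>y\<in>Q t. cball y (\<theta> t)) \<in> sets M" for t using Q(1) by auto
    hence "(\<Union>t\<in>{n..}. \<Union>y\<in>Q t. cball y (\<theta> t)) \<in> sets M" for n by auto
    thus "cball x r \<inter> (\<Inter>n. \<Union>t\<in>{n..}. \<Union>y\<in>Q t. cball y (\<theta> t)) \<in> sets M" by auto
  qed
  finally show ?thesis .
qed

theorem AE_infinitely_many:
  assumes psi: "\<And>t. 0 \<le> \<psi> t" and div: "\<not> summable (\<lambda>t. (\<psi> t / l ^ t) ^ m)"
  shows "AE x in M. x \<in> X \<longrightarrow> infinite {y. \<exists>t. y \<in> Q t \<and> dist x y \<le> \<psi> t}"
proof -
  have div': "\<not> summable (\<lambda>t. (\<psi> t / (A * l ^ t)) ^ m)"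
  proof
    assume "summable (\<lambda>t. (\<psi> t / (A * l ^ t)) ^ m)"
    hence "summable (\<lambda>t. A ^ m * (\<psi> t / (A * l ^ t)) ^ m)" by (rule summable_mult)
    thus False using div params by (simp flip: power_mult_distrib)
  qed
  define \<theta> where "\<theta> = (\<lambda>t. min (\<psi> t) (A * l ^ t))"
  define L where "L = (\<Inter>n. \<Union>t\<in>{n..}. \<Union>y\<in>Q t. cball y (\<theta> t))"
  have "(\<Union>y\<in>Q t. cball y (\<theta> t)) \<in> sets M" for t using Q(1) by auto
  hence "(\<Union>t\<in>{n..}. \<Union>y\<in>Q t. cball y (\<theta> t)) \<in> sets M" for n by auto
  hence L: "L \<in> sets borel" unfolding L_def sets_M[symmetric] by auto
  let ?c = "(k * c / (C * 8 ^ m))\<^sup>2 * (1 - l) / (3 * ((C / c)\<^sup>2 * C * 8 ^ m))"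
  have "measure M (X - L) = 0"
  proof (rule full_measure_if_positive_in_balls[of M X L C ?c m])
    show "0 < ?c" using params by auto
    fix x r assume "x \<in> X" "0 < r" "r \<le> (1 :: real)"
    thus "?c * r ^ m \<le> measure M (cball x r \<inter> L)"
      unfolding L_def \<theta>_def by (intro limsup_in_ball psi div')
  qed (use finite_measure_axioms sets_M X_borel L params upper in auto)
  hence "X - L \<in> null_sets M" using X_borel L sets_M
    by (intro null_setsI) (auto simp: emeasure_eq_measure)
  moreover have "(\<Union>t. Q t) \<in> null_sets M"
  proof -
    have "{y} \<in> null_sets M" if "y \<in> X" for y
      using point_null[OF that] sets_M by (intro null_setsI) (auto simp: emeasure_eq_measure)
    hence "(\<Union>y\<in>(\<Union>t. Q t). {y}) \<in> null_sets M"
      using Q by (intro null_sets_UN' countable_UN) (auto intro: countable_finite)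
    thus ?thesis by simp
  qed
  ultimately have "X - L \<union> (\<Union>t. Q t) \<in> null_sets M" by (rule null_sets.Un)
  moreover have "{x \<in> space M. \<not> (x \<in> X \<longrightarrow> infinite {y. \<exists>t. y \<in> Q t \<and> dist x y \<le> \<psi> t})}
    \<subseteq> X - L \<union> (\<Union>t. Q t)"
  proof
    fix x assume x: "x \<in> {x \<in> space M. \<not> (x \<in> X \<longrightarrow> infinite {y. \<exists>t. y \<in> Q t \<and> dist x y \<le> \<psi> t})}"
    let ?S = "{y. \<exists>t. y \<in> Q t \<and> dist x y \<le> \<psi> t}"
    have fin: "finite ?S" and xX: "x \<in> X" using x by auto
    show "x \<in> X - L \<union> (\<Union>t. Q t)"
    proof (rule ccontr)
      assume "x \<notin> X - L \<union> (\<Union>t. Q t)"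
      hence xL: "x \<in> L" and xQ: "\<And>t. x \<notin> Q t" using xX by auto
      have "x \<notin> ?S" using xQ by blast
      obtain d where d': "d > 0" "\<forall>y\<in>?S. y \<noteq> x \<longrightarrow> d \<le> dist x y"
        using finite_set_avoid[OF fin, of x] by blast
      have d: "d \<le> dist x y" if "y \<in> ?S" for y
      proof -
        have "y \<noteq> x" using that \<open>x \<notin> ?S\<close> by (intro notI) (simp only:)
        thus ?thesis using d'(2) that by blast
      qed
      have "(\<lambda>t. A * l ^ t) \<longlonglongrightarrow> 0"
        using params by (intro tendsto_mult_right_zero LIMSEQ_realpow_zero) auto
      hence "\<forall>\<^sub>F t in sequentially. A * l ^ t < d" by (rule order_tendstoD) (rule d'(1))
      then obtain n where n: "\<And>t. n \<le> t \<Longrightarrow> A * l ^ t < d" by (auto simp: eventually_sequentially)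
      have "x \<in> (\<Union>t\<in>{n..}. \<Union>y\<in>Q t. cball y (\<theta> t))" using xL unfolding L_def by blast
      then obtain t y where ty: "n \<le> t" "y \<in> Q t" "dist x y \<le> \<theta> t"
        by (auto simp: dist_commute)
      hence le: "dist x y \<le> \<psi> t" "dist x y \<le> A * l ^ t" by (simp_all add: \<theta>_def)
      hence "y \<in> ?S" using ty(2) by blast
      from d[OF this] le(2) n[OF ty(1)] show False by linarith
    qed
  qed
  ultimately show ?thesis by (rule AE_I')
qed

end

section \<open>Topology of completions of the rationals\<close>

lemma open_vec_box: "(\<And>i. open (f i)) \<Longrightarrow> open {x :: ('a :: topological_space, 'b :: finite) vec. \<forall>i. x $ i \<in> f i}"
  unfolding open_vec_def by blast

instance vec :: (first_countable_topology, finite) first_countable_topology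
proof
  fix x :: "('a, 'b) vec"
  have "\<exists>A. (\<forall>n. open (A n) \<and> x $ i \<in> A n) \<and>
      (\<forall>S. open S \<longrightarrow> x $ i \<in> S \<longrightarrow> (\<forall>\<^sub>F n in sequentially. A n \<subseteq> S))" for i
    by (rule countable_basis_at_decseq[of "x $ i"]) blast
  then obtain A where A: "\<And>i n. open (A i n)" "\<And>i n. x $ i \<in> A i n"
    "\<And>i S. open S \<Longrightarrow> x $ i \<in> S \<Longrightarrow> \<forall>\<^sub>F n in sequentially. A i n \<subseteq> S" by metis
  let ?B = "\<lambda>n. {y. \<forall>i. y $ i \<in> A i n}"
  show "\<exists>B :: nat \<Rightarrow> ('a, 'b) vec set. (\<forall>n. x \<in> B n \<and> open (B n)) \<and>
      (\<forall>S. open S \<and> x \<in> S \<longrightarrow> (\<exists>n. B n \<subseteq> S))"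
  proof (intro exI[of _ ?B] conjI allI impI)
    fix S assume "open S \<and> x \<in> S"
    then obtain T where T: "\<And>i. open (T i)" "\<And>i. x $ i \<in> T i" "\<And>y. (\<forall>i. y $ i \<in> T i) \<Longrightarrow> y \<in> S"
      unfolding open_vec_def by meson
    have "\<forall>\<^sub>F n in sequentially. \<forall>i. A i n \<subseteq> T i"
      using A(3)[OF T(1) T(2)] by (simp add: eventually_all_finite)
    then obtain n where "\<forall>i. A i n \<subseteq> T i" by (auto simp: eventually_sequentially)
    thus "\<exists>n. ?B n \<subseteq> S" using T(3) by (intro exI[of _ n]) blast
  next
    fix n show "open (?B n)" by (rule open_vec_box) (rule A(1))
  qed (use A in auto)
qed

instance vec :: (second_countable_topology, finite) second_countable_topology
proof
  obtain B :: "'a set set" where B: "countable B" "topological_basis B"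
    using ex_countable_basis by auto
  define V where "V = (\<lambda>f. {x :: ('a, 'b) vec. \<forall>i. x $ i \<in> f i})"
  define W where "W = V ` (\<Pi>\<^sub>E i\<in>UNIV. B)"
  have "countable W"
    unfolding W_def using B(1) by (intro countable_image countable_PiE) auto
  moreover have "topological_basis W"
  proof (rule topological_basisI)
    fix S assume "S \<in> W"
    then obtain f where f: "S = V f" "\<And>i. f i \<in> B" by (auto simp: W_def PiE_def)
    have "open (f i)" for i using f(2) B(2) topological_basis_open by blast
    thus "open S" unfolding f(1) V_def by (rule open_vec_box)
  next
    fix S :: "('a, 'b) vec set" and x assume S: "open S" "x \<in> S"
    then obtain A where A: "\<And>i. open (A i)" "\<And>i. x $ i \<in> A i" "\<And>y. (\<forall>i. y $ i \<in> A i) \<Longrightarrow> y \<in> S"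
      unfolding open_vec_def by meson
    have "\<exists>U\<in>B. x $ i \<in> U \<and> U \<subseteq> A i" for i
      using topological_basisE[OF B(2) A(1) A(2)] by metis
    then obtain f where f: "\<And>i. f i \<in> B" "\<And>i. x $ i \<in> f i" "\<And>i. f i \<subseteq> A i" by metis
    show "\<exists>U\<in>W. x \<in> U \<and> U \<subseteq> S"
    proof (intro bexI conjI)
      show "V f \<in> W" using f by (auto simp: W_def)
      show "x \<in> V f" using f by (simp add: V_def)
      show "V f \<subseteq> S" using f A(3) by (force simp: V_def)
    qed
  qed
  ultimately show "\<exists>W :: ('a, 'b) vec set set. countable W \<and> open = generate_topology W"
    using topological_basis_imp_subbasis by blast
qed

instance padic :: (prime_card) second_countable_topology
proof
  define W where "W = (\<lambda>(q, n). ball (of_rat q :: 'a padic) (1 / real (Suc n))) ` (UNIV :: (rat \<times> nat) set)"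
  have "topological_basis W"
  proof (rule topological_basisI)
    fix S :: "'a padic set" and x assume S: "open S" "x \<in> S"
    then obtain e where e: "e > 0" "ball x e \<subseteq> S" using open_contains_ball by blast
    obtain n where n: "1 / real (Suc n) < e / 2" using e(1) nat_approx_posE[of "e / 2"] by auto
    obtain q where q: "dist x (of_rat q) < 1 / real (Suc n)"
      using completion_dense[of "1 / real (Suc n)" x] by auto
    show "\<exists>U\<in>W. x \<in> U \<and> U \<subseteq> S"
    proof (intro bexI conjI)
      show "x \<in> ball (of_rat q) (1 / real (Suc n))" using q by (simp add: dist_commute)
      show "ball (of_rat q) (1 / real (Suc n)) \<subseteq> S"
      proof
        fix z assume "z \<in> ball (of_rat q :: 'a padic) (1 / real (Suc n))"
        hence "dist (of_rat q) z < 1 / real (Suc n)" by simp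
        hence "dist x z < e" using dist_triangle[of x z "of_rat q"] q n by linarith
        thus "z \<in> S" using e(2) by auto
      qed
    qed (auto simp: W_def)
  qed (auto simp: W_def)
  moreover have "countable W" by (simp add: W_def)
  ultimately show "\<exists>W :: 'a padic set set. countable W \<and> open = generate_topology W"
    using topological_basis_imp_subbasis by blast
qed

lemma vabs_0 [simp]: "vabs (0 :: 'k :: rat_completion) = 0"
  by simp

lemma vabs_triangle: "vabs (x + y) \<le> vabs x + vabs (y :: 'k :: rat_completion)"
  using dist_triangle[of "x + y" 0 y] by (simp add: dist_vabs)

lemma vabs_minus [simp]: "vabs (- x) = vabs (x :: 'k :: rat_completion)"
  using dist_commute[of x 0] by (simp add: dist_vabs)

lemma vabs_minus_commute: "vabs (x - y) = vabs (y - x :: 'k :: rat_completion)"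
  using vabs_minus[of "x - y"] by simp

lemma vabs_triangle_diff: "vabs (x - y) \<le> vabs (x - z) + vabs (z - y :: 'k :: rat_completion)"
  using dist_triangle[of x y z] by (simp add: dist_vabs)

lemma vabs_triangle_minus: "vabs (x - y) \<le> vabs x + vabs (y :: 'k :: rat_completion)"
  using vabs_triangle[of x "- y"] by simp

lemma vabs_1 [simp]: "vabs (1 :: 'k :: rat_completion) = 1"
proof -
  have "vabs (1 :: 'k) * vabs (1 :: 'k) = vabs (1 :: 'k)" by (simp flip: vabs_mult)
  moreover have "vabs (1 :: 'k) \<noteq> 0" by simp
  ultimately show ?thesis by simp
qed

lemma vabs_divide: "vabs (x / y) = vabs x / vabs (y :: 'k :: rat_completion)"
proof (cases "y = 0")
  case False
  hence "vabs (x / y) * vabs y = vabs x" by (simp flip: vabs_mult)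
  thus ?thesis using False by (simp add: field_simps)
qed simp

lemma tendsto_vabs_iff:
  "(f \<longlongrightarrow> a) F \<longleftrightarrow> ((\<lambda>x. vabs (f x - a :: 'k :: rat_completion)) \<longlongrightarrow> 0) F"
  unfolding tendsto_dist_iff[of f a F] dist_vabs ..

lemmas tendsto_vabsD = tendsto_vabs_iff[THEN iffD1]

lemma tendsto_vabs:
  fixes f :: "'a \<Rightarrow> 'k :: rat_completion"
  assumes "(f \<longlongrightarrow> a) F"
  shows "((\<lambda>x. vabs (f x)) \<longlongrightarrow> vabs a) F"
  using tendsto_dist[OF assms tendsto_const[of 0]] unfolding dist_vabs diff_0_right .

lemma tendsto_minus_vabs:
  fixes f g :: "'a \<Rightarrow> 'k :: rat_completion"
  assumes "(f \<longlongrightarrow> a) F" "(g \<longlongrightarrow> c) F"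
  shows "((\<lambda>x. f x - g x) \<longlongrightarrow> a - c) F"
proof (subst tendsto_vabs_iff, rule tendsto_sandwich[where f = "\<lambda>_. 0"])
  have "vabs (f x - g x - (a - c)) \<le> vabs (f x - a) + vabs (g x - c)" for x
    using vabs_triangle_minus[of "f x - a" "g x - c"] by (simp add: algebra_simps)
  thus "\<forall>\<^sub>F x in F. vabs (f x - g x - (a - c)) \<le> vabs (f x - a) + vabs (g x - c)" by simp
  show "((\<lambda>x. vabs (f x - a) + vabs (g x - c)) \<longlongrightarrow> 0) F"
    using tendsto_add[OF assms[THEN tendsto_vabsD]] by simp
qed auto

lemma tendsto_mult_vabs:
  fixes f g :: "'a \<Rightarrow> 'k :: rat_completion"
  assumes "(f \<longlongrightarrow> a) F" "(g \<longlongrightarrow> c) F"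
  shows "((\<lambda>x. f x * g x) \<longlongrightarrow> a * c) F"
proof (subst tendsto_vabs_iff, rule tendsto_sandwich[where f = "\<lambda>_. 0"])
  have "vabs (f x * g x - a * c) \<le> vabs (f x) * vabs (g x - c) + vabs (f x - a) * vabs c" for x
    using vabs_triangle[of "f x * (g x - c)" "(f x - a) * c"] by (simp add: algebra_simps flip: vabs_mult)
  thus "\<forall>\<^sub>F x in F. vabs (f x * g x - a * c) \<le> vabs (f x) * vabs (g x - c) + vabs (f x - a) * vabs c"
    by simp
  show "((\<lambda>x. vabs (f x) * vabs (g x - c) + vabs (f x - a) * vabs c) \<longlongrightarrow> 0) F"
    using tendsto_add[OF tendsto_mult[OF tendsto_vabs[OF assms(1)] tendsto_vabsD[OF assms(2)]]
        tendsto_mult[OF tendsto_vabsD[OF assms(1)] tendsto_const[of "vabs c"]]] by simp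
qed auto

lemma tendsto_inverse_vabs:
  fixes f :: "'a \<Rightarrow> 'k :: rat_completion"
  assumes "(f \<longlongrightarrow> a) F" "a \<noteq> 0"
  shows "((\<lambda>x. inverse (f x)) \<longlongrightarrow> inverse a) F"
proof (subst tendsto_vabs_iff, rule tendsto_sandwich[where f = "\<lambda>_. 0"])
  have "\<forall>\<^sub>F x in F. vabs (f x) > vabs a / 2"
    using tendsto_vabs[OF assms(1)] by (rule order_tendstoD) (use assms(2) in \<open>auto simp: less_le\<close>)
  thus "\<forall>\<^sub>F x in F. vabs (inverse (f x) - inverse a) \<le> vabs (f x - a) / (vabs (f x) * vabs a)"
  proof eventually_elim
    case (elim x)
    hence nz: "f x \<noteq> 0" using vabs_nonneg[of a] by (intro notI) simp
    have "inverse (f x) - inverse a = (a - f x) / (f x * a)" using nz assms(2) by (simp add: field_simps)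
    thus ?case by (simp add: vabs_divide vabs_mult vabs_minus_commute)
  qed
  have "((\<lambda>x. vabs (f x - a) / (vabs (f x) * vabs a)) \<longlongrightarrow> 0 / (vabs a * vabs a)) F"
    by (intro tendsto_divide tendsto_mult tendsto_vabs assms(1) tendsto_const
        tendsto_vabsD[OF assms(1)]) (use assms(2) in simp)
  thus "((\<lambda>x. vabs (f x - a) / (vabs (f x) * vabs a)) \<longlongrightarrow> 0) F" by simp
qed auto

lemma continuous_on_vabs:
  fixes f g :: "'a :: topological_space \<Rightarrow> 'k :: rat_completion"
  shows "continuous_on S f \<Longrightarrow> continuous_on S (\<lambda>x. vabs (f x))"
    and "continuous_on S f \<Longrightarrow> continuous_on S g \<Longrightarrow> continuous_on S (\<lambda>x. f x - g x)"
    and "continuous_on S f \<Longrightarrow> continuous_on S g \<Longrightarrow> continuous_on S (\<lambda>x. f x * g x)"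
    and "continuous_on S f \<Longrightarrow> continuous_on S g \<Longrightarrow> \<forall>x\<in>S. g x \<noteq> 0 \<Longrightarrow> continuous_on S (\<lambda>x. f x / g x)"
  unfolding continuous_on_def divide_inverse
  by (auto intro!: tendsto_vabs tendsto_minus_vabs tendsto_mult_vabs tendsto_inverse_vabs)

lemma vabs_coord_le_dist: "vabs (x $ i - y $ i) \<le> dist x (y :: ('k :: rat_completion) ^ 'n :: finite)"
  using dist_vec_nth_le[of x i y] by (simp add: dist_vabs)

lemma dist_le_coords:
  fixes x y :: "('k :: rat_completion) ^ 'n :: finite"
  assumes "\<And>i. vabs (x $ i - y $ i) \<le> r"
  shows "dist x y \<le> real CARD('n) * r"
proof -
  have "dist x y \<le> (\<Sum>i\<in>UNIV. \<bar>dist (x $ i) (y $ i)\<bar>)"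
    unfolding dist_vec_def by (rule L2_set_le_sum_abs)
  also have "\<dots> \<le> (\<Sum>i\<in>(UNIV :: 'n set). r)" using assms by (intro sum_mono) (simp add: dist_vabs)
  finally show ?thesis by simp
qed

section \<open>Charts of projective space\<close>

definition coord_box :: "real \<Rightarrow> ('k :: rat_completion ^ 'n :: finite) set" where
  "coord_box s = {x. \<forall>j. vabs (x $ j) \<le> s}"

definition chart :: "'n \<Rightarrow> 'k :: field ^ 'n :: finite \<Rightarrow> 'k ^ 'n" where
  "chart i x = (\<chi> j. x $ j / x $ i)"

definition chart_cube :: "'n \<Rightarrow> ('k :: rat_completion ^ 'n :: finite) set" where
  "chart_cube i = {u. u $ i = 1 \<and> (\<forall>j. vabs (u $ j) \<le> 1)}"

definition chart_cone :: "'n \<Rightarrow> ('k :: rat_completion ^ 'n :: finite) set" where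
  "chart_cone i = {x. x $ i \<noteq> 0 \<and> vabs (x $ i) \<le> 2 \<and> (\<forall>j. vabs (x $ j) \<le> vabs (x $ i))}"

definition rational_points :: "'n \<Rightarrow> nat \<Rightarrow> ('k :: rat_completion ^ 'n :: finite) set" where
  "rational_points i N = {u \<in> chart_cube i. \<exists>y :: int ^ 'n. y $ i \<noteq> 0 \<and> (\<forall>j. \<bar>y $ j\<bar> \<le> int N) \<and>
     u = chart i (\<chi> j. of_int (y $ j))}"

lemma continuous_on_chart:
  "(\<And>x. x \<in> S \<Longrightarrow> x $ i \<noteq> 0) \<Longrightarrow> continuous_on S (chart i :: 'k :: rat_completion ^ 'n :: finite \<Rightarrow> _)"
  unfolding chart_def by (intro continuous_on_vec_lambda continuous_on_vabs(4) continuous_on_component) auto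

lemma borel_measurable_vabs_coord [measurable]:
  "(\<lambda>x :: 'k :: rat_completion ^ 'n :: finite. vabs (x $ j)) \<in> borel_measurable borel"
  by (intro borel_measurable_continuous_onI continuous_on_vabs(1) continuous_on_component continuous_on_id)

lemma borel_measurable_vabs_coord_diff [measurable]:
  "(\<lambda>x :: 'k :: rat_completion ^ 'n :: finite. vabs (x $ j - c)) \<in> borel_measurable borel"
  by (intro borel_measurable_continuous_onI continuous_on_vabs continuous_on_component continuous_on_const continuous_on_id)

lemma borel_measurable_vabs_wedge [measurable]:
  "(\<lambda>x :: 'k :: rat_completion ^ 'n :: finite. vabs (x $ j * c - x $ i * d)) \<in> borel_measurable borel"
  by (intro borel_measurable_continuous_onI continuous_on_vabs continuous_on_component continuous_on_const continuous_on_id)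

lemma coord_box_borel [measurable]: "coord_box s \<in> sets borel"
  unfolding coord_box_def by measurable

lemma chart_cube_borel [measurable]: "(chart_cube i :: ('k :: rat_completion ^ 'n :: finite) set) \<in> sets borel"
proof -
  have "chart_cube i = {u :: 'k ^ 'n. vabs (u $ i - 1) = 0 \<and> (\<forall>j. vabs (u $ j) \<le> 1)}"
    by (simp add: chart_cube_def)
  also have "\<dots> \<in> sets borel" by measurable
  finally show ?thesis .
qed

lemma chart_cone_borel [measurable]: "(chart_cone i :: ('k :: rat_completion ^ 'n :: finite) set) \<in> sets borel"
proof -
  have "chart_cone i = {x :: 'k ^ 'n. vabs (x $ i) \<noteq> 0 \<and> vabs (x $ i) \<le> 2 \<and> (\<forall>j. vabs (x $ j) \<le> vabs (x $ i))}"
    by (simp add: chart_cone_def)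
  also have "\<dots> \<in> sets borel" by measurable
  finally show ?thesis .
qed

lemma finite_rational_points: "finite (rational_points i N :: ('k :: rat_completion ^ 'n :: finite) set)"
proof (rule finite_subset)
  show "(rational_points i N :: ('k ^ 'n) set) \<subseteq> (\<lambda>f. chart i (\<chi> j. of_int (f j))) ` (\<Pi>\<^sub>E j\<in>(UNIV :: 'n set). {- int N..int N})"
  proof
    fix u :: "'k ^ 'n" assume "u \<in> rational_points i N"
    then obtain y :: "int ^ 'n" where y: "\<forall>j. \<bar>y $ j\<bar> \<le> int N" "u = chart i (\<chi> j. of_int (y $ j))"
      by (auto simp: rational_points_def)
    show "u \<in> (\<lambda>f. chart i (\<chi> j. of_int (f j))) ` (\<Pi>\<^sub>E j\<in>(UNIV :: 'n set). {- int N..int N})"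
      using y by (intro image_eqI[of _ _ "($) y"]) (auto simp: abs_le_iff minus_le_iff)
  qed
qed (intro finite_imageI finite_PiE, auto)

lemma vabs_pos_iff [simp]: "0 < vabs x \<longleftrightarrow> x \<noteq> (0 :: 'k :: rat_completion)"
  by (simp add: less_le)

lemma chart_in_cube: "x \<in> chart_cone i \<Longrightarrow> chart i x \<in> chart_cube i"
  by (auto simp: chart_cone_def chart_cube_def chart_def vabs_divide divide_le_eq_1)

definition grid_vectors :: "'n \<Rightarrow> 'k set \<Rightarrow> ('k :: rat_completion ^ 'n :: finite) set" where
  "grid_vectors i V = {w. w $ i = 0 \<and> (\<forall>j. j \<noteq> i \<longrightarrow> w $ j \<in> V)}"

lemma grid_vectors:
  assumes "finite V"
  shows "finite (grid_vectors i V :: ('k :: rat_completion ^ 'n :: finite) set)"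
    and "card (grid_vectors i V :: ('k ^ 'n) set) = card V ^ (CARD('n) - 1)"
proof -
  let ?P = "\<Pi>\<^sub>E j\<in>UNIV - {i}. V"
  let ?h = "\<lambda>f. (\<chi> j. if j = i then 0 else f j) :: 'k ^ 'n"
  have eq: "grid_vectors i V = ?h ` ?P"
  proof
    show "grid_vectors i V \<subseteq> ?h ` ?P"
    proof
      fix w :: "'k ^ 'n" assume w: "w \<in> grid_vectors i V"
      show "w \<in> ?h ` ?P"
        by (rule image_eqI[of _ _ "restrict (($) w) (UNIV - {i})"])
          (use w in \<open>auto simp: grid_vectors_def vec_eq_iff\<close>)
    qed
    show "?h ` ?P \<subseteq> grid_vectors i V"
    proof
      fix w assume "w \<in> ?h ` ?P"
      then obtain f where f: "f \<in> ?P" "w = ?h f" by blast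
      have "f j \<in> V" if "j \<noteq> i" for j using PiE_mem[OF f(1)] that by simp
      thus "w \<in> grid_vectors i V" unfolding f(2) grid_vectors_def by simp
    qed
  qed
  have inj: "inj_on ?h ?P"
  proof (rule inj_onI)
    fix f g assume fg: "f \<in> ?P" "g \<in> ?P" "?h f = ?h g"
    show "f = g"
    proof (rule PiE_ext[OF fg(1,2)])
      fix j assume "j \<in> UNIV - {i}"
      thus "f j = g j" using arg_cong[OF fg(3), of "\<lambda>w. w $ j"] by simp
    qed
  qed
  show "finite (grid_vectors i V :: ('k ^ 'n) set)"
    unfolding eq using assms by (intro finite_imageI finite_PiE) auto
  show "card (grid_vectors i V :: ('k ^ 'n) set) = card V ^ (CARD('n) - 1)"
    unfolding eq card_image[OF inj] by (simp add: card_PiE)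
qed

lemma exists_scale:
  fixes b :: nat and s :: real
  assumes "2 \<le> b" "0 < s" "s < 1"
  shows "\<exists>k. 1 / real b ^ Suc k \<le> s \<and> s < 1 / real b ^ k"
proof -
  obtain N where N: "(1 / real b) ^ N < s"
    using real_arch_pow_inv[OF assms(2), of "1 / real b"] assms(1) by auto
  define K where "K = (LEAST N. 1 / real b ^ N \<le> s)"
  have K: "1 / real b ^ K \<le> s"
    unfolding K_def by (rule LeastI[of _ N]) (use N in \<open>simp add: power_one_over\<close>)
  moreover have "K \<noteq> 0" using K assms(3) by (intro notI) simp
  moreover have "\<not> 1 / real b ^ (K - 1) \<le> s"
    using not_less_Least[of "K - 1" "\<lambda>N. 1 / real b ^ N \<le> s"] \<open>K \<noteq> 0\<close> by (simp add: K_def)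
  ultimately show ?thesis by (intro exI[of _ "K - 1"]) simp
qed

lemma translate_borel:
  fixes A :: "('k :: rat_completion ^ 'n :: finite) set"
  assumes "A \<in> sets borel"
  shows "(\<lambda>x. a + x) ` A \<in> sets borel"
proof -
  let ?f = "\<lambda>x :: 'k ^ 'n. \<chi> j. x $ j - a $ j"
  have "(\<lambda>x. a + x) ` A = ?f -` A \<inter> space borel"
  proof (rule Set.set_eqI, rule iffI)
    fix x assume "x \<in> ?f -` A \<inter> space borel"
    moreover have "x = a + ?f x" by (simp add: vec_eq_iff)
    ultimately show "x \<in> (\<lambda>x. a + x) ` A" by blast
  next
    fix x assume "x \<in> (\<lambda>x. a + x) ` A"
    then obtain z where "z \<in> A" "x = a + z" by blast
    moreover from this have "?f x = z" by (simp add: vec_eq_iff)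
    ultimately show "x \<in> ?f -` A \<inter> space borel" by simp
  qed
  also have "?f \<in> borel_measurable borel"
    by (intro borel_measurable_continuous_onI continuous_on_vec_lambda continuous_on_vabs(2)
        continuous_on_component continuous_on_const continuous_on_id)
  hence "?f -` A \<inter> space borel \<in> sets borel" by (rule measurable_sets) (rule assms)
  finally show ?thesis .
qed

text \<open>
  What the argument uses about the place: a translation invariant measure, grids of about \<open>b ^ k\<close>
  points at mutual distance at least \<open>b ^ (- k)\<close>, balls of the unit ball that are centred away from its boundary,
  and a Dirichlet theorem. In the latter the set \<open>B\<close> collects the exceptional balls around points
  of small height.
\<close>

locale approximation_place =
  fixes \<beta> :: "(('k :: {rat_completion, second_countable_topology}) ^ 'n :: finite) measure" and b :: nat
  assumes sets_\<beta>: "sets \<beta> = sets borel"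
    and translation: "\<And>a A. A \<in> sets borel \<Longrightarrow> emeasure \<beta> ((\<lambda>x. a + x) ` A) = emeasure \<beta> A"
    and coord_box_finite: "\<And>s. emeasure \<beta> (coord_box s) < \<infinity>"
    and coord_box_pos: "\<And>s. 0 < s \<Longrightarrow> 0 < emeasure \<beta> (coord_box s)"
    and dim: "2 \<le> CARD('n)" and base: "2 \<le> b"
    and grid: "\<And>k. \<exists>V :: 'k set. finite V \<and> b ^ k \<le> card V \<and> card V \<le> 7 * b ^ k \<and>
      (\<forall>v\<in>V. vabs v \<le> 3) \<and> (\<forall>v\<in>V. \<forall>w\<in>V. v \<noteq> w \<longrightarrow> 1 / real b ^ k \<le> vabs (v - w)) \<and>
      (\<forall>x y z. vabs x \<le> 1 \<longrightarrow> vabs (y - 1) \<le> 1 / 2 \<longrightarrow> vabs z \<le> 1 \<longrightarrow>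
        (\<exists>v\<in>V. vabs (x - y * z - v) \<le> 1 / real b ^ k))"
    and interior_ball: "\<And>(x :: 'k) r. vabs x \<le> 1 \<Longrightarrow> 0 < r \<Longrightarrow> r \<le> 1 \<Longrightarrow>
      \<exists>x'. vabs (x' - x) \<le> r / 2 \<and> (\<forall>u. vabs (u - x') \<le> r / 2 \<longrightarrow> vabs u \<le> 1)"
    and dirichlet: "\<And>(i :: 'n) e. 0 < e \<Longrightarrow> \<exists>A>0. \<forall>x\<in>chart_cube i :: ('k ^ 'n) set. \<forall>r. 0 < r \<longrightarrow> r \<le> 1 \<longrightarrow>
      (\<forall>\<^sub>F t in sequentially. \<exists>B. finite B \<and> (\<forall>(y, s)\<in>B. y \<in> chart_cube i \<and> 0 < s) \<and>
        (\<Sum>(y, s)\<in>B. s ^ (CARD('n) - 1)) \<le> e * r ^ (CARD('n) - 1) \<and>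
        cball x r \<inter> chart_cube i \<subseteq>
          (\<Union>y\<in>rational_points i (b ^ ((CARD('n) - 1) * t)). cball y (A * (1 / real b ^ CARD('n)) ^ t)) \<union>
          (\<Union>(y, s)\<in>B. cball y s))"
begin

lemma packing:
  assumes W: "finite W" and T: "T \<in> sets borel" and S: "S \<in> sets borel" "emeasure \<beta> S < \<infinity>"
    and disj: "\<And>v w x y. v \<in> W \<Longrightarrow> w \<in> W \<Longrightarrow> x \<in> T \<Longrightarrow> y \<in> T \<Longrightarrow> v + x = w + y \<Longrightarrow> v = w"
    and sub: "\<And>w x. w \<in> W \<Longrightarrow> x \<in> T \<Longrightarrow> w + x \<in> S"
  shows "real (card W) * measure \<beta> T \<le> measure \<beta> S"
proof -
  have "of_nat (card W) * emeasure \<beta> T = (\<Sum>w\<in>W. emeasure \<beta> ((\<lambda>x. w + x) ` T))"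
    using translation[OF T] by simp
  also have "\<dots> = emeasure \<beta> (\<Union>w\<in>W. (\<lambda>x. w + x) ` T)"
  proof (rule sum_emeasure)
    show "disjoint_family_on (\<lambda>w. (\<lambda>x. w + x) ` T) W"
      using disj unfolding disjoint_family_on_def by (fastforce simp: image_iff)
  qed (use W translate_borel[OF T] sets_\<beta> in auto)
  also have "\<dots> \<le> emeasure \<beta> S" using sub S sets_\<beta> by (intro emeasure_mono) auto
  finally have "enn2real (of_nat (card W) * emeasure \<beta> T) \<le> enn2real (emeasure \<beta> S)"
    using S by (intro enn2real_mono) auto
  thus ?thesis by (simp add: measure_def enn2real_mult)
qed

lemma covering:
  assumes W: "finite W" and T: "T \<in> sets borel" "emeasure \<beta> T < \<infinity>"
    and sub: "S \<subseteq> (\<Union>w\<in>W. (\<lambda>x. w + x) ` T)"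
  shows "measure \<beta> S \<le> real (card W) * measure \<beta> T"
proof -
  have "emeasure \<beta> S \<le> emeasure \<beta> (\<Union>w\<in>W. (\<lambda>x. w + x) ` T)"
    using W translate_borel[OF T(1)] sets_\<beta> by (intro emeasure_mono sub) auto
  also have "\<dots> \<le> (\<Sum>w\<in>W. emeasure \<beta> ((\<lambda>x. w + x) ` T))"
    using W translate_borel[OF T(1)] sets_\<beta> by (intro emeasure_subadditive_finite) auto
  also have "\<dots> = of_nat (card W) * emeasure \<beta> T" using translation[OF T(1)] by simp
  finally have "enn2real (emeasure \<beta> S) \<le> enn2real (of_nat (card W) * emeasure \<beta> T)"
    using T by (intro enn2real_mono) (simp_all add: ennreal_mult_less_top ennreal_of_nat_eq_real_of_nat)
  thus ?thesis by (simp add: measure_def enn2real_mult)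
qed

lemma box_subset_finite: "S \<subseteq> coord_box s \<Longrightarrow> emeasure \<beta> S < \<infinity>"
  using emeasure_mono[of S "coord_box s" \<beta>] coord_box_finite[of s] sets_\<beta>
  by (metis coord_box_borel le_less_trans)

lemma measure_mono_box:
  "S \<subseteq> T \<Longrightarrow> T \<subseteq> coord_box s \<Longrightarrow> T \<in> sets borel \<Longrightarrow> measure \<beta> S \<le> measure \<beta> T"
  unfolding measure_def using box_subset_finite[of T s] sets_\<beta>
  by (intro enn2real_mono emeasure_mono) auto

definition chart_measure :: "'n \<Rightarrow> ('k ^ 'n) measure" where
  "chart_measure i = distr (restrict_space \<beta> (chart_cone i)) borel (chart i)"

lemma chart_measurable: "chart i \<in> measurable (restrict_space \<beta> (chart_cone i)) borel"
proof -
  have "chart i \<in> borel_measurable (restrict_space borel (chart_cone i :: ('k ^ 'n) set))"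
    by (intro borel_measurable_continuous_on_restrict continuous_on_chart) (auto simp: chart_cone_def)
  moreover have "sets (restrict_space \<beta> (chart_cone i)) = sets (restrict_space borel (chart_cone i))"
    by (rule sets_restrict_space_cong) (rule sets_\<beta>)
  ultimately show ?thesis using measurable_cong_sets by blast
qed

lemma space_\<beta>: "space \<beta> = UNIV"
  using sets_eq_imp_space_eq[OF sets_\<beta>] by simp

lemma emeasure_chart_measure:
  assumes "S \<in> sets borel"
  shows "emeasure (chart_measure i) S = emeasure \<beta> {x \<in> chart_cone i. chart i x \<in> S}"
proof -
  have "emeasure (chart_measure i) S
      = emeasure (restrict_space \<beta> (chart_cone i)) (chart i -` S \<inter> space (restrict_space \<beta> (chart_cone i)))"
    unfolding chart_measure_def by (rule emeasure_distr[OF chart_measurable assms])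
  also have "\<dots> = emeasure \<beta> (chart i -` S \<inter> space (restrict_space \<beta> (chart_cone i)))"
    by (rule emeasure_restrict_space) (auto simp: sets_\<beta> space_\<beta> space_restrict_space)
  also have "chart i -` S \<inter> space (restrict_space \<beta> (chart_cone i)) = {x \<in> chart_cone i. chart i x \<in> S}"
    by (auto simp: space_restrict_space space_\<beta>)
  finally show ?thesis .
qed

lemma measure_chart_measure:
  "S \<in> sets borel \<Longrightarrow> measure (chart_measure i) S = measure \<beta> {x \<in> chart_cone i. chart i x \<in> S}"
  by (simp add: measure_def emeasure_chart_measure)

lemma sets_chart_measure: "sets (chart_measure i) = sets borel"
  by (simp add: chart_measure_def)

lemma chart_cone_box: "(chart_cone i :: ('k ^ 'n) set) \<subseteq> coord_box 2"
  unfolding chart_cone_def coord_box_def using order_trans by blast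

lemma finite_chart_measure: "finite_measure (chart_measure i)"
proof
  have "emeasure (chart_measure i) UNIV \<noteq> \<infinity>"
    using box_subset_finite[OF chart_cone_box[of i]] by (subst emeasure_chart_measure) auto
  thus "emeasure (chart_measure i) (space (chart_measure i)) \<noteq> \<infinity>" by (simp add: chart_measure_def)
qed

lemma chart_ball_upper:
  assumes u: "u \<in> chart_cube i" and r: "0 < r"
  shows "measure (chart_measure i) (cball u r)
    \<le> measure \<beta> (coord_box 5) * (8 * real b) ^ (CARD('n) - 1) * r ^ (CARD('n) - 1)"
proof -
  let ?m = "CARD('n) - 1"
  define T where "T = {x :: 'k ^ 'n. vabs (x $ i) \<le> 2 \<and> (\<forall>j. vabs (x $ j) \<le> 2) \<and> (\<forall>j. vabs (x $ j * 1 - x $ i * u $ j) \<le> 2 * r)}"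
  have T: "T \<in> sets borel" unfolding T_def by measurable
  have Tj: "vabs (x $ j * 1 - x $ i * u $ j) \<le> 2 * r" if "x \<in> T" for x j
    using that unfolding T_def by blast
  have T2: "T \<subseteq> coord_box 2" "coord_box 2 \<subseteq> (coord_box 5 :: ('k ^ 'n) set)"
    by (auto simp: T_def coord_box_def intro: order_trans)
  have "measure (chart_measure i) (cball u r) = measure \<beta> {x \<in> chart_cone i. chart i x \<in> cball u r}"
    by (rule measure_chart_measure) simp
  also have "\<dots> \<le> measure \<beta> T"
  proof (rule measure_mono_box[OF _ T2(1) T])
    show "{x \<in> chart_cone i. chart i x \<in> cball u r} \<subseteq> T"
    proof
      fix x assume x: "x \<in> {x \<in> chart_cone i. chart i x \<in> cball u r}"
      hence x0: "x $ i \<noteq> 0" "vabs (x $ i) \<le> 2" "\<And>j. vabs (x $ j) \<le> vabs (x $ i)"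
        by (auto simp: chart_cone_def)
      have "vabs (x $ j * 1 - x $ i * u $ j) \<le> 2 * r" for j
      proof -
        have "vabs (x $ j / x $ i - u $ j) \<le> r"
          using vabs_coord_le_dist[of "chart i x" j u] x by (simp add: chart_def dist_commute)
        hence "vabs (x $ i) * vabs (x $ j / x $ i - u $ j) \<le> 2 * r"
          using x0(2) r by (intro mult_mono) auto
        thus ?thesis using x0(1) by (simp add: vabs_mult[symmetric] right_diff_distrib)
      qed
      thus "x \<in> T" using x0(2,3) order_trans[OF x0(3) x0(2)] by (simp add: T_def)
    qed
  qed
  also have "\<dots> \<le> measure \<beta> (coord_box 5) * (8 * real b * r) ^ ?m"
  proof (cases "4 * r < 1")
    case False
    have "measure \<beta> T \<le> measure \<beta> (coord_box 5) * 1"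
      using measure_mono_box[of T "coord_box 5" 5] T2 by auto
    also have "1 \<le> 8 * real b * r"
    proof -
      have "2 * (1 / 4) \<le> 2 * r" using False by (intro mult_left_mono) auto
      hence "1 * (1 / 2) \<le> real b * (2 * r)" using base by (intro mult_mono) auto
      thus ?thesis by simp
    qed
    hence "measure \<beta> (coord_box 5) * 1 \<le> measure \<beta> (coord_box 5) * (8 * real b * r) ^ ?m"
      by (intro mult_left_mono) auto
    finally show ?thesis .
  next
    case True
    obtain k where k: "1 / real b ^ Suc k \<le> 4 * r" "4 * r < 1 / real b ^ k"
      using exists_scale[OF base _ True] r by auto
    obtain V :: "'k set" where V: "finite V" "b ^ k \<le> card V" "\<forall>v\<in>V. vabs v \<le> 3"
      "\<forall>v\<in>V. \<forall>w\<in>V. v \<noteq> w \<longrightarrow> 1 / real b ^ k \<le> vabs (v - w)"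
      using grid[of k] by blast
    let ?W = "grid_vectors i V :: ('k ^ 'n) set"
    have "real (card ?W) * measure \<beta> T \<le> measure \<beta> (coord_box 5)"
    proof (rule packing)
      show "finite ?W" by (rule grid_vectors(1)[OF V(1)])
      fix v w x y assume v: "v \<in> ?W" "w \<in> ?W" and x: "x \<in> T" "y \<in> T" and eq: "v + x = w + y"
      have eqj: "v $ j + x $ j = w $ j + y $ j" for j using arg_cong[OF eq, of "\<lambda>z. z $ j"] by simp
      have "x $ i = y $ i" using eqj[of i] v by (simp add: grid_vectors_def)
      show "v = w"
      proof (rule ccontr)
        assume "v \<noteq> w"
        then obtain j where j: "v $ j \<noteq> w $ j" by (auto simp: vec_eq_iff)
        hence "j \<noteq> i" using v by (auto simp: grid_vectors_def)
        hence "1 / real b ^ k \<le> vabs (v $ j - w $ j)" using V(4) v j by (auto simp: grid_vectors_def)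
        also have "v $ j - w $ j = (y $ j * 1 - y $ i * u $ j) - (x $ j * 1 - x $ i * u $ j)"
          using eqj[of j] \<open>x $ i = y $ i\<close> by (simp add: algebra_simps)
        also have "vabs \<dots> \<le> 2 * r + 2 * r"
          by (rule order_trans[OF vabs_triangle_minus add_mono[OF Tj[OF x(2)] Tj[OF x(1)]]])
        finally show False using k(2) by simp
      qed
    next
      fix w x assume w: "w \<in> ?W" and x: "x \<in> T"
      have "vabs (w $ j + x $ j) \<le> 3 + 2" for j
        using w V(3) x by (intro order_trans[OF vabs_triangle] add_mono)
          (cases "j = i"; auto simp: grid_vectors_def T_def)+
      thus "w + x \<in> coord_box 5" by (simp add: coord_box_def)
    qed (use T coord_box_finite in auto)
    moreover have "(real b ^ k) ^ ?m \<le> real (card ?W)"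
    proof -
      have "(b ^ k) ^ ?m \<le> card ?W" unfolding grid_vectors(2)[OF V(1)] using V(2) by (intro power_mono) auto
      thus ?thesis by (metis of_nat_le_iff of_nat_power)
    qed
    ultimately have le: "(real b ^ k) ^ ?m * measure \<beta> T \<le> measure \<beta> (coord_box 5)"
      by (meson measure_nonneg mult_right_mono order_trans)
    have "0 < (real b ^ k) ^ ?m" using base by simp
    hence "measure \<beta> T \<le> measure \<beta> (coord_box 5) / (real b ^ k) ^ ?m"
      using le by (subst pos_le_divide_eq) (simp_all only: mult.commute)
    also have "\<dots> = measure \<beta> (coord_box 5) * (1 / real b ^ k) ^ ?m"
      unfolding power_one_over times_divide_eq_right mult_1_right ..
    finally have "measure \<beta> T \<le> measure \<beta> (coord_box 5) * (1 / real b ^ k) ^ ?m" .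
    also have "1 / real b ^ k \<le> 8 * real b * r"
    proof -
      have "1 / real b ^ k = real b * (1 / real b ^ Suc k)" using base by simp
      also have "\<dots> \<le> real b * (4 * r)" using k(1) by (intro mult_left_mono) auto
      also have "\<dots> \<le> 8 * real b * r" using r by simp
      finally show ?thesis .
    qed
    hence "measure \<beta> (coord_box 5) * (1 / real b ^ k) ^ ?m \<le> measure \<beta> (coord_box 5) * (8 * real b * r) ^ ?m"
      by (intro mult_left_mono power_mono) auto
    finally show ?thesis .
  qed
  also have "\<dots> = measure \<beta> (coord_box 5) * (8 * real b) ^ ?m * r ^ ?m"
    unfolding power_mult_distrib[of "8 * real b" r] by (rule mult.assoc[symmetric])
  finally show ?thesis .
qed

lemma chart_ball_lower:
  assumes u: "u \<in> chart_cube i" and r: "0 < r" "r \<le> 1"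
  shows "measure \<beta> (coord_box (1 / 2)) / (28 * real CARD('n) * real b) ^ (CARD('n) - 1) * r ^ (CARD('n) - 1)
    \<le> measure (chart_measure i) (cball u r)"
proof -
  let ?m = "CARD('n) - 1" and ?n = "real CARD('n)"
  define r' where "r' = r / ?n"
  have r': "0 < r'" "r' \<le> 1" using r dim by (auto simp: r'_def field_simps)
  have "\<exists>x'. vabs (x' - u $ j) \<le> r' / 2 \<and> (\<forall>v. vabs (v - x') \<le> r' / 2 \<longrightarrow> vabs v \<le> 1)" for j
    using interior_ball[of "u $ j" r'] u r' by (auto simp: chart_cube_def)
  then obtain c where c: "\<And>j. vabs (c j - u $ j) \<le> r' / 2"
    "\<And>j v. vabs (v - c j) \<le> r' / 2 \<Longrightarrow> vabs v \<le> 1" by metis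
  have c1: "vabs (c j) \<le> 1" for j using c(2)[of "c j" j] r' by simp
  obtain k where k: "1 / real b ^ Suc k \<le> r' / 4" "r' / 4 < 1 / real b ^ k"
    using exists_scale[OF base, of "r' / 4"] r' by auto
  define h where "h = 1 / real b ^ Suc k"
  have h0: "h > 0" using base by (simp add: h_def)
  have h: "h \<le> r' / 4" "r' / (4 * real b) \<le> h" using k base by (auto simp: h_def field_simps)
  obtain V :: "'k set" where V: "finite V" "card V \<le> 7 * b ^ Suc k"
    "\<forall>x y z. vabs x \<le> 1 \<longrightarrow> vabs (y - 1) \<le> 1 / 2 \<longrightarrow> vabs z \<le> 1 \<longrightarrow> (\<exists>v\<in>V. vabs (x - y * z - v) \<le> h)"
    using grid[of "Suc k"] unfolding h_def by blast
  let ?W = "grid_vectors i V :: ('k ^ 'n) set"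
  define T where "T = {x :: 'k ^ 'n. vabs (x $ i - 1) \<le> 1 / 2 \<and> (\<forall>j\<in>UNIV - {i}. vabs (x $ j * 1 - x $ i * c j) \<le> h)}"
  have T: "T \<in> sets borel" unfolding T_def by measurable
  have T0: "1 / 2 \<le> vabs (x $ i)" "vabs (x $ i) \<le> 3 / 2" if "x \<in> T" for x
    using that vabs_triangle_diff[of 1 0 "x $ i"] vabs_triangle[of "x $ i - 1" 1]
    by (auto simp: T_def vabs_minus_commute[of 1])
  have Tcone: "x \<in> chart_cone i \<and> chart i x \<in> cball u r" if "x \<in> T" for x
  proof -
    have x0: "x $ i \<noteq> 0" using T0[OF that] by auto
    have quot: "vabs (x $ j / x $ i - c j) \<le> r' / 2" if "j \<noteq> i" for j
    proof -
      have "x $ j / x $ i - c j = (x $ j * 1 - x $ i * c j) / x $ i" using x0 by (simp add: field_simps)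
      also have "vabs \<dots> \<le> h / (1 / 2)"
        unfolding vabs_divide using \<open>x \<in> T\<close> T0[OF \<open>x \<in> T\<close>] that h0 by (intro frac_le) (auto simp: T_def)
      finally show ?thesis using h(1) by simp
    qed
    have "vabs (x $ j / x $ i) \<le> 1" for j
      using c(2)[OF quot[of j]] x0 by (cases "j = i") auto
    hence cone: "x \<in> chart_cone i"
      using x0 T0[OF that] by (auto simp: chart_cone_def vabs_divide divide_le_eq_1)
    have "vabs (chart i x $ j - u $ j) \<le> r'" for j
    proof (cases "j = i")
      case True
      thus ?thesis using u x0 r' by (simp add: chart_def chart_cube_def)
    next
      case False
      have "vabs (x $ j / x $ i - u $ j) \<le> r' / 2 + r' / 2"
        using quot[OF False] c(1)[of j] vabs_triangle_diff[of "x $ j / x $ i" "u $ j" "c j"] by linarith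
      thus ?thesis by (simp add: chart_def)
    qed
    hence "dist (chart i x) u \<le> ?n * r'" by (rule dist_le_coords)
    thus ?thesis using cone by (simp add: r'_def dist_commute)
  qed
  have Tbox: "T \<subseteq> coord_box 2" using Tcone chart_cone_box by blast
  define D where "D = {x :: 'k ^ 'n. vabs (x $ i - 1) \<le> 1 / 2 \<and> (\<forall>j\<in>UNIV - {i}. vabs (x $ j) \<le> 1)}"
  have "measure \<beta> (coord_box (1 / 2)) = measure \<beta> ((\<lambda>x. axis i 1 + x) ` coord_box (1 / 2))"
    by (simp add: measure_def translation)
  also have "\<dots> \<le> measure \<beta> D"
  proof (rule measure_mono_box[of _ _ 2])
    show "(\<lambda>x. axis i 1 + x) ` coord_box (1 / 2) \<subseteq> D"
    proof safe
      fix x :: "'k ^ 'n" assume x: "x \<in> coord_box (1 / 2)"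
      have "vabs (x $ j) \<le> 1" for j using x by (auto simp: coord_box_def intro: order_trans[of _ "1 / 2"])
      thus "axis i 1 + x \<in> D" using x by (auto simp: D_def coord_box_def axis_def)
    qed
    show "D \<subseteq> coord_box 2"
    proof
      fix x assume x: "x \<in> D"
      have "vabs (x $ j) \<le> 2" for j
        using x vabs_triangle[of "x $ i - 1" 1] by (cases "j = i") (auto simp: D_def intro: order_trans[of _ 1])
      thus "x \<in> coord_box 2" by (simp add: coord_box_def)
    qed
    show "D \<in> sets borel" unfolding D_def by measurable
  qed
  also have "\<dots> \<le> real (card ?W) * measure \<beta> T"
  proof (rule covering)
    show "finite ?W" by (rule grid_vectors(1)[OF V(1)])
    show "D \<subseteq> (\<Union>w\<in>?W. (\<lambda>x. w + x) ` T)"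
    proof
      fix x assume x: "x \<in> D"
      have "\<exists>v\<in>V. vabs (x $ j - x $ i * c j - v) \<le> h" if "j \<noteq> i" for j
        using V(3) x c1[of j] that by (simp add: D_def)
      then obtain v where v: "\<And>j. j \<noteq> i \<Longrightarrow> v j \<in> V" "\<And>j. j \<noteq> i \<Longrightarrow> vabs (x $ j - x $ i * c j - v j) \<le> h"
        by metis
      define w :: "'k ^ 'n" where "w = (\<chi> j. if j = i then 0 else v j)"
      have "w \<in> ?W" using v by (simp add: w_def grid_vectors_def)
      moreover have "x - w \<in> T"
        using x v by (auto simp: T_def D_def w_def algebra_simps)
      moreover have "x = w + (x - w)" by simp
      ultimately show "x \<in> (\<Union>w\<in>?W. (\<lambda>x. w + x) ` T)" by blast
    qed
  qed (use T box_subset_finite[OF Tbox] in auto)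
  also have "\<dots> \<le> (7 * real b ^ Suc k) ^ ?m * measure \<beta> T"
  proof (rule mult_right_mono)
    have "card ?W \<le> (7 * b ^ Suc k) ^ ?m" unfolding grid_vectors(2)[OF V(1)] using V(2) by (intro power_mono) auto
    hence "real (card ?W) \<le> real ((7 * b ^ Suc k) ^ ?m)" by (simp only: of_nat_le_iff)
    thus "real (card ?W) \<le> (7 * real b ^ Suc k) ^ ?m" by simp
  qed simp
  also have "\<dots> \<le> (7 * real b ^ Suc k) ^ ?m * measure \<beta> {x \<in> chart_cone i. chart i x \<in> cball u r}"
  proof (intro mult_left_mono measure_mono_box[of _ _ 2])
    have "chart i -` cball u r \<inter> space (restrict_space \<beta> (chart_cone i)) \<in> sets (restrict_space \<beta> (chart_cone i))"
      using chart_measurable by (rule measurable_sets) simp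
    moreover have "chart i -` cball u r \<inter> space (restrict_space \<beta> (chart_cone i)) = {x \<in> chart_cone i. chart i x \<in> cball u r}"
      by (auto simp: space_restrict_space space_\<beta>)
    ultimately show "{x \<in> chart_cone i. chart i x \<in> cball u r} \<in> sets borel"
      by (simp add: sets_restrict_space_iff sets_\<beta> space_\<beta>)
    show "{x \<in> chart_cone i. chart i x \<in> cball u r} \<subseteq> coord_box 2" using chart_cone_box by blast
  qed (use Tcone in auto)
  also have "measure \<beta> {x \<in> chart_cone i. chart i x \<in> cball u r} = measure (chart_measure i) (cball u r)"
    by (simp add: measure_chart_measure)
  finally have "measure \<beta> (coord_box (1 / 2)) * (h / 7) ^ ?m
      \<le> (7 * real b ^ Suc k) ^ ?m * measure (chart_measure i) (cball u r) * (h / 7) ^ ?m"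
    using h0 by (intro mult_right_mono) simp_all
  also have "\<dots> = (7 * real b ^ Suc k * (h / 7)) ^ ?m * measure (chart_measure i) (cball u r)"
    unfolding power_mult_distrib[of "7 * real b ^ Suc k" "h / 7"] by (simp only: mult.commute mult.left_commute)
  also have "7 * real b ^ Suc k * (h / 7) = 1" using base by (simp add: h_def)
  also have "1 ^ ?m * measure (chart_measure i) (cball u r) = measure (chart_measure i) (cball u r)"
    by (simp only: power_one mult_1_left)
  finally have "measure \<beta> (coord_box (1 / 2)) * (h / 7) ^ ?m \<le> measure (chart_measure i) (cball u r)" .
  moreover have "measure \<beta> (coord_box (1 / 2)) * (r / (28 * ?n * real b)) ^ ?m
      \<le> measure \<beta> (coord_box (1 / 2)) * (h / 7) ^ ?m"
  proof (intro mult_left_mono power_mono)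
    have "r / (28 * ?n * real b) = (r' / (4 * real b)) / 7" by (simp add: r'_def)
    also have "\<dots> \<le> h / 7" using h(2) by (intro divide_right_mono) auto
    finally show "r / (28 * ?n * real b) \<le> h / 7" .
  qed (use r in auto)
  ultimately have le: "measure \<beta> (coord_box (1 / 2)) * (r / (28 * ?n * real b)) ^ ?m
      \<le> measure (chart_measure i) (cball u r)" by (rule order_trans[rotated])
  have "measure \<beta> (coord_box (1 / 2)) / (28 * ?n * real b) ^ ?m * r ^ ?m
      = measure \<beta> (coord_box (1 / 2)) * (r / (28 * ?n * real b)) ^ ?m"
    unfolding power_divide times_divide_eq_left times_divide_eq_right ..
  also note le
  finally show ?thesis .
qed

end

context approximation_place begin

lemma AE_chart:
  fixes \<psi> :: "nat \<Rightarrow> real" and i :: 'n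
  assumes psi: "\<And>t. 0 \<le> \<psi> t"
    and div: "\<not> summable (\<lambda>t. (\<psi> t * (real b ^ CARD('n)) ^ t) ^ (CARD('n) - 1))"
  shows "AE x in \<beta>. x \<in> chart_cone i \<longrightarrow>
    infinite {y. \<exists>t. y \<in> rational_points i (b ^ ((CARD('n) - 1) * t)) \<and> dist (chart i x) y \<le> \<psi> t}"
proof -
  let ?m = "CARD('n) - 1" and ?M = "chart_measure i" and ?l = "1 / real b ^ CARD('n)"
  let ?Q = "\<lambda>t. rational_points i (b ^ (?m * t)) :: ('k ^ 'n) set"
  interpret M: finite_measure ?M by (rule finite_chart_measure)
  define C where "C = measure \<beta> (coord_box 5) * (8 * real b) ^ ?m"
  define c where "c = measure \<beta> (coord_box (1 / 2)) / (28 * real CARD('n) * real b) ^ ?m"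
  have box_pos: "0 < measure \<beta> (coord_box s)" if "0 < s" for s
    using coord_box_pos[OF that] coord_box_finite[of s] by (simp add: measure_def enn2real_positive_iff)
  have pos: "0 < C" "0 < c" using box_pos base by (simp_all add: C_def c_def)
  define e where "e = c / (2 * C)"
  have e: "0 < e" using pos by (simp add: e_def)
  obtain A where A: "0 < A" and dir: "\<And>x r. x \<in> chart_cube i \<Longrightarrow> 0 < r \<Longrightarrow> r \<le> 1 \<Longrightarrow>
      \<forall>\<^sub>F t in sequentially. \<exists>B. finite B \<and> (\<forall>(y, s)\<in>B. y \<in> chart_cube i \<and> 0 < s) \<and>
        (\<Sum>(y, s)\<in>B. s ^ ?m) \<le> e * r ^ ?m \<and>
        cball x r \<inter> (chart_cube i :: ('k ^ 'n) set) \<subseteq>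
          (\<Union>y\<in>?Q t. cball y (A * ?l ^ t)) \<union> (\<Union>(y, s)\<in>B. cball y s)"
    using dirichlet[OF e, of i] by blast
  have upper: "measure ?M (cball u r) \<le> C * r ^ ?m" if "u \<in> chart_cube i" "0 < r" for u r
    unfolding C_def by (rule chart_ball_upper[OF that])
  have lower: "c * r ^ ?m \<le> measure ?M (cball u r)" if "u \<in> chart_cube i" "0 < r" "r \<le> 1" for u r
    unfolding c_def by (rule chart_ball_lower[OF that])
  have cb: "cball u r \<in> sets ?M" for u r by (simp add: sets_chart_measure)
  have cube: "chart_cube i \<in> sets ?M" by (simp add: sets_chart_measure)
  have concentrated: "measure ?M (S \<inter> chart_cube i) = measure ?M S" if "S \<in> sets borel" for S
  proof -
    have "{x \<in> chart_cone i. chart i x \<in> S \<inter> chart_cube i} = {x \<in> chart_cone i. chart i x \<in> S}"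
      using chart_in_cube by blast
    thus ?thesis using that by (simp add: measure_chart_measure)
  qed
  interpret ubiquitous ?M "chart_cube i" ?Q C c A ?l "c / 2" ?m
  proof unfold_locales
    show "sets ?M = sets borel" by (rule sets_chart_measure)
    show "chart_cube i \<in> sets (borel :: ('k ^ 'n) measure)" by measurable
    show "0 < ?l" using base by simp
    have "1 < real b ^ CARD('n)" using base dim by (intro one_less_power) auto
    thus "?l < 1" by (subst divide_less_eq_1_pos) linarith+
    show "0 < ?m" using dim by simp
    show "0 < c / 2" using pos by simp
    show "finite (?Q t)" for t by (rule finite_rational_points)
    show "?Q t \<subseteq> chart_cube i" for t by (auto simp: rational_points_def)
  next
    fix x :: "'k ^ 'n" and r :: real assume x: "x \<in> chart_cube i" and r: "0 < r" "r \<le> 1"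
    show "\<forall>\<^sub>F t in sequentially. c / 2 * r ^ ?m \<le> measure ?M (cball x r \<inter> (\<Union>y\<in>?Q t. cball y (A * ?l ^ t)))"
      using dir[OF x r]
    proof eventually_elim
      case (elim t)
      then obtain B where B: "finite B" "\<And>y s. (y, s) \<in> B \<Longrightarrow> y \<in> chart_cube i" "\<And>y s. (y, s) \<in> B \<Longrightarrow> 0 < s"
        "(\<Sum>(y, s)\<in>B. s ^ ?m) \<le> e * r ^ ?m"
        "cball x r \<inter> chart_cube i \<subseteq> (\<Union>y\<in>?Q t. cball y (A * ?l ^ t)) \<union> (\<Union>(y, s)\<in>B. cball y s)"
        by (auto split: prod.splits)
      let ?G = "cball x r \<inter> (\<Union>y\<in>?Q t. cball y (A * ?l ^ t))"
      let ?E = "\<Union>b\<in>B. cball (fst b) (snd b)"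
      have G: "?G \<in> sets ?M" using finite_rational_points cb by (intro sets.Int sets.finite_UN)
      have E: "?E \<in> sets ?M" using B(1) cb by (intro sets.finite_UN)
      have "c * r ^ ?m \<le> measure ?M (cball x r \<inter> chart_cube i)"
        using lower[OF x r] concentrated[of "cball x r"] by simp
      also have "\<dots> \<le> measure ?M (?G \<union> ?E)"
      proof (rule M.finite_measure_mono)
        show "cball x r \<inter> chart_cube i \<subseteq> ?G \<union> ?E"
        proof
          fix w assume w: "w \<in> cball x r \<inter> chart_cube i"
          with B(5) consider "w \<in> (\<Union>y\<in>?Q t. cball y (A * ?l ^ t))" | y s where "(y, s) \<in> B" "w \<in> cball y s"
            by blast
          thus "w \<in> ?G \<union> ?E" using w by cases (blast, force)
        qed
      qed (use G E in simp)
      also have "\<dots> \<le> measure ?M ?G + measure ?M ?E" by (rule measure_Un_le[OF G E])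
      also have "measure ?M ?E \<le> (\<Sum>b\<in>B. measure ?M (cball (fst b) (snd b)))"
        by (rule M.finite_measure_subadditive_finite[OF B(1)]) (use cb in blast)
      also have "\<dots> \<le> (\<Sum>b\<in>B. C * snd b ^ ?m)" using B(2,3) by (intro sum_mono upper) auto
      also have "\<dots> = C * (\<Sum>(y, s)\<in>B. s ^ ?m)" by (simp add: sum_distrib_left case_prod_beta)
      also have "\<dots> \<le> C * (e * r ^ ?m)" using B(4) pos by (intro mult_left_mono) auto
      also have "\<dots> = c / 2 * r ^ ?m" using pos by (simp add: e_def)
      finally show ?case by simp
    qed
  qed (use pos A upper lower in \<open>auto\<close>)
  have "AE u in ?M. u \<in> chart_cube i \<longrightarrow> infinite {y. \<exists>t. y \<in> ?Q t \<and> dist u y \<le> \<psi> t}"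
  proof (rule AE_infinitely_many[OF psi])
    have "\<psi> t / ?l ^ t = \<psi> t * (real b ^ CARD('n)) ^ t" for t by (simp add: power_one_over)
    thus "\<not> summable (\<lambda>t. (\<psi> t / ?l ^ t) ^ ?m)" using div by (simp only: not_False_eq_True)
  qed
  hence "AE x in restrict_space \<beta> (chart_cone i). chart i x \<in> chart_cube i \<longrightarrow>
      infinite {y. \<exists>t. y \<in> ?Q t \<and> dist (chart i x) y \<le> \<psi> t}"
    unfolding chart_measure_def by (rule AE_distrD[OF chart_measurable])
  hence "AE x in \<beta>. x \<in> chart_cone i \<longrightarrow> chart i x \<in> chart_cube i \<longrightarrow>
      infinite {y. \<exists>t. y \<in> ?Q t \<and> dist (chart i x) y \<le> \<psi> t}"
    by (subst (asm) AE_restrict_space_iff) (auto simp: sets_\<beta> space_\<beta>)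
  thus ?thesis using chart_in_cube by (auto elim!: eventually_mono)
qed

end

section \<open>The real place\<close>

lemma card_int_ball_le:
  fixes c h :: real
  assumes "0 \<le> h"
  shows "finite {z :: int. \<bar>of_int z - c\<bar> \<le> h}" "real (card {z :: int. \<bar>of_int z - c\<bar> \<le> h}) \<le> 2 * h + 1"
proof -
  have sub: "{z :: int. \<bar>of_int z - c\<bar> \<le> h} \<subseteq> {\<lceil>c - h\<rceil>..\<lfloor>c + h\<rfloor>}"
    by (auto simp: ceiling_le_iff le_floor_iff)
  thus "finite {z :: int. \<bar>of_int z - c\<bar> \<le> h}" by (rule finite_subset) simp
  have "card {z :: int. \<bar>of_int z - c\<bar> \<le> h} \<le> card {\<lceil>c - h\<rceil>..\<lfloor>c + h\<rfloor>}"
    by (rule card_mono[OF _ sub]) simp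
  hence "real (card {z :: int. \<bar>of_int z - c\<bar> \<le> h}) \<le> real (nat (\<lfloor>c + h\<rfloor> + 1 - \<lceil>c - h\<rceil>))" by simp
  also have "\<dots> \<le> 2 * h + 1" using assms by linarith
  finally show "real (card {z :: int. \<bar>of_int z - c\<bar> \<le> h}) \<le> 2 * h + 1" .
qed

lemma power_add_le:
  fixes x y :: real
  assumes "0 \<le> x" "0 \<le> y"
  shows "(x + y) ^ m \<le> 2 ^ m * (x ^ m + y ^ m)"
proof -
  have "(x + y) ^ m \<le> (2 * max x y) ^ m" using assms by (intro power_mono) auto
  also have "\<dots> \<le> 2 ^ m * (x ^ m + y ^ m)"
    using assms unfolding power_mult_distrib by (intro mult_left_mono) (auto simp: max_def)
  finally show ?thesis .
qed

lemma card_PiE_pointed_le: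
  fixes i :: "'n :: finite" and K :: real
  assumes "\<And>j. finite (S j)" "\<And>j. real (card (S j)) \<le> K"
  shows "finite (\<Pi>\<^sub>E j\<in>UNIV. if j = i then {a} else S j)"
    and "real (card (\<Pi>\<^sub>E j\<in>UNIV. if j = i then {a} else S j)) \<le> K ^ (CARD('n) - 1)"
proof -
  show "finite (\<Pi>\<^sub>E j\<in>UNIV. if j = i then {a} else S j)"
    using assms(1) by (intro finite_PiE) auto
  have "real (card (\<Pi>\<^sub>E j\<in>UNIV. if j = i then {a} else S j))
      = (\<Prod>j\<in>UNIV. real (card (if j = i then {a} else S j)))"
    by (simp add: card_PiE)
  also have "\<dots> = (\<Prod>j\<in>UNIV - {i}. real (card (S j)))"
    by (subst prod.remove[of _ i]) auto
  also have "\<dots> \<le> (\<Prod>j\<in>UNIV - {i}. K)" using assms(2) by (intro prod_mono) auto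
  finally show "real (card (\<Pi>\<^sub>E j\<in>UNIV. if j = i then {a} else S j)) \<le> K ^ (CARD('n) - 1)"
    by (simp add: card_Diff_subset)
qed

lemma sum_inverse_le: "(\<Sum>q\<in>{1..2 ^ s}. 1 / real q) \<le> real s + 1"
proof (induction s)
  case (Suc s)
  have "{1..2 ^ Suc s} = {1..2 ^ s} \<union> {2 ^ s + 1..2 ^ Suc s :: nat}" by auto
  hence "(\<Sum>q\<in>{1..2 ^ Suc s}. 1 / real q)
      = (\<Sum>q\<in>{1..2 ^ s}. 1 / real q) + (\<Sum>q\<in>{2 ^ s + 1..2 ^ Suc s}. 1 / real q)"
    by (simp add: sum.union_disjoint)
  also have "(\<Sum>q\<in>{2 ^ s + 1..2 ^ Suc s}. 1 / real q) \<le> (\<Sum>q\<in>{2 ^ s + 1..2 ^ Suc s :: nat}. 1 / real (2 ^ s))"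
    by (intro sum_mono divide_left_mono) (auto simp flip: of_nat_power)
  also have "\<dots> \<le> 1" by (simp add: field_simps)
  finally show ?case using Suc by simp
qed simp

lemma linear_over_power_tendsto_0:
  fixes b m :: nat
  assumes "2 \<le> b" "0 < m"
  shows "(\<lambda>t. (real (m * t) + 1) / real b ^ (m * t)) \<longlonglongrightarrow> 0"
proof -
  have b: "norm (1 / real b) < 1" using assms by simp
  have "(\<lambda>s. real s * (1 / real b) ^ s + (1 / real b) ^ s) \<longlonglongrightarrow> 0 + 0"
    by (intro tendsto_add powser_times_n_limit_0 LIMSEQ_power_zero b)
  hence "(\<lambda>s. (real s + 1) / real b ^ s) \<longlonglongrightarrow> 0" by (simp add: power_one_over field_simps add_divide_distrib)
  moreover have "strict_mono (\<lambda>t. m * t)" using assms by (intro strict_monoI) simp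
  ultimately have "((\<lambda>s. (real s + 1) / real b ^ s) \<circ> (\<lambda>t. m * t)) \<longlonglongrightarrow> 0"
    by (rule LIMSEQ_subseq_LIMSEQ)
  thus ?thesis by (simp only: o_def)
qed

lemma sum_ball_image_le:
  fixes g :: "'a \<Rightarrow> 'b \<times> real"
  assumes "finite I" "\<And>z. z \<in> I \<Longrightarrow> 0 \<le> snd (g z)"
  shows "(\<Sum>(y, s)\<in>g ` I. s ^ m) \<le> (\<Sum>z\<in>I. snd (g z) ^ m)"
  using sum_image_le[of I "\<lambda>(y, s). s ^ m" g] assms by (auto simp: case_prod_beta)

lemma coord_box_real: "(coord_box s :: (real ^ 'n :: finite) set) = cbox (\<chi> j. - s) (\<chi> j. s)"
  by (auto simp: coord_box_def vabs_real_def mem_box_cart abs_le_iff minus_le_iff)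

lemma emeasure_lborel_coord_box:
  assumes "0 < s"
  shows "0 < emeasure lborel (coord_box s :: (real ^ 'n :: finite) set)"
proof -
  have "emeasure lborel (coord_box s :: (real ^ 'n) set)
      = (\<Prod>b\<in>Basis. ((\<chi> j. s) - (\<chi> j. - s) :: real ^ 'n) \<bullet> b)"
    unfolding coord_box_real using assms by (intro emeasure_lborel_cbox) (auto simp: Basis_vec_def inner_axis)
  also have "\<dots> = ennreal (\<Prod>b\<in>(Basis :: (real ^ 'n) set). 2 * s)"
    by (intro arg_cong[of _ _ ennreal] prod.cong) (auto simp: Basis_vec_def inner_axis)
  finally show ?thesis using assms by (simp add: ennreal_zero_less_mult_iff)
qed

lemma emeasure_lborel_translate:
  fixes a :: "'a :: euclidean_space"
  assumes "A \<in> sets borel"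
  shows "emeasure lborel ((\<lambda>x. a + x) ` A) = emeasure lborel A"
proof -
  have "emeasure lborel A = emeasure (distr lborel borel ((+) (- a))) A"
    by (simp add: lborel_distr_plus)
  also have "\<dots> = emeasure lborel ((+) (- a) -` A)"
    using assms by (subst emeasure_distr) auto
  also have "(+) (- a) -` A = (\<lambda>x. a + x) ` A"
    by (auto simp: image_iff) (metis add.commute add.right_neutral add_diff_cancel_left' diff_add_cancel uminus_add_conv_diff)
  finally show ?thesis ..
qed

lemma real_grid:
  "\<exists>V :: real set. finite V \<and> 2 ^ k \<le> card V \<and> card V \<le> 7 * 2 ^ k \<and>
      (\<forall>v\<in>V. vabs v \<le> 3) \<and> (\<forall>v\<in>V. \<forall>w\<in>V. v \<noteq> w \<longrightarrow> 1 / real 2 ^ k \<le> vabs (v - w)) \<and>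
      (\<forall>x y z. vabs x \<le> 1 \<longrightarrow> vabs (y - 1) \<le> 1 / 2 \<longrightarrow> vabs z \<le> 1 \<longrightarrow>
        (\<exists>v\<in>V. vabs (x - y * z - v) \<le> 1 / real 2 ^ k))"
proof -
  let ?f = "\<lambda>j :: int. of_int j / 2 ^ k :: real"
  let ?I = "{- 3 * 2 ^ k..3 * 2 ^ k :: int}"
  have inj: "inj_on ?f ?I" by (auto simp: inj_on_def)
  have card: "card (?f ` ?I) = 6 * 2 ^ k + 1"
    unfolding card_image[OF inj] by (simp add: nat_add_distrib nat_mult_distrib nat_power_eq)
  have one: "(1 :: real) \<le> 2 ^ k" by simp
  have sep: "1 / 2 ^ k \<le> \<bar>?f j - ?f l\<bar>" if "?f j \<noteq> ?f l" for j l
  proof -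
    have "1 \<le> \<bar>j - l\<bar>" using that by auto
    hence "1 \<le> \<bar>of_int j - of_int l :: real\<bar>" by linarith
    thus ?thesis by (simp add: diff_divide_distrib[symmetric] divide_right_mono)
  qed
  have cov: "\<exists>v\<in>?f ` ?I. \<bar>x - y * z - v\<bar> \<le> 1 / 2 ^ k" if xyz: "\<bar>x\<bar> \<le> 1" "\<bar>y - 1\<bar> \<le> 1 / 2" "\<bar>z\<bar> \<le> 1" for x y z :: real
  proof -
    define w where "w = x - y * z"
    have "\<bar>y\<bar> \<le> 3 / 2" using xyz(2) by linarith
    hence "\<bar>y * z\<bar> \<le> (3 / 2) * 1" unfolding abs_mult by (rule mult_mono[OF _ xyz(3)]) simp_all
    hence w: "\<bar>w\<bar> \<le> 5 / 2" using xyz(1) unfolding w_def by linarith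
    define j where "j = \<lfloor>w * 2 ^ k\<rfloor>"
    have "w * 2 ^ k \<le> 5 / 2 * 2 ^ k" "- (5 / 2) * 2 ^ k \<le> w * 2 ^ k"
      using w by (intro mult_right_mono; auto simp: abs_le_iff)+
    hence "w * 2 ^ k \<le> 3 * 2 ^ k" "- 3 * 2 ^ k \<le> w * 2 ^ k" using one by linarith+
    hence "w * 2 ^ k \<le> of_int (3 * 2 ^ k)" "of_int (- 3 * 2 ^ k) \<le> w * 2 ^ k"
      by (simp_all only: of_int_mult of_int_power of_int_minus of_int_numeral)
    hence "j \<in> ?I" unfolding j_def atLeastAtMost_iff le_floor_iff
      by (intro conjI) (assumption, linarith)
    moreover have "\<bar>w * 2 ^ k - of_int j\<bar> \<le> 1" unfolding j_def by linarith
    hence "\<bar>w * 2 ^ k - of_int j\<bar> / 2 ^ k \<le> 1 / 2 ^ k" by (intro divide_right_mono) auto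
    moreover have "w - ?f j = (w * 2 ^ k - of_int j) / 2 ^ k" by (simp add: field_simps)
    hence "\<bar>w - ?f j\<bar> = \<bar>w * 2 ^ k - of_int j\<bar> / 2 ^ k" by simp
    ultimately have "j \<in> ?I" "\<bar>w - ?f j\<bar> \<le> 1 / 2 ^ k" by (simp_all only:)
    thus ?thesis unfolding w_def by blast
  qed
  show ?thesis
  proof (intro exI[of _ "?f ` ?I"] conjI)
    have "(2 :: nat) ^ k \<ge> 1" by simp
    thus "2 ^ k \<le> card (?f ` ?I)" "card (?f ` ?I) \<le> 7 * 2 ^ k" unfolding card by linarith+
    show "\<forall>v\<in>?f ` ?I. vabs v \<le> 3"
    proof
      fix v assume "v \<in> ?f ` ?I"
      then obtain j where j: "v = ?f j" "- 3 * 2 ^ k \<le> j" "j \<le> 3 * 2 ^ k" by auto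
      have "of_int (- 3 * 2 ^ k) \<le> (of_int j :: real)" "(of_int j :: real) \<le> of_int (3 * 2 ^ k)"
        using j by (simp_all only: of_int_le_iff)
      thus "vabs v \<le> 3" unfolding j vabs_real_def by (auto simp: abs_le_iff field_simps)
    qed
  qed (use sep cov in \<open>auto simp: vabs_real_def\<close>)
qed


lemma real_dirichlet:
  fixes i :: "'n :: finite" and e :: real
  assumes n: "2 \<le> CARD('n)" and e: "0 < e"
  shows "\<exists>A>0. \<forall>x\<in>chart_cube i :: (real ^ 'n) set. \<forall>r. 0 < r \<longrightarrow> r \<le> 1 \<longrightarrow>
      (\<forall>\<^sub>F t in sequentially. \<exists>B. finite B \<and> (\<forall>(y, s)\<in>B. y \<in> chart_cube i \<and> 0 < s) \<and>
        (\<Sum>(y, s)\<in>B. s ^ (CARD('n) - 1)) \<le> e * r ^ (CARD('n) - 1) \<and>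
        cball x r \<inter> chart_cube i \<subseteq>
          (\<Union>y\<in>rational_points i (2 ^ ((CARD('n) - 1) * t)). cball y (A * (1 / real 2 ^ CARD('n)) ^ t)) \<union>
          (\<Union>(y, s)\<in>B. cball y s))"
proof -
  define m where "m = CARD('n) - 1"
  have m: "0 < m" "CARD('n) = Suc m" using n by (auto simp: m_def)
  let ?n = "real CARD('n)"
  define d where "d = e / (2 * (8 * ?n) ^ m)"
  have d: "0 < d" using e by (simp add: d_def)
  have main: "\<forall>\<^sub>F t in sequentially. \<exists>B. finite B \<and> (\<forall>(y, s)\<in>B. y \<in> chart_cube i \<and> 0 < s) \<and>
        (\<Sum>(y, s)\<in>B. s ^ m) \<le> e * r ^ m \<and>
        cball x r \<inter> chart_cube i \<subseteq>
          (\<Union>y\<in>rational_points i (2 ^ (m * t)). cball y (?n / d * (1 / real 2 ^ Suc m) ^ t)) \<union>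
          (\<Union>(y, s)\<in>B. cball y s)" if x: "x \<in> chart_cube i" and r: "0 < r" "r \<le> 1" for x :: "real ^ 'n" and r
  proof -
    have "(\<lambda>t. (1 / 2) ^ t :: real) \<longlonglongrightarrow> 0" by (intro LIMSEQ_realpow_zero) auto
    hence ev1: "\<forall>\<^sub>F t in sequentially. (1 / 2) ^ t < r" by (rule order_tendstoD) (rule r)
    have "0 < e * r ^ m / (2 * (2 * ?n) ^ m)" using e r by simp
    hence ev2: "\<forall>\<^sub>F t in sequentially. (real (m * t) + 1) / real 2 ^ (m * t) < e * r ^ m / (2 * (2 * ?n) ^ m)"
      by (rule order_tendstoD(2)[OF linear_over_power_tendsto_0[OF order_refl m(1)]])
    from ev1 ev2 show ?thesis
    proof eventually_elim
      case (elim t)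
      define N :: nat where "N = 2 ^ t"
      have N: "0 < N" by (simp add: N_def)
      have Nm: "(2 :: nat) ^ (m * t) = N ^ m" by (simp add: N_def mult.commute flip: power_mult)
      define R where "R = {q \<in> {1..N ^ m}. real q \<le> d * real N ^ m}"
      have R1: "1 \<le> real q" if "q \<in> R" for q using that by (simp add: R_def)
      define F where "F = (\<lambda>q. \<Pi>\<^sub>E j\<in>(UNIV :: 'n set). if j = i then {int q} else
        {z. \<bar>of_int z - real q * x $ j\<bar> \<le> 2 * (real q * r)} \<inter> {- int q..int q})"
      define g where "g = (\<lambda>(q :: nat, f :: 'n \<Rightarrow> int). ((\<chi> j. of_int (f j) / real q) :: real ^ 'n, ?n / (real N * real q)))"
      define I where "I = (SIGMA q:R. F q)"
      have F: "finite (F q)" "real (card (F q)) \<le> (4 * (real q * r) + 1) ^ m" for q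
      proof -
        let ?S = "\<lambda>j. {z. \<bar>of_int z - real q * x $ j\<bar> \<le> 2 * (real q * r)} \<inter> {- int q..int q}"
        have h: "0 \<le> 2 * (real q * r)" using r by simp
        have le: "real (card (?S j)) \<le> 4 * (real q * r) + 1" for j
        proof -
          have "card (?S j) \<le> card {z :: int. \<bar>of_int z - real q * x $ j\<bar> \<le> 2 * (real q * r)}"
            using card_int_ball_le(1)[OF h] by (intro card_mono) auto
          hence "real (card (?S j)) \<le> real (card {z :: int. \<bar>of_int z - real q * x $ j\<bar> \<le> 2 * (real q * r)})"
            by (simp only: of_nat_le_iff)
          also have "\<dots> \<le> 2 * (2 * (real q * r)) + 1" by (rule card_int_ball_le(2)[OF h])
          finally show ?thesis by simp
        qed
        show "finite (F q)" unfolding F_def by (intro card_PiE_pointed_le(1)[OF _ le]) simp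
        show "real (card (F q)) \<le> (4 * (real q * r) + 1) ^ m"
          unfolding F_def m_def by (intro card_PiE_pointed_le(2) le) simp
      qed
      have I: "finite I" unfolding I_def by (intro finite_SigmaI F) (simp add: R_def)
      have Ipos: "0 < snd (g z)" if "z \<in> I" for z
        using that N R1 n by (fastforce simp: I_def g_def)
      have "(\<Sum>(y, s)\<in>g ` I. s ^ m) \<le> (\<Sum>z\<in>I. snd (g z) ^ m)"
        by (rule sum_ball_image_le[OF I]) (use Ipos in \<open>simp add: less_imp_le\<close>)
      also have "\<dots> = (\<Sum>q\<in>R. \<Sum>f\<in>F q. snd (g (q, f)) ^ m)"
        unfolding I_def by (subst sum.Sigma) (use F in \<open>auto simp: R_def case_prod_beta\<close>)
      also have "\<dots> = (\<Sum>q\<in>R. real (card (F q)) * (?n / (real N * real q)) ^ m)" by (simp add: g_def)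
      also have "\<dots> \<le> (\<Sum>q\<in>R. (?n / real N) ^ m * ((8 * r) ^ m + 2 ^ m * (1 / real q)))"
      proof (intro sum_mono)
        fix q assume q: "q \<in> R"
        note q1 = R1[OF q]
        have "real (card (F q)) * (?n / (real N * real q)) ^ m
            \<le> (4 * (real q * r) + 1) ^ m * (?n / (real N * real q)) ^ m"
          using F(2) by (intro mult_right_mono) auto
        also have "\<dots> = (?n / real N) ^ m * (4 * r + 1 / real q) ^ m"
          unfolding power_mult_distrib[symmetric] using q1 N by (intro arg_cong[of _ _ "\<lambda>z. z ^ m"]) (simp add: field_simps)
        also have "\<dots> \<le> (?n / real N) ^ m * (2 ^ m * ((4 * r) ^ m + (1 / real q) ^ m))"
          using r by (intro mult_left_mono power_add_le) auto
        also have "(1 / real q) ^ m \<le> (1 / real q) ^ 1"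
          using q1 m(1) by (intro power_decreasing) auto
        hence "(?n / real N) ^ m * (2 ^ m * ((4 * r) ^ m + (1 / real q) ^ m))
            \<le> (?n / real N) ^ m * (2 ^ m * ((4 * r) ^ m + 1 / real q))"
          by (intro mult_left_mono add_left_mono) auto
        also have "2 ^ m * ((4 * r) ^ m + 1 / real q) = (8 * r) ^ m + 2 ^ m * (1 / real q)"
          unfolding distrib_left power_mult_distrib[symmetric] mult.assoc[symmetric] by simp
        finally show "real (card (F q)) * (?n / (real N * real q)) ^ m
            \<le> (?n / real N) ^ m * ((8 * r) ^ m + 2 ^ m * (1 / real q))" .
      qed
      also have "\<dots> = (?n / real N) ^ m * (real (card R) * (8 * r) ^ m + 2 ^ m * (\<Sum>q\<in>R. 1 / real q))"
        by (simp only: sum_distrib_left[symmetric] sum.distrib sum_constant)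
      also have "\<dots> \<le> (?n / real N) ^ m * (d * real N ^ m * (8 * r) ^ m + 2 ^ m * (real (m * t) + 1))"
      proof (intro mult_left_mono add_mono mult_right_mono)
        have "R \<subseteq> {1..nat \<lfloor>d * real N ^ m\<rfloor>}" by (auto simp: R_def le_nat_floor)
        hence "card R \<le> nat \<lfloor>d * real N ^ m\<rfloor>" using card_mono[of "{1..nat \<lfloor>d * real N ^ m\<rfloor>}" R] by simp
        thus "real (card R) \<le> d * real N ^ m" using d by (simp add: le_nat_floor of_nat_floor le_nat_iff le_floor_iff)
        have "(\<Sum>q\<in>R. 1 / real q) \<le> (\<Sum>q\<in>{1..2 ^ (m * t)}. 1 / real q)"
          unfolding Nm by (intro sum_mono2) (auto simp: R_def)
        also have "\<dots> \<le> real (m * t) + 1" by (rule sum_inverse_le)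
        finally show "(\<Sum>q\<in>R. 1 / real q) \<le> real (m * t) + 1" .
      qed (use r in auto)
      also have "\<dots> = d * (8 * ?n) ^ m * r ^ m + (2 * ?n) ^ m * ((real (m * t) + 1) / real N ^ m)"
        using N unfolding power_divide power_mult_distrib by (simp add: field_simps)
      also have "\<dots> \<le> e / 2 * r ^ m + (2 * ?n) ^ m * (e * r ^ m / (2 * (2 * ?n) ^ m))"
      proof (intro add_mono mult_left_mono)
        show "d * (8 * ?n) ^ m * r ^ m \<le> e / 2 * r ^ m" using n by (simp add: d_def)
        have "real N ^ m = real 2 ^ (m * t)" using Nm by (metis of_nat_numeral of_nat_power)
        thus "(real (m * t) + 1) / real N ^ m \<le> e * r ^ m / (2 * (2 * ?n) ^ m)" using elim(2) by simp
      qed (use n in auto)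
      also have "\<dots> = e * r ^ m" using n by simp
      finally have bad: "(\<Sum>(y, s)\<in>g ` I. s ^ m) \<le> e * r ^ m" .
      have cover: "u \<in> (\<Union>y\<in>rational_points i (2 ^ (m * t)). cball y (?n / d * (1 / real 2 ^ Suc m) ^ t)) \<union>
          (\<Union>(y, s)\<in>g ` I. cball y s)" if u: "u \<in> cball x r" "u \<in> chart_cube i" for u
      proof -
        obtain h where h: "bij_betw h {..<m} (UNIV - {i})"
          using ex_bij_betw_nat_finite[of "UNIV - {i}"] by (auto simp: m_def lessThan_atLeast0)
        obtain q p where q: "0 < q" "q \<le> int (N ^ m)"
          and p: "\<And>k. k < m \<Longrightarrow> \<bar>of_int q * (u $ h k) - of_int (p k)\<bar> < 1 / real N"
          using Dirichlet_approx_simult[OF N, of m "\<lambda>k. u $ h k"] by blast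
        define f where "f = (\<lambda>j. if j = i then q else p (the_inv_into {..<m} h j))"
        have f: "\<bar>of_int q * u $ j - of_int (f j)\<bar> < 1 / real N" for j
        proof (cases "j = i")
          case True
          thus ?thesis using u(2) N by (simp add: f_def chart_cube_def)
        next
          case False
          hence "j \<in> h ` {..<m}" using h by (simp add: bij_betw_def)
          then obtain k where k: "k < m" "j = h k" by auto
          have "the_inv_into {..<m} h j = k"
            unfolding k(2) using h k(1) by (intro the_inv_into_f_f) (auto simp: bij_betw_def)
          thus ?thesis using p[OF k(1)] False k(2) by (simp add: f_def)
        qed
        have uj: "\<bar>u $ j\<bar> \<le> 1" for j using u(2) by (simp add: chart_cube_def vabs_real_def)
        have N1: "1 / real N \<le> 1" using N by simp
        have fq: "\<bar>f j\<bar> \<le> q" for j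
        proof -
          have "\<bar>of_int q * u $ j\<bar> \<le> of_int q * 1" unfolding abs_mult using uj q by (intro mult_mono) auto
          hence "\<bar>of_int (f j) :: real\<bar> < of_int q + 1" using f[of j] N1 by linarith
          thus ?thesis by linarith
        qed
        have fi: "f i = q" by (simp add: f_def)
        define y :: "real ^ 'n" where "y = (\<chi> j. of_int (f j) / of_int q)"
        have ycube: "y \<in> chart_cube i"
          using fq q by (auto simp: y_def chart_cube_def vabs_real_def f_def abs_divide divide_le_eq_1)
            (metis abs_of_pos fq f_def of_int_abs of_int_le_iff of_int_0_less_iff)+
        have "\<bar>u $ j - y $ j\<bar> \<le> 1 / (real N * of_int q)" for j
        proof -
          have "u $ j - y $ j = (of_int q * u $ j - of_int (f j)) / of_int q" using q by (simp add: y_def field_simps)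
          hence "\<bar>u $ j - y $ j\<bar> = \<bar>of_int q * u $ j - of_int (f j)\<bar> / of_int q" using q by simp
          also have "\<dots> \<le> (1 / real N) / of_int q" using f[of j] q by (intro divide_right_mono) auto
          finally show ?thesis by simp
        qed
        hence "dist u y \<le> ?n * (1 / (real N * of_int q))"
          by (intro dist_le_coords) (simp add: vabs_real_def)
        hence dist: "dist y u \<le> ?n / (real N * of_int q)" by (simp add: dist_commute)
        show ?thesis
        proof (cases "nat q \<in> R")
          case True
          have "\<bar>of_int (f j) - of_int q * x $ j\<bar> \<le> 2 * (of_int q * r)" for j
          proof -
            have "\<bar>u $ j - x $ j\<bar> \<le> r"
              using vabs_coord_le_dist[of u j x] u(1) by (simp add: vabs_real_def dist_commute)
            hence "of_int q * \<bar>u $ j - x $ j\<bar> \<le> of_int q * r" using q by (intro mult_left_mono) auto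
            hence "\<bar>of_int q * u $ j - of_int q * x $ j\<bar> \<le> of_int q * r"
              using q by (simp add: abs_mult flip: right_diff_distrib)
            moreover have "1 / real N \<le> of_int q * r"
            proof -
              have "1 / real N \<le> 1 * r" using elim(1) by (simp add: N_def power_one_over)
              also have "\<dots> \<le> of_int q * r" using q r by (intro mult_right_mono) auto
              finally show ?thesis .
            qed
            ultimately show ?thesis using f[of j] by linarith
          qed
          note near = this
          have "- q \<le> f j" "f j \<le> q" for j using fq[of j] by linarith+
          moreover have "real (nat q) = of_int q" using q by simp
          ultimately have "f j \<in> (if j = i then {int (nat q)} else
              {z. \<bar>of_int z - real (nat q) * x $ j\<bar> \<le> 2 * (real (nat q) * r)} \<inter> {- int (nat q)..int (nat q)})" for j
            using near[of j] fi q by simp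
          hence "f \<in> F (nat q)" unfolding F_def by (intro PiE_I) auto
          hence "(nat q, f) \<in> I" using True by (simp add: I_def)
          moreover have "g (nat q, f) = (y, ?n / (real N * of_int q))" using q by (simp add: g_def y_def)
          ultimately have "(y, ?n / (real N * of_int q)) \<in> g ` I" by (metis image_eqI)
          thus ?thesis using dist by fastforce
        next
          case False
          hence "d * real N ^ m < of_int q" using q by (auto simp: R_def nat_le_iff Suc_le_eq)
          have "y \<in> rational_points i (2 ^ (m * t))"
            unfolding rational_points_def
          proof (intro CollectI conjI ycube exI)
            let ?y = "(\<chi> j. f j) :: int ^ 'n"
            show "?y $ i \<noteq> 0" using q by (simp add: f_def)
            show "\<forall>j. \<bar>?y $ j\<bar> \<le> int (2 ^ (m * t))" using fq q(2) unfolding Nm by (auto intro: order_trans)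
            show "y = chart i (\<chi> j. of_int (?y $ j))" by (simp add: y_def chart_def f_def vec_eq_iff)
          qed
          moreover have "?n / (real N * of_int q) \<le> ?n / d * (1 / real 2 ^ Suc m) ^ t"
          proof -
            have "?n / (real N * of_int q) \<le> ?n / (real N * (d * real N ^ m))"
              using \<open>d * real N ^ m < of_int q\<close> N d q(1) by (intro divide_left_mono mult_left_mono mult_pos_pos) auto
            also have "\<dots> = ?n / d * (1 / real N ^ Suc m)" by simp
            also have "1 / real N ^ Suc m = (1 / real 2 ^ Suc m) ^ t"
              by (simp add: N_def power_one_over power_mult[symmetric] mult.commute flip: power_Suc)
            finally show ?thesis .
          qed
          ultimately show ?thesis using dist by (fastforce intro: order_trans)
        qed
      qed
      show ?case
      proof (intro exI[of _ "g ` I"] conjI)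
        show "finite (g ` I)" using I by simp
        show "\<forall>(y, s)\<in>g ` I. y \<in> chart_cube i \<and> 0 < s"
        proof
          fix b assume "b \<in> g ` I"
          then obtain q f where qf: "q \<in> R" "f \<in> F q" "b = g (q, f)" by (auto simp: I_def)
          have fi: "f i = int q" using PiE_mem[OF qf(2)[unfolded F_def], of i] by simp
          have "\<bar>f j\<bar> \<le> int q" for j
            using PiE_mem[OF qf(2)[unfolded F_def], of j] by (cases "j = i") auto
          hence fle: "\<bar>of_int (f j) :: real\<bar> \<le> real q" for j by (metis of_int_abs of_int_le_iff of_int_of_nat_eq)
          have "fst b \<in> chart_cube i"
            using fi fle R1[OF qf(1)] by (auto simp: qf(3) g_def chart_cube_def vabs_real_def divide_le_eq_1)
          moreover have "0 < snd b" using Ipos qf by (auto simp: I_def)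
          ultimately show "case b of (y, s) \<Rightarrow> y \<in> chart_cube i \<and> 0 < s" by (simp add: case_prod_beta)
        qed
        show "cball x r \<inter> chart_cube i \<subseteq>
          (\<Union>y\<in>rational_points i (2 ^ (m * t)). cball y (?n / d * (1 / real 2 ^ Suc m) ^ t)) \<union>
          (\<Union>(y, s)\<in>g ` I. cball y s)" using cover by blast
      qed (rule bad)
    qed
  qed
  show ?thesis
    unfolding m_def[symmetric]
  proof (intro exI[of _ "?n / d"] conjI ballI allI impI)
    show "0 < ?n / d" using d by simp
  qed (rule main[folded m(2)])
qed

lemma approximation_place_real:
  assumes "2 \<le> CARD('n :: finite)"
  shows "approximation_place (lborel :: (real ^ 'n) measure) 2"
proof
  show "emeasure lborel ((\<lambda>x. a + x) ` A) = emeasure lborel A" if "A \<in> sets borel" for a and A :: "(real ^ 'n) set"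
    by (rule emeasure_lborel_translate[OF that])
  show "emeasure lborel (coord_box s :: (real ^ 'n) set) < \<infinity>" for s
    unfolding coord_box_real by (rule emeasure_lborel_cbox_finite)
  show "0 < emeasure lborel (coord_box s :: (real ^ 'n) set)" if "0 < s" for s
    by (rule emeasure_lborel_coord_box[OF that])
  show "\<exists>x'. vabs (x' - x) \<le> r / 2 \<and> (\<forall>u. vabs (u - x') \<le> r / 2 \<longrightarrow> vabs u \<le> 1)"
    if "vabs x \<le> 1" "0 < r" "r \<le> 1" for x r :: real
  proof (intro exI[of _ "(1 - r / 2) * x"] conjI allI impI)
    have "(1 - r / 2) * x - x = - (r / 2 * x)" by (simp add: algebra_simps)
    hence "vabs ((1 - r / 2) * x - x) = r / 2 * \<bar>x\<bar>" using that by (simp add: vabs_real_def abs_mult)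
    also have "\<dots> \<le> r / 2 * 1" using that by (intro mult_left_mono) (auto simp: vabs_real_def)
    finally show "vabs ((1 - r / 2) * x - x) \<le> r / 2" by simp
    fix u assume u: "vabs (u - (1 - r / 2) * x) \<le> r / 2"
    have "\<bar>(1 - r / 2) * x\<bar> = (1 - r / 2) * \<bar>x\<bar>" using that by (simp add: abs_mult)
    also have "\<dots> \<le> (1 - r / 2) * 1" using that by (intro mult_left_mono) (auto simp: vabs_real_def)
    finally have le: "\<bar>(1 - r / 2) * x\<bar> \<le> (1 - r / 2) * 1" .
    have "\<bar>u\<bar> \<le> \<bar>u - w\<bar> + \<bar>w\<bar>" for w by linarith
    from order_trans[OF this add_mono[OF u[unfolded vabs_real_def] le]]
    show "vabs u \<le> 1" by (simp add: vabs_real_def)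
  qed
qed (use assms real_grid real_dirichlet[OF assms] in auto)

section \<open>The \<open>p\<close>-adic absolute value and residues\<close>

lemma prime_CARD [simp]: "prime CARD('p :: prime_card)"
  using prime_card[where 'a = 'p] by simp

lemma CARD_ge_2: "2 \<le> CARD('p :: prime_card)"
  using prime_CARD[where 'p = 'p] by (rule prime_ge_2_nat)

lemma CARD_real_gt_1: "1 < real CARD('p :: prime_card)"
  using CARD_ge_2[where 'p = 'p] by linarith

lemma vabs_padic_of_rat: "vabs (of_rat q :: 'p :: prime_card padic) = rat_abs (Prime_place CARD('p)) q"
  by (simp add: vabs_of_rat place_of_padic_def)

lemma vabs_ultrametric: "vabs (x + y) \<le> max (vabs x) (vabs (y :: 'p :: prime_card padic))"
  unfolding vabs_padic_def
proof transfer
  fix X Y :: "'p rat_cauchy"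
  have "rc_abs (X + Y) n \<le> max (rc_abs X n) (rc_abs Y n)" for n
    unfolding rc_abs_def using rat_abs_prime_add[OF prime_CARD, of "Rep_rat_cauchy X n" "Rep_rat_cauchy Y n"]
    by simp
  thus "lim (rc_abs (X + Y)) \<le> max (lim (rc_abs X)) (lim (rc_abs Y))"
    by (intro LIMSEQ_le[OF rc_abs_lim tendsto_max[OF rc_abs_lim rc_abs_lim]]) auto
qed

lemma vabs_ultrametric_le:
  fixes x y :: "'p :: prime_card padic"
  assumes "vabs x \<le> r" "vabs y \<le> r"
  shows "vabs (x + y) \<le> r" "vabs (x - y) \<le> r"
  using vabs_ultrametric[of x y] vabs_ultrametric[of x "- y"] assms by auto

lemma vabs_ultrametric_diff:
  fixes x y z :: "'p :: prime_card padic"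
  assumes "vabs (x - y) \<le> r" "vabs (y - z) \<le> r"
  shows "vabs (x - z) \<le> r"
  using vabs_ultrametric_le(1)[OF assms] by simp

lemma vabs_of_int_le_iff:
  "vabs (of_int z :: 'p :: prime_card padic) \<le> 1 / real CARD('p) ^ k \<longleftrightarrow> int CARD('p) ^ k dvd z"
proof (cases "z = 0")
  case False
  let ?p = "CARD('p)"
  have u: "\<not> is_unit (int ?p)" using CARD_ge_2[where 'p = 'p] by (simp add: zdvd1_eq)
  have "vabs (of_int z :: 'p padic) = vabs (of_rat (of_int z) :: 'p padic)" by simp
  also have "\<dots> = real ?p powi (- int (multiplicity (int ?p) z))"
    unfolding vabs_padic_of_rat using False rat_valuation_frac[OF prime_CARD[where 'p = 'p], of z 1]
    by (simp add: rat_abs.simps)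
  also have "\<dots> \<le> 1 / real ?p ^ k \<longleftrightarrow> real ?p ^ k \<le> real ?p ^ multiplicity (int ?p) z"
    using CARD_real_gt_1[where 'p = 'p] by (simp add: power_int_minus field_simps)
  also have "\<dots> \<longleftrightarrow> k \<le> multiplicity (int ?p) z"
    using CARD_real_gt_1[where 'p = 'p] by (rule power_increasing_iff)
  also have "\<dots> \<longleftrightarrow> int ?p ^ k dvd z"
    by (rule power_dvd_iff_le_multiplicity[OF False u, symmetric])
  finally show ?thesis .
qed simp

lemma vabs_of_int_le_1: "vabs (of_int z :: 'p :: prime_card padic) \<le> 1"
  using vabs_of_int_le_iff[of z 0, where 'p = 'p] by simp

lemma vabs_of_nat_le_1: "vabs (of_nat z :: 'p :: prime_card padic) \<le> 1"
  using vabs_of_int_le_1[of "int z", where 'p = 'p] by simp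

lemma vabs_CARD_power: "vabs (of_nat CARD('p) ^ k :: 'p :: prime_card padic) = 1 / real CARD('p) ^ k"
proof (induction k)
  case (Suc k)
  let ?p = "CARD('p)"
  have "vabs (of_nat ?p :: 'p padic) = vabs (of_rat (of_nat ?p) :: 'p padic)" by simp
  also have "\<dots> = 1 / real ?p"
    unfolding vabs_padic_of_rat using rat_valuation_frac[OF prime_CARD[where 'p = 'p], of "int ?p" 1]
    by (simp add: rat_abs.simps power_int_minus field_simps)
  finally show ?case using Suc by (simp add: vabs_mult)
qed simp

lemma vabs_of_int_unit:
  assumes "\<not> int CARD('p) dvd z"
  shows "vabs (of_int z :: 'p :: prime_card padic) = 1"
proof -
  have "z \<noteq> 0" using assms by auto
  have "vabs (of_int z :: 'p padic) = vabs (of_rat (of_int z) :: 'p padic)" by simp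
  also have "\<dots> = 1"
    unfolding vabs_padic_of_rat using assms \<open>z \<noteq> 0\<close> rat_valuation_frac[OF prime_CARD[where 'p = 'p], of z 1]
    by (simp add: rat_abs.simps not_dvd_imp_multiplicity_0)
  finally show ?thesis .
qed

lemma padic_residue:
  fixes x :: "'p :: prime_card padic"
  assumes "vabs x \<le> 1"
  shows "\<exists>N<CARD('p) ^ k. vabs (x - of_nat N) \<le> 1 / real CARD('p) ^ k"
proof -
  let ?p = "CARD('p)"
  have p1: "1 \<le> real ?p ^ k" using CARD_real_gt_1[where 'p = 'p] by simp
  obtain q where q: "dist x (of_rat q) < 1 / real ?p ^ k"
    using completion_dense[of "1 / real ?p ^ k" x] CARD_real_gt_1[where 'p = 'p] by auto
  hence xq: "vabs (x - of_rat q) \<le> 1 / real ?p ^ k" by (simp add: dist_vabs)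
  moreover have "1 / real ?p ^ k \<le> 1" using p1 by simp
  ultimately have "vabs (x - of_rat q) \<le> 1" by linarith
  hence q1: "vabs (of_rat q :: 'p padic) \<le> 1"
    using vabs_ultrametric_le(2)[OF assms, of "x - of_rat q"] by simp
  obtain a d where ad: "quotient_of q = (a, d)" by fastforce
  have d: "d > 0" "coprime a d" "q = of_int a / of_int d"
    using quotient_of_denom_pos[OF ad] quotient_of_coprime[OF ad] quotient_of_div[OF ad] by auto
  have pd: "\<not> int ?p dvd d"
  proof
    assume dvd: "int ?p dvd d"
    hence dp: "vabs (of_int d :: 'p padic) \<le> 1 / real ?p"
      using vabs_of_int_le_iff[of d 1, where 'p = 'p] by simp
    have "of_int a = of_rat q * (of_int d :: 'p padic)" using d by (simp add: of_rat_divide)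
    hence "vabs (of_int a :: 'p padic) = vabs (of_rat q :: 'p padic) * vabs (of_int d :: 'p padic)"
      by (simp add: vabs_mult)
    also have "\<dots> \<le> 1 * (1 / real ?p)" by (rule mult_mono[OF q1 dp]) simp_all
    finally have "int ?p dvd a" using vabs_of_int_le_iff[of a 1, where 'p = 'p] by simp
    hence "int ?p dvd 1" using dvd d(2) by (metis coprime_common_divisor)
    thus False using CARD_ge_2[where 'p = 'p] by simp
  qed
  have vd: "vabs (of_int d :: 'p padic) = 1" by (rule vabs_of_int_unit[OF pd])
  have "prime (int ?p)" by simp
  hence "coprime d (int ?p ^ k)"
    using pd by (metis coprime_commute coprime_power_right_iff prime_imp_coprime)
  then obtain y where y: "[d * y = 1] (mod int ?p ^ k)" using cong_solve_coprime_int by blast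
  define N where "N = nat ((a * y) mod int ?p ^ k)"
  have pk: "0 < int ?p ^ k" using CARD_ge_2[where 'p = 'p] by simp
  have N: "int N = (a * y) mod int ?p ^ k" unfolding N_def using pk by simp
  have "int N < int ?p ^ k" unfolding N using pk by simp
  hence lt: "N < ?p ^ k" by (metis of_nat_less_iff of_nat_power)
  have "[int N = a * y] (mod int ?p ^ k)" unfolding N by (simp add: cong_def)
  hence "[int N * d = a * y * d] (mod int ?p ^ k)" by (rule cong_scalar_right)
  also have "a * y * d = a * (d * y)" by simp
  also have "[a * (d * y) = a * 1] (mod int ?p ^ k)" using y by (rule cong_scalar_left)
  finally have "int ?p ^ k dvd a - int N * d" by (simp add: cong_iff_dvd_diff dvd_diff_commute)
  hence "vabs (of_int (a - int N * d) :: 'p padic) \<le> 1 / real ?p ^ k" by (simp only: vabs_of_int_le_iff)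
  moreover have "of_rat q - of_nat N = (of_int (a - int N * d) / of_int d :: 'p padic)"
  proof -
    have "(of_rat q :: 'p padic) = of_int a / of_int d" using d by (simp add: of_rat_divide)
    thus ?thesis using d(1) by (simp add: diff_divide_distrib)
  qed
  ultimately have "vabs (of_rat q - of_nat N :: 'p padic) \<le> 1 / real ?p ^ k"
    by (simp only: vabs_divide vd div_by_1)
  from vabs_ultrametric_diff[OF xq this] lt show ?thesis by blast
qed

lemma padic_residue_unique:
  assumes "vabs (of_nat a - of_nat b :: 'p :: prime_card padic) \<le> 1 / real CARD('p) ^ k"
    and "a < CARD('p) ^ k" "b < CARD('p) ^ k"
  shows "a = b"
proof (rule ccontr)
  assume "a \<noteq> b"
  hence nz: "int a - int b \<noteq> 0" by simp
  have "vabs (of_int (int a - int b) :: 'p padic) \<le> 1 / real CARD('p) ^ k" using assms(1) by simp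
  hence dvd: "int (CARD('p) ^ k) dvd int a - int b" unfolding vabs_of_int_le_iff by simp
  from dvd_imp_le_int[OF nz dvd] assms(2,3) show False by linarith
qed

text \<open>
  The numbers \<open>\<Sum>j. d j * p ^ (- 1 - j)\<close>, where the \<open>d j\<close> are the base \<open>p\<close> digits of \<open>N\<close>,
  represent the cosets of the \<open>p\<close>-adic integers.
\<close>

function coset_rep :: "nat \<Rightarrow> 'p :: prime_card padic" where
  "coset_rep N = (if N = 0 then 0
     else (of_nat (N mod CARD('p)) + coset_rep (N div CARD('p))) / of_nat CARD('p))"
  by auto
termination
  by (relation "Wellfounded.measure id") (use CARD_ge_2[where 'p = 'a] in \<open>auto intro!: div_less_dividend\<close>)

declare coset_rep.simps [simp del]

lemma coset_rep_rec:
  "coset_rep N = (of_nat (N mod CARD('p)) + coset_rep (N div CARD('p))) / (of_nat CARD('p) :: 'p :: prime_card padic)"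
  by (cases "N = 0") (simp_all add: coset_rep.simps[of N] coset_rep.simps[of 0])

lemma coset_rep_inj:
  "vabs (coset_rep N - coset_rep N' :: 'p :: prime_card padic) \<le> 1 \<Longrightarrow> N = N'"
proof (induction "N + N'" arbitrary: N N' rule: less_induct)
  case less
  let ?p = "CARD('p)"
  show ?case
  proof (cases "N + N' = 0")
    case False
    have p2: "2 \<le> ?p" by (rule CARD_ge_2)
    have p0: "(of_nat ?p :: 'p padic) \<noteq> 0" by simp
    let ?c = "coset_rep (N div ?p) - coset_rep (N' div ?p) :: 'p padic"
    let ?d = "of_int (int (N mod ?p) - int (N' mod ?p)) :: 'p padic"
    have eq: "?d + ?c = of_nat ?p ^ 1 * (coset_rep N - coset_rep N')"
      unfolding coset_rep_rec[of N] coset_rep_rec[of N'] using p0 by (simp add: field_simps)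
    have "vabs (?d + ?c) \<le> 1 / real ?p ^ 1 * 1"
      unfolding eq vabs_mult vabs_CARD_power using less.prems by (intro mult_left_mono) auto
    hence dc: "vabs (?d + ?c) \<le> 1 / real ?p ^ 1" by simp
    also have "\<dots> \<le> 1" using p2 by simp
    finally have "vabs (?d + ?c - ?d) \<le> 1" by (rule vabs_ultrametric_le(2)[OF _ vabs_of_int_le_1])
    hence c1: "vabs ?c \<le> 1" by simp
    have "N div ?p + N' div ?p < N + N'"
    proof (cases "N = 0")
      case True
      thus ?thesis using False p2 by (simp add: div_less_dividend)
    next
      case False
      hence "N div ?p < N" using p2 by (intro div_less_dividend) auto
      thus ?thesis using div_le_dividend[of N' ?p] by linarith
    qed
    from less.hyps[OF this c1] have div: "N div ?p = N' div ?p" .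
    hence "vabs ?d \<le> 1 / real ?p ^ 1" using dc by simp
    hence dist: "vabs (of_nat (N mod ?p) - of_nat (N' mod ?p) :: 'p padic) \<le> 1 / real ?p ^ 1" by simp
    have "0 < ?p" using p2 by linarith
    hence "N mod ?p < ?p ^ 1" "N' mod ?p < ?p ^ 1" by (simp_all only: power_one_right mod_less_divisor)
    with dist have "N mod ?p = N' mod ?p" by (rule padic_residue_unique)
    thus ?thesis using div by (metis div_mult_mod_eq)
  qed simp
qed

lemma coset_rep_surj:
  "vabs x \<le> real CARD('p) ^ j \<Longrightarrow> \<exists>N<CARD('p) ^ j. vabs (x - coset_rep N :: 'p :: prime_card padic) \<le> 1"
proof (induction j arbitrary: x)
  case 0
  thus ?case by (intro exI[of _ 0]) (simp add: coset_rep.simps)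
next
  case (Suc j)
  let ?p = "CARD('p)"
  have p2: "2 \<le> ?p" by (rule CARD_ge_2)
  have "vabs (of_nat ?p ^ 1 * x) = 1 / real ?p * vabs x" unfolding vabs_mult vabs_CARD_power by simp
  also have "\<dots> \<le> 1 / real ?p * (real ?p ^ Suc j)" using Suc.prems by (intro mult_left_mono) auto
  also have "\<dots> = real ?p ^ j" by simp
  finally obtain M where M: "M < ?p ^ j" "vabs (of_nat ?p ^ 1 * x - coset_rep M) \<le> 1"
    using Suc.IH by blast
  obtain d where d: "d < ?p ^ 1" "vabs (of_nat ?p ^ 1 * x - coset_rep M - of_nat d) \<le> 1 / real ?p ^ 1"
    using padic_residue[OF M(2), of 1] by blast
  have rec: "coset_rep (?p * M + d) = (of_nat d + coset_rep M) / (of_nat ?p :: 'p padic)"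
    using d(1) by (subst coset_rep_rec) simp
  have "x - coset_rep (?p * M + d) = (of_nat ?p ^ 1 * x - coset_rep M - of_nat d) / of_nat ?p ^ 1"
    unfolding rec by (simp add: field_simps)
  hence "vabs (x - coset_rep (?p * M + d)) = vabs (of_nat ?p ^ 1 * x - coset_rep M - of_nat d) * real ?p"
    by (simp only: vabs_divide vabs_CARD_power) simp
  also have "\<dots> \<le> 1 / real ?p ^ 1 * real ?p" using d(2) by (intro mult_right_mono) auto
  finally have "vabs (x - coset_rep (?p * M + d)) \<le> 1" by simp
  moreover have "?p * M + d < ?p * (M + 1)" using d(1) by simp
  hence "?p * M + d < ?p ^ Suc j" using M(1) by (metis Suc_eq_plus1 Suc_leI less_le_trans mult_le_mono2 power_Suc)
  ultimately show ?case by blast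
qed

lemma coset_rep_scaled_surj:
  fixes x :: "'p :: prime_card padic"
  obtains N where "vabs (x - of_nat CARD('p) ^ k * coset_rep N) \<le> 1 / real CARD('p) ^ k"
proof -
  let ?p = "of_nat CARD('p) ^ k :: 'p padic"
  obtain j where "vabs (x / ?p) \<le> real CARD('p) ^ j"
    using real_arch_pow[OF CARD_real_gt_1, of "vabs (x / ?p)"] less_imp_le by blast
  then obtain N where N: "vabs (x / ?p - coset_rep N) \<le> 1" using coset_rep_surj by blast
  have "x - ?p * coset_rep N = ?p * (x / ?p - coset_rep N)" by (simp add: field_simps)
  hence "vabs (x - ?p * coset_rep N) = 1 / real CARD('p) ^ k * vabs (x / ?p - coset_rep N)"
    by (simp only: vabs_mult vabs_CARD_power)
  also have "\<dots> \<le> 1 / real CARD('p) ^ k * 1" using N by (intro mult_left_mono) auto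
  finally show ?thesis using that by simp
qed

lemma coset_rep_scaled_inj:
  assumes "vabs (of_nat CARD('p) ^ k * coset_rep N - of_nat CARD('p) ^ k * coset_rep N' :: 'p :: prime_card padic)
    \<le> 1 / real CARD('p) ^ k"
  shows "N = N'"
proof -
  have "1 / real CARD('p) ^ k * vabs (coset_rep N - coset_rep N' :: 'p padic) \<le> 1 / real CARD('p) ^ k * 1"
    using assms unfolding right_diff_distrib[symmetric] vabs_mult vabs_CARD_power by simp
  moreover have "0 < 1 / real CARD('p) ^ k" by simp
  ultimately have "vabs (coset_rep N - coset_rep N' :: 'p padic) \<le> 1" by (simp only: mult_le_cancel_left_pos)
  thus ?thesis by (rule coset_rep_inj)
qed

text \<open>
  Reflecting the base \<open>p\<close> expansion of a nonnegative real number at the point maps intervals to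
  balls of the same measure. The image of the Lebesgue measure is the Haar measure.
\<close>

lemma reflect_digits_exists:
  fixes x :: real
  assumes "0 \<le> x"
  shows "\<exists>z :: 'p :: prime_card padic. \<forall>k. vabs (z - of_nat CARD('p) ^ k * coset_rep (nat \<lfloor>x * real CARD('p) ^ k\<rfloor>))
    \<le> 1 / real CARD('p) ^ k"
proof -
  let ?p = "CARD('p)"
  have p1: "1 < real ?p" by (rule CARD_real_gt_1)
  define a where "a = (\<lambda>k. nat \<lfloor>x * real ?p ^ k\<rfloor>)"
  define s where "s = (\<lambda>k. of_nat ?p ^ k * coset_rep (a k) :: 'p padic)"
  have div: "a (Suc k) div ?p = a k" for k
  proof -
    define y where "y = x * real ?p ^ k"
    have y: "0 \<le> y" using assms by (simp add: y_def)
    have ak: "a k = nat \<lfloor>y\<rfloor>" and aSk: "a (Suc k) = nat \<lfloor>real ?p * y\<rfloor>"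
      by (simp_all add: a_def y_def mult.left_commute)
    have "real (a k) \<le> y" "y < real (Suc (a k))" unfolding ak using y by linarith+
    hence "real ?p * real (a k) \<le> real ?p * y" and lt: "real ?p * y < real ?p * real (Suc (a k))"
      using p1 by simp_all
    hence "?p * a k \<le> a (Suc k)" unfolding aSk by (intro le_nat_floor) simp
    moreover have "0 \<le> real ?p * y" using y by simp
    hence "real (a (Suc k)) \<le> real ?p * y" unfolding aSk by linarith
    hence "real (a (Suc k)) < real ?p * real (Suc (a k))" using lt by (rule le_less_trans)
    hence "real (a (Suc k)) < real (?p * Suc (a k))" by (simp only: of_nat_mult)
    hence "a (Suc k) < ?p * Suc (a k)" by (simp only: of_nat_less_iff)
    ultimately show ?thesis by (rule div_nat_eqI)
  qed
  have incr: "vabs (s (Suc k) - s k) \<le> 1 / real ?p ^ k" for k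
  proof -
    have "s (Suc k) - s k = of_nat ?p ^ k * of_nat (a (Suc k) mod ?p)"
      unfolding s_def coset_rep_rec[of "a (Suc k)"] div by (simp add: field_simps)
    hence "vabs (s (Suc k) - s k) = 1 / real ?p ^ k * vabs (of_nat (a (Suc k) mod ?p) :: 'p padic)"
      by (simp only: vabs_mult vabs_CARD_power)
    also have "\<dots> \<le> 1 / real ?p ^ k * 1" by (intro mult_left_mono vabs_of_nat_le_1) simp
    finally show ?thesis by simp
  qed
  have far: "vabs (s l - s k) \<le> 1 / real ?p ^ k" if "k \<le> l" for k l
    using that
  proof (induction l rule: dec_induct)
    case (step l)
    have "1 / real ?p ^ l \<le> 1 / real ?p ^ k"
      using step(1) p1 by (intro divide_left_mono power_increasing) auto
    with incr[of l] have "vabs (s (Suc l) - s l) \<le> 1 / real ?p ^ k" by (rule order_trans)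
    from vabs_ultrametric_diff[OF this step.IH] show ?case .
  qed (use p1 in simp)
  have "Cauchy s"
    unfolding Cauchy_altdef2
  proof (intro allI impI)
    fix e :: real assume "0 < e"
    then obtain k where "(1 / real ?p) ^ k < e" using real_arch_pow_inv[of e "1 / real ?p"] p1 by auto
    thus "\<exists>N. \<forall>n\<ge>N. dist (s n) (s N) < e"
      using far by (intro exI[of _ k]) (auto simp: dist_vabs power_one_over intro: le_less_trans)
  qed
  then obtain z where z: "s \<longlonglongrightarrow> z" using Cauchy_convergent convergent_def by blast
  have "vabs (z - s k) \<le> 1 / real ?p ^ k" for k
  proof (rule LIMSEQ_le_const2)
    show "(\<lambda>l. vabs (s l - s k)) \<longlonglongrightarrow> vabs (z - s k)"
      by (intro tendsto_vabs tendsto_minus_vabs z tendsto_const)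
    show "\<exists>N. \<forall>n\<ge>N. vabs (s n - s k) \<le> 1 / real ?p ^ k" using far by blast
  qed
  thus ?thesis unfolding s_def a_def by blast
qed

section \<open>Haar measure on the \<open>p\<close>-adic numbers\<close>

definition reflect_digits :: "real \<Rightarrow> 'p :: prime_card padic" where
  "reflect_digits x = (SOME z. \<forall>k. vabs (z - of_nat CARD('p) ^ k * coset_rep (nat \<lfloor>x * real CARD('p) ^ k\<rfloor>))
    \<le> 1 / real CARD('p) ^ k)"

lemma reflect_digits:
  assumes "0 \<le> x"
  shows "vabs (reflect_digits x - of_nat CARD('p) ^ k * coset_rep (nat \<lfloor>x * real CARD('p) ^ k\<rfloor>) :: 'p :: prime_card padic)
    \<le> 1 / real CARD('p) ^ k"
proof -
  have "\<forall>k. vabs (reflect_digits x - of_nat CARD('p) ^ k * coset_rep (nat \<lfloor>x * real CARD('p) ^ k\<rfloor>) :: 'p padic)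
    \<le> 1 / real CARD('p) ^ k"
    unfolding reflect_digits_def by (rule someI_ex, rule reflect_digits_exists, rule assms)
  thus ?thesis ..
qed

lemma reflect_digits_in_coset_iff:
  assumes "0 \<le> x"
  shows "vabs (reflect_digits x - of_nat CARD('p) ^ k * coset_rep N :: 'p :: prime_card padic) \<le> 1 / real CARD('p) ^ k
    \<longleftrightarrow> real N \<le> x * real CARD('p) ^ k \<and> x * real CARD('p) ^ k < real N + 1"
proof -
  let ?p = "real CARD('p)"
  let ?N = "nat \<lfloor>x * ?p ^ k\<rfloor>"
  have 1: "vabs (reflect_digits x - of_nat CARD('p) ^ k * coset_rep ?N :: 'p padic) \<le> 1 / ?p ^ k"
    by (rule reflect_digits[OF assms])
  have "vabs (reflect_digits x - of_nat CARD('p) ^ k * coset_rep N :: 'p padic) \<le> 1 / ?p ^ k \<longleftrightarrow> ?N = N"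
  proof
    assume 2: "vabs (reflect_digits x - of_nat CARD('p) ^ k * coset_rep N :: 'p padic) \<le> 1 / ?p ^ k"
    have "vabs (of_nat CARD('p) ^ k * coset_rep ?N - of_nat CARD('p) ^ k * coset_rep N :: 'p padic) \<le> 1 / ?p ^ k"
      by (rule vabs_ultrametric_diff[OF _ 2]) (subst vabs_minus_commute, rule 1)
    thus "?N = N" by (rule coset_rep_scaled_inj)
  qed (use 1 in auto)
  also have "\<dots> \<longleftrightarrow> real N \<le> x * ?p ^ k \<and> x * ?p ^ k < real N + 1"
  proof -
    have "0 \<le> x * ?p ^ k" using assms by simp
    thus ?thesis by linarith
  qed
  finally show ?thesis .
qed

definition padic_box :: "'p :: prime_card padic ^ 'n :: finite \<Rightarrow> nat \<Rightarrow> ('p padic ^ 'n) set" where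
  "padic_box a k = {z. \<forall>j. vabs (z $ j - a $ j) \<le> 1 / real CARD('p) ^ k}"

lemma padic_box_borel [measurable]: "padic_box a k \<in> sets borel"
  unfolding padic_box_def by measurable

lemma padic_box_self: "a \<in> padic_box a k"
  by (simp add: padic_box_def)

lemma padic_box_mono: "k \<le> l \<Longrightarrow> padic_box a l \<subseteq> padic_box (a :: 'p :: prime_card padic ^ 'n :: finite) k"
proof -
  assume "k \<le> l"
  hence "1 / real CARD('p) ^ l \<le> 1 / real CARD('p) ^ k"
    using CARD_real_gt_1[where 'p = 'p] by (intro divide_left_mono power_increasing) auto
  thus ?thesis unfolding padic_box_def by (auto intro: order_trans)
qed

lemma padic_box_eq:
  assumes "b \<in> padic_box a k"
  shows "padic_box b k = padic_box a k"
proof -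
  have b: "vabs (b $ j - a $ j) \<le> 1 / real CARD('a) ^ k" for j using assms by (simp add: padic_box_def)
  hence b': "vabs (a $ j - b $ j) \<le> 1 / real CARD('a) ^ k" for j by (subst vabs_minus_commute)
  show ?thesis
    unfolding padic_box_def using vabs_ultrametric_diff[OF _ b] vabs_ultrametric_diff[OF _ b'] by blast
qed

definition coset_vec :: "nat \<Rightarrow> nat ^ 'n \<Rightarrow> 'p :: prime_card padic ^ 'n :: finite" where
  "coset_vec k N = (\<chi> j. of_nat CARD('p) ^ k * coset_rep (N $ j))"

lemma padic_box_coset:
  fixes a :: "'p :: prime_card padic ^ 'n :: finite"
  obtains N where "padic_box a k = padic_box (coset_vec k N) k"
proof -
  have "\<exists>N. vabs (a $ j - of_nat CARD('p) ^ k * coset_rep N) \<le> 1 / real CARD('p) ^ k" for j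
    by (rule coset_rep_scaled_surj[of "a $ j" k]) blast
  then obtain N where "\<And>j. vabs (a $ j - of_nat CARD('p) ^ k * coset_rep (N j)) \<le> 1 / real CARD('p) ^ k"
    by metis
  hence "a \<in> padic_box (coset_vec k (\<chi> j. N j)) k" by (simp add: padic_box_def coset_vec_def)
  from padic_box_eq[OF this] show ?thesis by (rule that)
qed

definition padic_boxes :: "('p :: prime_card padic ^ 'n :: finite) set set" where
  "padic_boxes = range (\<lambda>(a, k). padic_box a k)"

lemma countable_padic_boxes: "countable (padic_boxes :: ('p :: prime_card padic ^ 'n :: finite) set set)"
proof (rule countable_subset)
  show "padic_boxes \<subseteq> range (\<lambda>(k, N). padic_box (coset_vec k N :: 'p padic ^ 'n) k)"
  proof
    fix S :: "('p padic ^ 'n) set" assume "S \<in> padic_boxes"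
    then obtain a k where S: "S = padic_box a k" by (auto simp: padic_boxes_def)
    obtain N where "padic_box a k = padic_box (coset_vec k N) k" by (rule padic_box_coset)
    thus "S \<in> range (\<lambda>(k, N). padic_box (coset_vec k N :: 'p padic ^ 'n) k)" unfolding S by force
  qed
qed simp

lemma padic_box_in_open:
  fixes x :: "'p :: prime_card padic ^ 'n :: finite"
  assumes "open S" "x \<in> S"
  obtains k where "padic_box x k \<subseteq> S"
proof -
  obtain e where e: "0 < e" "ball x e \<subseteq> S" using assms open_contains_ball by blast
  have "0 < e / real CARD('n)" using e by simp
  then obtain k where k: "(1 / real CARD('p)) ^ k < e / real CARD('n)"
    using real_arch_pow_inv[of "e / real CARD('n)" "1 / real CARD('p)"] CARD_real_gt_1[where 'p = 'p] by auto
  have "padic_box x k \<subseteq> ball x e"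
  proof
    fix z assume "z \<in> padic_box x k"
    hence "dist z x \<le> real CARD('n) * (1 / real CARD('p) ^ k)"
      by (intro dist_le_coords) (simp add: padic_box_def)
    also have "\<dots> < real CARD('n) * (e / real CARD('n))"
      using k by (intro mult_strict_left_mono) (simp_all add: power_one_over)
    also have "\<dots> = e" by simp
    finally show "z \<in> ball x e" by (simp add: dist_commute)
  qed
  with e(2) show ?thesis by (intro that) blast
qed

lemma sets_borel_padic: "sets (borel :: ('p :: prime_card padic ^ 'n :: finite) measure) = sigma_sets UNIV padic_boxes"
proof
  show "sets (borel :: ('p padic ^ 'n) measure) \<subseteq> sigma_sets UNIV padic_boxes"
    unfolding borel_def sets_measure_of[OF subset_UNIV[of "Collect open", folded Pow_UNIV]]
  proof (rule sigma_sets_mono, safe)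
    fix S :: "('p padic ^ 'n) set" assume S: "open S"
    have "S = \<Union>{B \<in> padic_boxes. B \<subseteq> S}"
    proof
      show "S \<subseteq> \<Union>{B \<in> padic_boxes. B \<subseteq> S}"
      proof
        fix x assume "x \<in> S"
        then obtain k where "padic_box x k \<subseteq> S" using padic_box_in_open[OF S] by blast
        moreover have "padic_box x k \<in> padic_boxes" by (auto simp: padic_boxes_def)
        ultimately show "x \<in> \<Union>{B \<in> padic_boxes. B \<subseteq> S}" using padic_box_self by blast
      qed
    qed blast
    moreover have "\<Union>{B \<in> padic_boxes. B \<subseteq> S} \<in> sigma_sets UNIV padic_boxes"
      by (rule sigma_sets_UNION) (auto intro: countable_subset[OF _ countable_padic_boxes])
    ultimately show "S \<in> sigma_sets UNIV padic_boxes" by simp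
  qed
  show "sigma_sets UNIV padic_boxes \<subseteq> sets (borel :: ('p padic ^ 'n) measure)"
  proof -
    have "padic_boxes \<subseteq> sets (borel :: ('p padic ^ 'n) measure)" by (auto simp: padic_boxes_def)
    from sets.sigma_sets_subset[OF this] show ?thesis by simp
  qed
qed

lemma padic_measure_eqI:
  fixes \<mu> \<nu> :: "('p :: prime_card padic ^ 'n :: finite) measure"
  assumes sets: "sets \<mu> = sets borel" "sets \<nu> = sets borel"
    and eq: "\<And>a k. emeasure \<mu> (padic_box a k) = emeasure \<nu> (padic_box a k)"
    and fin: "\<And>a. emeasure \<mu> (padic_box a 0) \<noteq> \<infinity>"
  shows "\<mu> = \<nu>"
proof (rule measure_eqI_generator_eq[where E = "insert {} padic_boxes" and \<Omega> = UNIV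
      and A = "\<lambda>i. padic_box (coset_vec 0 (from_nat i)) 0"])
  show "Int_stable (insert {} padic_boxes :: ('p padic ^ 'n) set set)"
    unfolding Int_stable_def
  proof (intro ballI)
    fix S T :: "('p padic ^ 'n) set" assume ST: "S \<in> insert {} padic_boxes" "T \<in> insert {} padic_boxes"
    show "S \<inter> T \<in> insert {} padic_boxes"
    proof (cases "S \<inter> T = {}")
      case False
      then obtain z where z: "z \<in> S" "z \<in> T" by blast
      then obtain a k b l where ab: "S = padic_box a k" "T = padic_box b l"
        using ST by (auto simp: padic_boxes_def)
      have "S = padic_box z k" "T = padic_box z l" using z ab padic_box_eq by blast+
      hence "S \<inter> T = padic_box z (max k l)"
        using padic_box_mono[of k l z] padic_box_mono[of l k z] by (cases "k \<le> l") (auto simp: max_def)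
      thus ?thesis by (auto simp: padic_boxes_def)
    qed simp
  qed
  show "sets \<mu> = sigma_sets UNIV (insert {} padic_boxes)" "sets \<nu> = sigma_sets UNIV (insert {} padic_boxes)"
  proof -
    have "sigma_sets UNIV (insert {} padic_boxes) = sigma_sets UNIV (padic_boxes :: ('p padic ^ 'n) set set)"
      by (rule sigma_sets_eqI) (auto intro: sigma_sets.Empty)
    thus "sets \<mu> = sigma_sets UNIV (insert {} padic_boxes)" "sets \<nu> = sigma_sets UNIV (insert {} padic_boxes)"
      using sets sets_borel_padic by simp_all
  qed
  show "(\<Union>i. padic_box (coset_vec 0 (from_nat i)) 0) = (UNIV :: ('p padic ^ 'n) set)"
  proof safe
    fix x :: "'p padic ^ 'n"
    obtain N where N: "padic_box x 0 = padic_box (coset_vec 0 N) 0" by (rule padic_box_coset)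
    show "x \<in> (\<Union>i. padic_box (coset_vec 0 (from_nat i)) 0)"
      using padic_box_self[of x 0] unfolding N by (intro UN_I[of "to_nat N"]) auto
  qed simp
qed (use eq fin in \<open>auto simp: padic_boxes_def\<close>)

lemma emeasure_lborel_half_open_cube:
  fixes l :: "real ^ 'n :: finite"
  assumes "0 < h"
  shows "emeasure lborel {x. \<forall>j. l $ j \<le> x $ j \<and> x $ j < l $ j + h} = ennreal (h ^ CARD('n))"
proof -
  let ?S = "{x. \<forall>j. l $ j \<le> x $ j \<and> x $ j < l $ j + h}" and ?u = "l + (\<chi> j. h)"
  have ip: "((\<chi> j. h) :: real ^ 'n) \<bullet> b = h" if "b \<in> Basis" for b
    using that by (auto simp: Basis_vec_def inner_axis)
  have prod: "(\<Prod>b\<in>Basis. (?u - l) \<bullet> b) = h ^ CARD('n)"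
    by (simp add: ip)
  have le: "l \<bullet> b \<le> ?u \<bullet> b" if "b \<in> Basis" for b using ip[OF that] assms by (simp add: inner_add_left)
  have S: "?S \<in> sets lborel" by measurable
  have lo: "emeasure lborel (box l ?u) \<le> emeasure lborel ?S"
    by (rule emeasure_mono) (use S in \<open>auto simp: mem_box_cart less_imp_le\<close>)
  have hi: "emeasure lborel ?S \<le> emeasure lborel (cbox l ?u)"
    by (rule emeasure_mono) (auto simp: mem_box_cart less_imp_le)
  have box: "emeasure lborel (box l ?u) = ennreal (h ^ CARD('n))"
    using emeasure_lborel_box[of l ?u] le prod by simp
  have cbox: "emeasure lborel (cbox l ?u) = ennreal (h ^ CARD('n))"
    using emeasure_lborel_cbox[of l ?u] le prod by simp
  show ?thesis by (rule antisym[OF hi[unfolded cbox] lo[unfolded box]])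
qed

definition reflected_lebesgue :: "('p :: prime_card padic ^ 'n :: finite) measure" where
  "reflected_lebesgue = distr (restrict_space lborel {x :: real ^ 'n. \<forall>j. 0 \<le> x $ j}) borel (\<lambda>x. \<chi> j. reflect_digits (x $ j))"

lemma reflected_lebesgue_box:
  fixes a :: "'p :: prime_card padic ^ 'n :: finite"
  shows "emeasure reflected_lebesgue (padic_box a k) = ennreal ((1 / real CARD('p) ^ k) ^ CARD('n))"
proof -
  let ?\<Omega> = "{x :: real ^ 'n. \<forall>j. 0 \<le> x $ j}"
  let ?M = "restrict_space lborel ?\<Omega>"
  let ?f = "\<lambda>x :: real ^ 'n. (\<chi> j. reflect_digits (x $ j)) :: 'p padic ^ 'n"
  have \<Omega>: "?\<Omega> \<in> sets lborel" by measurable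
  have pre: "\<exists>l. ?f -` padic_box b m \<inter> space ?M = {x. \<forall>j. l $ j \<le> x $ j \<and> x $ j < l $ j + 1 / real CARD('p) ^ m}" for b m
  proof -
    let ?P = "real CARD('p) ^ m"
    have P: "0 < ?P" by simp
    obtain N where N: "padic_box b m = padic_box (coset_vec m N) m" by (rule padic_box_coset)
    let ?l = "(\<chi> j. real (N $ j) / ?P) :: real ^ 'n"
    have iff: "?l $ j \<le> x \<and> x < ?l $ j + 1 / ?P \<longleftrightarrow> real (N $ j) \<le> x * ?P \<and> x * ?P < real (N $ j) + 1" for j x
      by (simp add: pos_divide_le_eq[OF P] pos_less_divide_eq[OF P] flip: add_divide_distrib)
    have "?f -` padic_box b m \<inter> space ?M = {x. \<forall>j. ?l $ j \<le> x $ j \<and> x $ j < ?l $ j + 1 / ?P}"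
    proof (intro Set.set_eqI iffI)
      fix x assume "x \<in> ?f -` padic_box b m \<inter> space ?M"
      hence x: "0 \<le> x $ j" "vabs (reflect_digits (x $ j) - of_nat CARD('p) ^ m * coset_rep (N $ j) :: 'p padic) \<le> 1 / ?P" for j
        unfolding N by (auto simp: space_restrict_space padic_box_def coset_vec_def)
      show "x \<in> {x. \<forall>j. ?l $ j \<le> x $ j \<and> x $ j < ?l $ j + 1 / ?P}"
        using x(2)[unfolded reflect_digits_in_coset_iff[OF x(1)]] unfolding mem_Collect_eq iff by blast
    next
      fix x assume x: "x \<in> {x. \<forall>j. ?l $ j \<le> x $ j \<and> x $ j < ?l $ j + 1 / ?P}"
      have x0: "0 \<le> x $ j" for j using x by (auto intro: order_trans[of _ "real (N $ j) / ?P"])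
      have "real (N $ j) \<le> x $ j * ?P \<and> x $ j * ?P < real (N $ j) + 1" for j
        using x unfolding mem_Collect_eq iff by blast
      hence "vabs (reflect_digits (x $ j) - of_nat CARD('p) ^ m * coset_rep (N $ j) :: 'p padic) \<le> 1 / ?P" for j
        unfolding reflect_digits_in_coset_iff[OF x0] by blast
      thus "x \<in> ?f -` padic_box b m \<inter> space ?M"
        unfolding N using x0 by (simp add: space_restrict_space padic_box_def coset_vec_def)
    qed
    thus ?thesis by blast
  qed
  have "?f \<in> measurable ?M borel"
  proof (rule measurable_sigma_sets[OF sets_borel_padic])
    fix S :: "('p padic ^ 'n) set" assume "S \<in> padic_boxes"
    then obtain b m where S: "S = padic_box b m" by (auto simp: padic_boxes_def)
    obtain l where l: "?f -` S \<inter> space ?M = {x. \<forall>j. l $ j \<le> x $ j \<and> x $ j < l $ j + 1 / real CARD('p) ^ m}"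
      using pre unfolding S by blast
    have "{x :: real ^ 'n. \<forall>j. l $ j \<le> x $ j \<and> x $ j < l $ j + 1 / real CARD('p) ^ m} \<in> sets lborel" by measurable
    moreover have "?f -` S \<inter> space ?M \<subseteq> ?\<Omega>" by (auto simp: space_restrict_space)
    ultimately show "?f -` S \<inter> space ?M \<in> sets ?M"
      using \<Omega> unfolding l by (subst sets_restrict_space_iff) auto
  qed auto
  hence "emeasure reflected_lebesgue (padic_box a k) = emeasure ?M (?f -` padic_box a k \<inter> space ?M)"
    unfolding reflected_lebesgue_def by (rule emeasure_distr) simp
  also have "\<dots> = emeasure lborel (?f -` padic_box a k \<inter> space ?M)"
    by (rule emeasure_restrict_space) (use \<Omega> in \<open>auto simp: space_restrict_space\<close>)
  also obtain l where "?f -` padic_box a k \<inter> space ?M = {x. \<forall>j. l $ j \<le> x $ j \<and> x $ j < l $ j + 1 / real CARD('p) ^ k}"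
    using pre by blast
  also have "emeasure lborel \<dots> = ennreal ((1 / real CARD('p) ^ k) ^ CARD('n))"
    by (rule emeasure_lborel_half_open_cube) simp
  finally show ?thesis .
qed

lemma padic_box_translate: "(\<lambda>x. a + x) ` padic_box b k = padic_box (a + b) k"
proof (intro Set.set_eqI iffI)
  fix z assume "z \<in> padic_box (a + b) k"
  hence "z - a \<in> padic_box b k" by (simp add: padic_box_def diff_diff_add)
  moreover have "z = a + (z - a)" by simp
  ultimately show "z \<in> (\<lambda>x. a + x) ` padic_box b k" by blast
qed (auto simp: padic_box_def)

lemma is_haar_reflected_lebesgue: "is_haar_measure (reflected_lebesgue :: ('p :: prime_card padic ^ 'n :: finite) measure)"
  unfolding is_haar_measure_def
proof (intro conjI allI ballI)
  let ?\<beta> = "reflected_lebesgue :: ('p padic ^ 'n) measure"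
  show sets: "sets ?\<beta> = sets borel" by (simp add: reflected_lebesgue_def)
  have "{x. \<forall>i. vabs (x $ i) \<le> 1} = padic_box (0 :: 'p padic ^ 'n) 0" by (simp add: padic_box_def)
  thus "emeasure ?\<beta> {x. \<forall>i. vabs (x $ i) \<le> 1} = 1" by (simp add: reflected_lebesgue_box)
  fix a and A :: "('p padic ^ 'n) set" assume A: "A \<in> sets borel"
  let ?t = "\<lambda>x :: 'p padic ^ 'n. \<chi> j. x $ j - a $ j"
  have t: "?t \<in> measurable ?\<beta> borel"
    unfolding measurable_cong_sets[OF sets refl]
    by (intro borel_measurable_continuous_onI continuous_on_vec_lambda continuous_on_vabs(2)
        continuous_on_component continuous_on_const continuous_on_id)
  have pre: "?t -` S \<inter> space ?\<beta> = (\<lambda>x. a + x) ` S" for S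
  proof (intro Set.set_eqI iffI)
    fix x assume "x \<in> ?t -` S \<inter> space ?\<beta>"
    moreover have "x = a + ?t x" by (simp add: vec_eq_iff)
    ultimately show "x \<in> (\<lambda>x. a + x) ` S" by blast
  next
    fix x assume "x \<in> (\<lambda>x. a + x) ` S"
    then obtain z where z: "z \<in> S" "x = a + z" by blast
    hence "?t x = z" by (simp add: vec_eq_iff)
    thus "x \<in> ?t -` S \<inter> space ?\<beta>" using z sets_eq_imp_space_eq[OF sets] by simp
  qed
  have "?\<beta> = distr ?\<beta> borel ?t"
    by (rule padic_measure_eqI)
      (simp_all add: sets emeasure_distr[OF t] pre padic_box_translate reflected_lebesgue_box)
  hence "emeasure ?\<beta> A = emeasure (distr ?\<beta> borel ?t) A" by simp
  also have "\<dots> = emeasure ?\<beta> ((\<lambda>x. a + x) ` A)" unfolding emeasure_distr[OF t A] pre ..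
  finally show "emeasure ?\<beta> ((\<lambda>x. a + x) ` A) = emeasure ?\<beta> A" ..
qed

lemma is_haar_measure_box:
  fixes \<beta> :: "('p :: prime_card padic ^ 'n :: finite) measure"
  assumes "is_haar_measure \<beta>"
  shows "emeasure \<beta> (padic_box a k) = ennreal ((1 / real CARD('p) ^ k) ^ CARD('n))"
proof -
  have sets: "sets \<beta> = sets borel"
    and transl: "\<And>a A. A \<in> sets borel \<Longrightarrow> emeasure \<beta> ((\<lambda>x. a + x) ` A) = emeasure \<beta> A"
    and one: "emeasure \<beta> {x. \<forall>i. vabs (x $ i) \<le> 1} = 1"
    using assms by (auto simp: is_haar_measure_def)
  have box: "emeasure \<beta> (padic_box c k) = emeasure \<beta> (padic_box 0 k)" for c
    using transl[OF padic_box_borel, of c 0 k] by (simp add: padic_box_translate)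
  let ?p = "CARD('p)"
  let ?F = "\<Pi>\<^sub>E j\<in>(UNIV :: 'n set). {..<?p ^ k}"
  let ?v = "\<lambda>f. (\<chi> j. of_nat (f j)) :: 'p padic ^ 'n"
  have F: "finite ?F" "card ?F = (?p ^ k) ^ CARD('n)" by (auto intro: finite_PiE simp: card_PiE)
  have p1: "1 / real ?p ^ k \<le> 1" using CARD_real_gt_1[where 'p = 'p] by simp
  have "{x. \<forall>i. vabs (x $ i) \<le> 1} = (\<Union>f\<in>?F. padic_box (?v f) k)"
  proof (intro Set.set_eqI iffI)
    fix x :: "'p padic ^ 'n" assume "x \<in> {x. \<forall>i. vabs (x $ i) \<le> 1}"
    hence "\<exists>N<?p ^ k. vabs (x $ j - of_nat N) \<le> 1 / real ?p ^ k" for j using padic_residue by blast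
    then obtain f where "\<And>j. f j < ?p ^ k" "\<And>j. vabs (x $ j - of_nat (f j)) \<le> 1 / real ?p ^ k" by metis
    thus "x \<in> (\<Union>f\<in>?F. padic_box (?v f) k)" by (intro UN_I[of f]) (auto simp: padic_box_def)
  next
    fix x assume "x \<in> (\<Union>f\<in>?F. padic_box (?v f) k)"
    then obtain f where "\<And>j. vabs (x $ j - of_nat (f j)) \<le> 1 / real ?p ^ k" by (auto simp: padic_box_def)
    hence "vabs (x $ j - of_nat (f j)) \<le> 1" for j using p1 order_trans by blast
    hence "vabs (x $ j - of_nat (f j) + of_nat (f j)) \<le> 1" for j
      by (rule vabs_ultrametric_le(1)) (rule vabs_of_nat_le_1)
    thus "x \<in> {x. \<forall>i. vabs (x $ i) \<le> 1}" by simp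
  qed
  hence "1 = emeasure \<beta> (\<Union>f\<in>?F. padic_box (?v f) k)" using one by simp
  also have "\<dots> = (\<Sum>f\<in>?F. emeasure \<beta> (padic_box (?v f) k))"
  proof (rule sum_emeasure[symmetric])
    show "disjoint_family_on (\<lambda>f. padic_box (?v f) k) ?F"
      unfolding disjoint_family_on_def
    proof (intro ballI impI, rule ccontr)
      fix f g assume fg: "f \<in> ?F" "g \<in> ?F" "f \<noteq> g" "padic_box (?v f) k \<inter> padic_box (?v g) k \<noteq> {}"
      then obtain z where z: "z \<in> padic_box (?v f) k" "z \<in> padic_box (?v g) k" by blast
      have "f j = g j" for j
      proof -
        have "vabs (of_nat (f j) - of_nat (g j) :: 'p padic) \<le> 1 / real ?p ^ k"
          using z vabs_ultrametric_diff[of "of_nat (f j)" "z $ j" _ "of_nat (g j)"]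
          by (simp add: padic_box_def vabs_minus_commute[of "of_nat (f j)"])
        thus ?thesis
          by (rule padic_residue_unique) (use PiE_mem[OF fg(1), of j] PiE_mem[OF fg(2), of j] in auto)
      qed
      thus False using fg(3) by blast
    qed
  qed (use F sets in auto)
  also have "\<dots> = of_nat (card ?F) * emeasure \<beta> (padic_box 0 k)" by (subst sum.cong[OF refl box]) (rule sum_constant)
  finally have eq: "of_nat (card ?F) * emeasure \<beta> (padic_box 0 k) = 1" ..
  have P: "0 < (real ?p ^ k) ^ CARD('n)" by simp
  have "emeasure \<beta> (padic_box 0 k) = ennreal (1 / (real ?p ^ k) ^ CARD('n))"
  proof (cases "emeasure \<beta> (padic_box 0 k)")
    case (real r)
    hence "ennreal ((real ?p ^ k) ^ CARD('n) * r) = 1"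
      using eq P unfolding F(2) by (simp add: ennreal_of_nat_eq_real_of_nat ennreal_mult)
    hence "(real ?p ^ k) ^ CARD('n) * r = 1" using real by simp
    hence "r = 1 / (real ?p ^ k) ^ CARD('n)" using P by (simp add: field_simps)
    thus ?thesis using real by simp
  next
    case top
    thus ?thesis using eq unfolding F(2) by (simp add: ennreal_mult_top)
  qed
  thus ?thesis unfolding box[of a] by (simp add: power_one_over)
qed

lemma is_haar_padic_haar: "is_haar_measure (padic_haar :: ('p :: prime_card padic ^ 'n :: finite) measure)"
  unfolding padic_haar_def
proof (rule theI)
  show "is_haar_measure (reflected_lebesgue :: ('p padic ^ 'n) measure)" by (rule is_haar_reflected_lebesgue)
  fix \<beta> :: "('p padic ^ 'n) measure" assume \<beta>: "is_haar_measure \<beta>"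
  show "\<beta> = reflected_lebesgue"
  proof (rule padic_measure_eqI)
    show "sets \<beta> = sets borel" using \<beta> by (simp add: is_haar_measure_def)
    show "sets (reflected_lebesgue :: ('p padic ^ 'n) measure) = sets borel" by (simp add: reflected_lebesgue_def)
  qed (simp_all add: is_haar_measure_box[OF \<beta>] reflected_lebesgue_box)
qed

section \<open>Dirichlet's theorem at a prime\<close>

lemma card_cong_interval_le:
  fixes c h :: int and P :: nat
  assumes "0 < P" "0 \<le> h"
  shows "finite {z. \<bar>z\<bar> \<le> h \<and> int P dvd z - c}"
    and "real (card {z. \<bar>z\<bar> \<le> h \<and> int P dvd z - c}) \<le> 2 * (of_int h / real P) + 1"
proof -
  let ?S = "{z. \<bar>z\<bar> \<le> h \<and> int P dvd z - c}"
  let ?T = "{u :: int. \<bar>of_int u - (- of_int c / real P)\<bar> \<le> of_int h / real P}"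
  have S: "?S \<subseteq> (\<lambda>u. c + int P * u) ` ?T"
  proof
    fix z assume "z \<in> ?S"
    then obtain u where z: "\<bar>z\<bar> \<le> h" "z = c + int P * u" by (auto elim!: dvdE simp: algebra_simps)
    have "of_int u - (- of_int c / real P) = (of_int z :: real) / real P"
      unfolding z(2) using assms by (simp add: field_simps)
    moreover have "\<bar>of_int z :: real\<bar> \<le> of_int h" using z(1) by linarith
    hence "\<bar>(of_int z :: real) / real P\<bar> \<le> of_int h / real P"
      unfolding abs_divide using assms by (simp add: divide_right_mono)
    ultimately have "u \<in> ?T" by (simp only: mem_Collect_eq)
    thus "z \<in> (\<lambda>u. c + int P * u) ` ?T" using z(2) by blast
  qed
  have h: "0 \<le> of_int h / real P" using assms by simp
  have finT: "finite ?T" by (rule card_int_ball_le(1)[OF h])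
  thus "finite ?S" using S finite_subset by blast
  have "card ?S \<le> card ((\<lambda>u. c + int P * u) ` ?T)" by (rule card_mono[OF _ S]) (use finT in simp)
  also have "\<dots> \<le> card ?T" by (rule card_image_le[OF finT])
  finally have "real (card ?S) \<le> real (card ?T)" by (simp only: of_nat_le_iff)
  also have "\<dots> \<le> 2 * (of_int h / real P) + 1" by (rule card_int_ball_le(2)[OF h])
  finally show "real (card ?S) \<le> 2 * (of_int h / real P) + 1" .
qed

lemma sum_geometric_tail_le:
  fixes b :: nat
  assumes "2 \<le> b"
  shows "(\<Sum>j\<in>{k<..M}. 1 / real b ^ j) \<le> 1 / real b ^ k"
proof (cases "k \<le> M")
  case True
  hence "(\<Sum>j\<in>{k<..M}. 1 / real b ^ j) \<le> 1 / real b ^ k - 1 / real b ^ M"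
  proof (induction M rule: dec_induct)
    case (step M)
    have "2 * (1 / real b ^ Suc M) \<le> real b * (1 / real b ^ Suc M)"
      using assms by (intro mult_right_mono) auto
    also have "\<dots> = 1 / real b ^ M" using assms by simp
    finally have "1 / real b ^ Suc M \<le> 1 / real b ^ M - 1 / real b ^ Suc M" by simp
    moreover have "{k<..Suc M} = insert (Suc M) {k<..M}" using step by auto
    ultimately show ?case using step.IH by simp
  qed simp
  moreover have "0 \<le> 1 / real b ^ M" by simp
  ultimately show ?thesis by linarith
qed simp

lemma padic_pigeonhole:
  fixes u :: "'p :: prime_card padic ^ 'n :: finite"
  assumes u: "\<And>j. vabs (u $ j) \<le> 1" and count: "(CARD('p) ^ k) ^ (CARD('n) - 1) < (H + 1) ^ CARD('n)"
  shows "\<exists>z :: 'n \<Rightarrow> int. (\<exists>j. z j \<noteq> 0) \<and> (\<forall>j. \<bar>z j\<bar> \<le> int H) \<and>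
    (\<forall>j. j \<noteq> i \<longrightarrow> vabs (of_int (z j) - u $ j * of_int (z i)) \<le> 1 / real CARD('p) ^ k)"
proof -
  let ?p = "CARD('p)"
  let ?D = "\<Pi>\<^sub>E j\<in>(UNIV :: 'n set). {0..H}"
  let ?E = "\<Pi>\<^sub>E j\<in>(UNIV :: 'n set) - {i}. {..<?p ^ k}"
  have le1: "vabs (of_nat (y j) - u $ j * of_nat (y i)) \<le> 1" for y :: "'n \<Rightarrow> nat" and j
  proof (rule vabs_ultrametric_le(2)[OF vabs_of_nat_le_1])
    have "vabs (u $ j * of_nat (y i)) \<le> 1 * 1"
      unfolding vabs_mult by (intro mult_mono u vabs_of_nat_le_1) simp_all
    thus "vabs (u $ j * of_nat (y i)) \<le> 1" by simp
  qed
  have "\<exists>g. \<forall>y j. g y j < ?p ^ k \<and> vabs (of_nat (y j) - u $ j * of_nat (y i) - of_nat (g y j)) \<le> 1 / real ?p ^ k"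
    using padic_residue[OF le1] by metis
  then obtain g where g: "\<And>y j. g y j < ?p ^ k"
    "\<And>y j. vabs (of_nat (y j) - u $ j * of_nat (y i) - of_nat (g y j)) \<le> 1 / real ?p ^ k" by blast
  let ?G = "\<lambda>y. restrict (g y) (UNIV - {i})"
  have "?G ` ?D \<subseteq> ?E"
  proof (rule image_subsetI)
    fix y show "?G y \<in> ?E" using g(1) by (intro PiE_I) auto
  qed
  moreover have "finite ?E" by (intro finite_PiE) auto
  moreover have "card ?E < card ?D" using count by (simp add: card_PiE)
  ultimately have "\<not> inj_on ?G ?D" using card_inj_on_le[of ?G ?D ?E] by (meson not_le)
  then obtain y y' where y: "y \<in> ?D" "y' \<in> ?D" "y \<noteq> y'" "?G y = ?G y'" by (auto simp: inj_on_def)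
  define z where "z = (\<lambda>j. int (y j) - int (y' j))"
  show ?thesis
  proof (intro exI[of _ z] conjI allI impI)
    show "\<exists>j. z j \<noteq> 0" using y(3) by (auto simp: z_def fun_eq_iff)
    show "\<bar>z j\<bar> \<le> int H" for j
    proof -
      have "y j \<le> H" "y' j \<le> H" using PiE_mem[OF y(1), of j] PiE_mem[OF y(2), of j] by auto
      thus ?thesis by (simp add: z_def abs_le_iff)
    qed
    fix j assume "j \<noteq> i"
    hence gy: "g y j = g y' j" using fun_cong[OF y(4), of j] by simp
    have "of_int (z j) - u $ j * of_int (z i)
      = (of_nat (y j) - u $ j * of_nat (y i) - of_nat (g y j)) - (of_nat (y' j) - u $ j * of_nat (y' i) - of_nat (g y' j))"
      unfolding gy by (simp add: z_def algebra_simps)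
    also have "vabs \<dots> \<le> 1 / real ?p ^ k" by (intro vabs_ultrametric_le(2) g(2))
    finally show "vabs (of_int (z j) - u $ j * of_int (z i)) \<le> 1 / real ?p ^ k" .
  qed
qed

lemma padic_dirichlet_point:
  fixes u :: "'p :: prime_card padic ^ 'n :: finite" and t :: nat
  assumes n: "2 \<le> CARD('n)" and u: "u \<in> chart_cube i" and t: "0 < t"
  defines "m \<equiv> CARD('n) - 1"
  obtains a and w :: "'n \<Rightarrow> int" where "a \<le> m * t" "\<And>j. \<bar>w j\<bar> \<le> int (CARD('p) ^ (m * t - a))"
    "\<not> int CARD('p) dvd w i" "\<And>j. vabs (of_int (w j) - u $ j * of_int (w i)) \<le> real CARD('p) ^ a / real CARD('p) ^ (Suc m * t)"
proof -
  let ?p = "CARD('p)" and ?k = "Suc m * t" and ?H = "CARD('p) ^ (m * t)"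
  have p2: "2 \<le> ?p" by (rule CARD_ge_2)
  have p1: "1 < real ?p" by (rule CARD_real_gt_1)
  have nm: "CARD('n) = Suc m" using n by (simp add: m_def)
  have u1: "vabs (u $ j) \<le> 1" for j using u by (simp add: chart_cube_def)
  have "(?p ^ ?k) ^ m = ?H ^ Suc m" by (simp only: power_mult[symmetric] mult.commute mult.left_commute)
  also have "\<dots> < (?H + 1) ^ Suc m" by (intro power_strict_mono) auto
  finally have count: "(?p ^ ?k) ^ (CARD('n) - 1) < (?H + 1) ^ CARD('n)" unfolding nm diff_Suc_1 .
  obtain z :: "'n \<Rightarrow> int" where z: "\<exists>j. z j \<noteq> 0" "\<And>j. \<bar>z j\<bar> \<le> int ?H"
    and z': "\<And>j. j \<noteq> i \<Longrightarrow> vabs (of_int (z j) - u $ j * of_int (z i)) \<le> 1 / real ?p ^ ?k"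
    using padic_pigeonhole[OF u1 count] by blast
  have approx: "vabs (of_int (z j) - u $ j * of_int (z i)) \<le> 1 / real ?p ^ ?k" for j
    using z'[of j] u by (cases "j = i") (simp_all add: chart_cube_def)
  have zi: "z i \<noteq> 0"
  proof
    assume zi: "z i = 0"
    obtain j where j: "z j \<noteq> 0" using z(1) by blast
    have "vabs (of_int (z j) :: 'p padic) \<le> 1 / real ?p ^ ?k" using approx[of j] zi by simp
    hence dvd: "int ?p ^ ?k dvd z j" by (simp only: vabs_of_int_le_iff)
    have "int ?p ^ ?k \<le> \<bar>z j\<bar>" using dvd_imp_le_int[OF j dvd] by simp
    also have "\<dots> \<le> int ?p ^ (m * t)" using z(2)[of j] by simp
    also have "\<dots> < int ?p ^ ?k" using t p2 by (intro power_strict_increasing) auto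
    finally show False by simp
  qed
  define a where "a = multiplicity (int ?p) (z i)"
  have u: "\<not> is_unit (int ?p)" using p2 by (simp add: zdvd1_eq)
  have ai: "int ?p ^ a dvd z i" unfolding a_def by (rule multiplicity_dvd)
  have "int ?p ^ a \<le> \<bar>z i\<bar>" using dvd_imp_le_int[OF zi ai] by simp
  also have "\<dots> \<le> int ?p ^ (m * t)" using z(2)[of i] by simp
  finally have am: "a \<le> m * t" using p2 by (subst (asm) power_increasing_iff) auto
  have ak: "1 / real ?p ^ ?k \<le> 1 / real ?p ^ a"
    using am p1 by (intro divide_left_mono power_increasing) auto
  have div: "int ?p ^ a dvd z j" for j
  proof -
    have "vabs (of_int (z i) :: 'p padic) \<le> 1 / real ?p ^ a" using ai by (simp only: vabs_of_int_le_iff)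
    hence "vabs (u $ j * of_int (z i)) \<le> 1 * (1 / real ?p ^ a)"
      unfolding vabs_mult by (intro mult_mono u1) simp_all
    hence "vabs ((of_int (z j) - u $ j * of_int (z i)) + u $ j * of_int (z i)) \<le> 1 / real ?p ^ a"
      using approx[of j] ak by (intro vabs_ultrametric_le(1)) auto
    thus ?thesis by (simp add: vabs_of_int_le_iff)
  qed
  define w where "w = (\<lambda>j. z j div int ?p ^ a)"
  have zw: "z j = int ?p ^ a * w j" for j using div[of j] by (simp add: w_def)
  show ?thesis
  proof (rule that[OF am])
    show "\<bar>w j\<bar> \<le> int (?p ^ (m * t - a))" for j
    proof -
      have "int ?p ^ a * \<bar>w j\<bar> \<le> int ?p ^ (m * t)" using z(2)[of j] unfolding zw by (simp add: abs_mult)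
      also have "\<dots> = int ?p ^ a * int ?p ^ (m * t - a)" using am by (simp flip: power_add)
      finally show ?thesis using p2 by simp
    qed
    show "\<not> int ?p dvd w i"
    proof
      assume "int ?p dvd w i"
      hence "int ?p ^ Suc a dvd z i" unfolding zw[of i] by (simp add: mult.commute)
      hence "Suc a \<le> a" unfolding a_def using power_dvd_iff_le_multiplicity[OF zi u] by blast
      thus False by simp
    qed
    show "vabs (of_int (w j) - u $ j * of_int (w i)) \<le> real ?p ^ a / real ?p ^ ?k" for j
    proof -
      have "of_int (z j) - u $ j * of_int (z i) = of_nat ?p ^ a * (of_int (w j) - u $ j * of_int (w i))"
        unfolding zw[of j] zw[of i] by (simp add: algebra_simps)
      hence "1 / real ?p ^ a * vabs (of_int (w j) - u $ j * of_int (w i)) \<le> 1 / real ?p ^ ?k"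
        using approx[of j] by (simp only: vabs_mult vabs_CARD_power)
      hence "real ?p ^ a * (1 / real ?p ^ a * vabs (of_int (w j) - u $ j * of_int (w i))) \<le> real ?p ^ a * (1 / real ?p ^ ?k)"
        by (rule mult_left_mono) simp
      thus ?thesis by simp
    qed
  qed
qed

lemma padic_dirichlet:
  fixes i :: "'n :: finite" and e :: real
  assumes n: "2 \<le> CARD('n)" and e: "0 < e"
  shows "\<exists>A>0. \<forall>x\<in>chart_cube i :: ('p :: prime_card padic ^ 'n) set. \<forall>r. 0 < r \<longrightarrow> r \<le> 1 \<longrightarrow>
      (\<forall>\<^sub>F t in sequentially. \<exists>B. finite B \<and> (\<forall>(y, s)\<in>B. y \<in> chart_cube i \<and> 0 < s) \<and>
        (\<Sum>(y, s)\<in>B. s ^ (CARD('n) - 1)) \<le> e * r ^ (CARD('n) - 1) \<and>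
        cball x r \<inter> chart_cube i \<subseteq>
          (\<Union>y\<in>rational_points i (CARD('p) ^ ((CARD('n) - 1) * t)). cball y (A * (1 / real CARD('p) ^ CARD('n)) ^ t)) \<union>
          (\<Union>(y, s)\<in>B. cball y s))"
proof -
  let ?p = "CARD('p)"
  define m where "m = CARD('n) - 1"
  have m: "0 < m" "CARD('n) = Suc m" using n by (auto simp: m_def)
  let ?n = "real CARD('n)"
  have p2: "2 \<le> ?p" by (rule CARD_ge_2)
  have p1: "1 < real ?p" by (rule CARD_real_gt_1)
  define K where "K = 3 * (4 * ?n * real ?p) ^ m"
  have K: "0 < K" using p1 by (simp add: K_def)
  obtain j0 where j0: "(1 / real ?p) ^ j0 < e / 2 / K"
    using real_arch_pow_inv[of "e / 2 / K" "1 / real ?p"] e K p1 by auto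
  have main: "\<forall>\<^sub>F t in sequentially. \<exists>B. finite B \<and> (\<forall>(y, s)\<in>B. y \<in> chart_cube i \<and> 0 < s) \<and>
        (\<Sum>(y, s)\<in>B. s ^ m) \<le> e * r ^ m \<and>
        cball x r \<inter> chart_cube i \<subseteq>
          (\<Union>y\<in>rational_points i (?p ^ (m * t)). cball y (?n * real ?p ^ j0 * (1 / real ?p ^ Suc m) ^ t)) \<union>
          (\<Union>(y, s)\<in>B. cball y s)" if x: "x \<in> chart_cube i" and r: "0 < r" "r \<le> 1" for x :: "'p padic ^ 'n" and r
  proof -
    obtain l where l: "r \<le> 1 / real ?p ^ l" "1 / real ?p ^ Suc l \<le> r"
    proof (cases "r = 1")
      case True
      thus ?thesis using that[of 0] p1 by simp
    next
      case False
      then obtain k where "1 / real ?p ^ Suc k \<le> r" "r < 1 / real ?p ^ k"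
        using exists_scale[OF p2, of r] r by auto
      thus ?thesis using that[of k] by simp
    qed
    have "0 < e * r ^ m / (2 * (3 * (2 * ?n) ^ m))" using e r by simp
    hence ev: "\<forall>\<^sub>F t in sequentially. (real (m * t) + 1) / real ?p ^ (m * t) < e * r ^ m / (2 * (3 * (2 * ?n) ^ m))"
      by (rule order_tendstoD(2)[OF linear_over_power_tendsto_0[OF p2 m(1)]])
    from ev eventually_ge_at_top[of "max 1 l"] show ?thesis
    proof eventually_elim
      case (elim t)
      hence t: "0 < t" "l \<le> t" by auto
      define H where "H = real ?p ^ (m * t)"
      have H: "0 < H" "H \<noteq> 0" using p1 by (simp_all add: H_def)
      have x1: "vabs (x $ j) \<le> 1" for j using x by (simp add: chart_cube_def)
      have "\<exists>N. vabs (of_int w * x $ j - of_nat N) \<le> 1 / real ?p ^ l" for w j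
      proof -
        have "vabs (of_int w * x $ j) \<le> 1 * 1"
          unfolding vabs_mult by (intro mult_mono x1 vabs_of_int_le_1) simp_all
        thus ?thesis using padic_residue by (metis mult_1_left)
      qed
      then obtain c where c: "\<And>w j. vabs (of_int w * x $ j - of_nat (c w j)) \<le> 1 / real ?p ^ l" by metis
      define h where "h = (\<lambda>a. int (?p ^ (m * t - a)))"
      have h: "0 \<le> h a" for a by (simp add: h_def)
      define S where "S = (\<lambda>a w j. {z. \<bar>z\<bar> \<le> h a \<and> int (?p ^ l) dvd z - int (c w j)})"
      define F where "F = (\<lambda>a w. \<Pi>\<^sub>E j\<in>(UNIV :: 'n set). if j = i then {w} else S a w j)"
      define W where "W = (\<lambda>a. {w \<in> {- h a..h a}. \<not> int ?p dvd w})"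
      define R where "R = {j0<..m * t}"
      define I where "I = (SIGMA a:R. SIGMA w:W a. F a w)"
      define rad where "rad = (\<lambda>a. ?n * (real ?p ^ a / real ?p ^ (Suc m * t)))"
      define g where "g = (\<lambda>(a :: nat, w :: int, f :: 'n \<Rightarrow> int). (chart i (\<chi> j. of_int (f j)) :: 'p padic ^ 'n, rad a))"
      have rad: "0 < rad a" for a using p1 by (simp add: rad_def)
      have pl: "0 < ?p ^ l" by simp
      have S: "finite (S a w j)" "real (card (S a w j)) \<le> 2 * (of_int (h a) / real (?p ^ l)) + 1" for a w j
        unfolding S_def by (rule card_cong_interval_le[OF pl h])+
      have F: "finite (F a w)" "real (card (F a w)) \<le> (2 * (of_int (h a) / real (?p ^ l)) + 1) ^ m" for a w
        unfolding F_def m_def by (rule card_PiE_pointed_le[OF S])+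
      have W: "finite (W a)" "real (card (W a)) \<le> 3 * of_int (h a)" for a
      proof -
        show "finite (W a)" unfolding W_def by (rule finite_subset[of _ "{- h a..h a}"]) auto
        have "card (W a) \<le> card {- h a..h a}" unfolding W_def by (rule card_mono) auto
        also have "\<dots> = nat (2 * h a + 1)" by simp
        also have "1 \<le> h a" unfolding h_def using p2 by simp
        hence "nat (2 * h a + 1) \<le> nat (3 * h a)" by simp
        finally have "real (card (W a)) \<le> real (nat (3 * h a))" by (simp only: of_nat_le_iff)
        thus "real (card (W a)) \<le> 3 * of_int (h a)" using h[of a] by simp
      qed
      have R: "finite R" "card R \<le> m * t" by (auto simp: R_def)
      have I: "finite I" unfolding I_def by (intro finite_SigmaI R W F)
      have "(\<Sum>(y, s)\<in>g ` I. s ^ m) \<le> (\<Sum>z\<in>I. snd (g z) ^ m)"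
        by (rule sum_ball_image_le[OF I]) (auto simp: g_def less_imp_le[OF rad] split: prod.splits)
      also have "\<dots> = (\<Sum>a\<in>R. \<Sum>z\<in>(SIGMA w:W a. F a w). rad a ^ m)"
        unfolding I_def by (subst sum.Sigma) (use R W F in \<open>auto simp: g_def case_prod_beta intro!: finite_SigmaI\<close>)
      also have "\<dots> = (\<Sum>a\<in>R. (\<Sum>w\<in>W a. real (card (F a w))) * rad a ^ m)"
        by (simp add: card_SigmaI W F)
      also have "\<dots> \<le> (\<Sum>a\<in>R. 3 * (4 * ?n) ^ m * (1 / real ?p ^ l) ^ m * (1 / real ?p ^ a) + 3 * (2 * ?n) ^ m * (1 / H))"
      proof (intro sum_mono)
        fix a assume "a \<in> R"
        hence a: "a \<le> m * t" by (simp add: R_def)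
        have "real_of_int (h a) = real ?p ^ (m * t - a)" by (simp add: h_def)
        also have "\<dots> = H / real ?p ^ a" unfolding H_def using a p1 by (intro power_diff) auto
        finally have ha: "of_int (h a) = H / real ?p ^ a" .
        let ?q = "real ?p ^ a" and ?P = "real ?p ^ l"
        have q: "0 < ?q" "?q \<le> H" using p1 a by (simp_all add: H_def power_increasing)
        have P: "0 < ?P" using p1 by simp
        have radH: "rad a = ?n * (?q / (H * real ?p ^ t))"
          by (simp add: rad_def H_def power_add mult.commute)
        have HP: "(real ?p ^ t) ^ m = H" by (simp add: H_def power_mult[symmetric] mult.commute)
        have "(\<Sum>w\<in>W a. real (card (F a w))) \<le> (\<Sum>w\<in>W a. (2 * (H / ?q / ?P) + 1) ^ m)"
          using F(2)[of a] unfolding ha by (intro sum_mono) simp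
        also have "\<dots> = real (card (W a)) * (2 * (H / ?q / ?P) + 1) ^ m" by simp
        also have "\<dots> \<le> 3 * (H / ?q) * (2 ^ m * ((2 * (H / ?q / ?P)) ^ m + 1 ^ m))"
        proof (rule mult_mono)
          have nn: "0 \<le> 2 * (H / ?q / ?P)" using less_imp_le[OF H(1)] by simp
          show "(2 * (H / ?q / ?P) + 1) ^ m \<le> 2 ^ m * ((2 * (H / ?q / ?P)) ^ m + 1 ^ m)"
            using nn by (rule power_add_le) simp
          show "0 \<le> (2 * (H / ?q / ?P) + 1) ^ m" using nn by (intro zero_le_power add_nonneg_nonneg) simp_all
          show "0 \<le> 3 * (H / ?q)" using less_imp_le[OF H(1)] by simp
        qed (use W(2)[of a] in \<open>simp add: ha\<close>)
        finally have "(\<Sum>w\<in>W a. real (card (F a w))) * rad a ^ m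
            \<le> 3 * (H / ?q) * (2 ^ m * ((2 * (H / ?q / ?P)) ^ m + 1 ^ m)) * rad a ^ m"
          using rad[of a] by (intro mult_right_mono) simp_all
        also have "\<dots> = 3 * (H / ?q) * (2 ^ m * (2 * (H / ?q / ?P)) ^ m * rad a ^ m) + 3 * (H / ?q) * (2 ^ m * 1 ^ m * rad a ^ m)"
          by (simp only: distrib_left distrib_right mult.assoc)
        also have "2 ^ m * (2 * (H / ?q / ?P)) ^ m * rad a ^ m = (4 * ?n) ^ m * (1 / ?P) ^ m / H"
        proof -
          have "2 * (2 * (H / ?q / ?P)) * rad a = 4 * ?n * (1 / ?P) / real ?p ^ t"
            unfolding radH using H(2) q(1) P by simp
          thus ?thesis unfolding power_mult_distrib[symmetric] by (simp only: power_divide HP)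
        qed
        also have "2 ^ m * 1 ^ m * rad a ^ m = (2 * ?n) ^ m * (?q ^ m / (H ^ m * H))"
          unfolding radH power_mult_distrib power_divide HP by simp
        also have "3 * (H / ?q) * ((4 * ?n) ^ m * (1 / ?P) ^ m / H) = 3 * (4 * ?n) ^ m * (1 / ?P) ^ m * (1 / ?q)"
          using H by simp
        also have "3 * (H / ?q) * ((2 * ?n) ^ m * (?q ^ m / (H ^ m * H))) = 3 * (2 * ?n) ^ m * (?q ^ m / ?q / H ^ m)"
          using H by simp
        also have "?q ^ m / ?q / H ^ m \<le> 1 / H"
        proof -
          have e: "z ^ m = z * z ^ (m - 1)" for z :: real using m(1) by (cases m) auto
          have "?q ^ (m - 1) / H ^ (m - 1) \<le> 1" using q H by (simp add: power_mono)
          hence "?q ^ (m - 1) / H ^ (m - 1) / H \<le> 1 / H" using H by (intro divide_right_mono) simp_all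
          moreover have "?q ^ m / ?q / H ^ m = ?q ^ (m - 1) / H ^ (m - 1) / H"
            unfolding e[of ?q] e[of H] using q by simp
          ultimately show ?thesis by simp
        qed
        finally show "(\<Sum>w\<in>W a. real (card (F a w))) * rad a ^ m
            \<le> 3 * (4 * ?n) ^ m * (1 / ?P) ^ m * (1 / ?q) + 3 * (2 * ?n) ^ m * (1 / H)"
          by (simp add: mult_left_mono)
      qed
      also have "\<dots> = 3 * (4 * ?n) ^ m * (1 / real ?p ^ l) ^ m * (\<Sum>a\<in>R. 1 / real ?p ^ a)
          + 3 * (2 * ?n) ^ m * (real (card R) / H)"
        by (simp add: sum.distrib sum_distrib_left)
      also have "\<dots> \<le> 3 * (4 * ?n) ^ m * (real ?p * r) ^ m * (1 / real ?p ^ j0)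
          + 3 * (2 * ?n) ^ m * ((real (m * t) + 1) / H)"
      proof (intro add_mono mult_mono mult_left_mono power_mono divide_right_mono)
        have "1 / real ?p ^ l = real ?p * (1 / real ?p ^ Suc l)" using p1 by simp
        also have "\<dots> \<le> real ?p * r" by (rule mult_left_mono[OF l(2)]) simp
        finally show "1 / real ?p ^ l \<le> real ?p * r" .
        show "(\<Sum>a\<in>R. 1 / real ?p ^ a) \<le> 1 / real ?p ^ j0" unfolding R_def by (rule sum_geometric_tail_le[OF p2])
        show "real (card R) \<le> real (m * t) + 1" using R(2) by linarith
      qed (use H r p1 in \<open>auto intro: sum_nonneg\<close>)
      also have "\<dots> \<le> e / 2 * r ^ m + 3 * (2 * ?n) ^ m * (e * r ^ m / (2 * (3 * (2 * ?n) ^ m)))"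
      proof (intro add_mono mult_left_mono)
        have "3 * (4 * ?n) ^ m * (real ?p * r) ^ m * (1 / real ?p ^ j0) = K * (1 / real ?p) ^ j0 * r ^ m"
          by (simp add: K_def power_mult_distrib power_one_over)
        also have "\<dots> \<le> K * (e / 2 / K) * r ^ m"
          using j0 K r by (intro mult_right_mono mult_left_mono) simp_all
        also have "\<dots> = e / 2 * r ^ m" using K by simp
        finally show "3 * (4 * ?n) ^ m * (real ?p * r) ^ m * (1 / real ?p ^ j0) \<le> e / 2 * r ^ m" .
        show "(real (m * t) + 1) / H \<le> e * r ^ m / (2 * (3 * (2 * ?n) ^ m))"
          unfolding H_def using elim(1) by simp
      qed simp
      also have "\<dots> = e * r ^ m" by simp
      finally have bad: "(\<Sum>(y, s)\<in>g ` I. s ^ m) \<le> e * r ^ m" .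
      have cube: "chart i (\<chi> j. of_int (f j)) \<in> (chart_cube i :: ('p padic ^ 'n) set)" if "\<not> int ?p dvd f i" for f
        using vabs_of_int_unit[OF that] vabs_of_int_le_1[where 'p = 'p]
        by (auto simp: chart_cube_def chart_def vabs_divide)
      have cover: "u \<in> (\<Union>y\<in>rational_points i (?p ^ (m * t)). cball y (?n * real ?p ^ j0 * (1 / real ?p ^ Suc m) ^ t)) \<union>
          (\<Union>(y, s)\<in>g ` I. cball y s)" if u: "u \<in> cball x r" "u \<in> chart_cube i" for u
      proof -
        obtain a and w :: "'n \<Rightarrow> int" where a: "a \<le> m * t" and w: "\<And>j. \<bar>w j\<bar> \<le> int (?p ^ (m * t - a))"
          "\<not> int ?p dvd w i" "\<And>j. vabs (of_int (w j) - u $ j * of_int (w i)) \<le> real ?p ^ a / real ?p ^ (Suc m * t)"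
          using padic_dirichlet_point[OF n u(2) t(1)] unfolding m_def[symmetric] by metis
        let ?v = "chart i (\<chi> j. of_int (w j)) :: 'p padic ^ 'n"
        have wi: "vabs (of_int (w i) :: 'p padic) = 1" by (rule vabs_of_int_unit[OF w(2)])
        hence wi0: "(of_int (w i) :: 'p padic) \<noteq> 0" by auto
        have "vabs (?v $ j - u $ j) \<le> real ?p ^ a / real ?p ^ (Suc m * t)" for j
        proof -
          have "?v $ j - u $ j = (of_int (w j) - u $ j * of_int (w i)) / of_int (w i)"
            using wi0 by (simp add: chart_def diff_divide_distrib)
          thus ?thesis using w(3)[of j] by (simp only: vabs_divide wi div_by_1)
        qed
        hence dist: "dist ?v u \<le> rad a" unfolding rad_def by (rule dist_le_coords)
        show ?thesis
        proof (cases "a \<le> j0")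
          case True
          have "rad a \<le> ?n * (real ?p ^ j0 / real ?p ^ (Suc m * t))"
            unfolding rad_def using True p1 by (intro mult_left_mono divide_right_mono power_increasing) auto
          also have "\<dots> = ?n * real ?p ^ j0 * (1 / real ?p ^ Suc m) ^ t"
            by (simp only: power_one_over power_mult[symmetric] times_divide_eq_right mult_1_right)
          finally have "?n * real ?p ^ j0 * (1 / real ?p ^ Suc m) ^ t \<ge> dist ?v u" using dist by linarith
          moreover have "?v \<in> rational_points i (?p ^ (m * t))"
            unfolding rational_points_def
          proof (intro CollectI conjI exI cube)
            show "\<not> int ?p dvd w i" by (rule w(2))
            show "(\<chi> j. w j) $ i \<noteq> 0" using w(2) by auto
            show "\<forall>j. \<bar>(\<chi> j. w j) $ j\<bar> \<le> int (?p ^ (m * t))"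
            proof
              fix j
              have "?p ^ (m * t - a) \<le> ?p ^ (m * t)" using p2 by (intro power_increasing) auto
              hence "int (?p ^ (m * t - a)) \<le> int (?p ^ (m * t))" by (simp only: of_nat_le_iff)
              thus "\<bar>(\<chi> j. w j) $ j\<bar> \<le> int (?p ^ (m * t))" using w(1)[of j] unfolding vec_lambda_beta by linarith
            qed
            show "?v = chart i (\<chi> j. of_int ((\<chi> j. w j) $ j))" by simp
          qed
          ultimately show ?thesis by (intro UnI1 UN_I[of ?v]) simp_all
        next
          case False
          have near: "vabs (of_int (w j) - of_int (w i) * x $ j) \<le> 1 / real ?p ^ l" for j
          proof -
            have "real ?p ^ a / real ?p ^ (Suc m * t) \<le> real ?p ^ (m * t) / real ?p ^ (Suc m * t)"
              using a p1 by (intro divide_right_mono power_increasing) auto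
            also have "\<dots> = 1 / real ?p ^ t" using p1 by (simp add: power_add)
            also have "\<dots> \<le> 1 / real ?p ^ l" using t(2) p1 by (intro divide_left_mono power_increasing) auto
            finally have 1: "vabs (of_int (w j) - u $ j * of_int (w i)) \<le> 1 / real ?p ^ l"
              using w(3)[of j] by linarith
            have "vabs (u $ j - x $ j) \<le> r"
              using vabs_coord_le_dist[of u j x] u(1) by (simp add: dist_commute)
            hence "vabs (of_int (w i) * (u $ j - x $ j)) \<le> 1 / real ?p ^ l"
              unfolding vabs_mult wi using l(1) by simp
            from vabs_ultrametric_le(1)[OF 1 this] show ?thesis by (simp add: algebra_simps)
          qed
          have "w j \<in> (if j = i then {w i} else S a (w i) j)" for j
          proof (cases "j = i")
            case False
            from vabs_ultrametric_diff[OF near[of j] c[of "w i" j]]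
            have "vabs (of_int (w j - int (c (w i) j)) :: 'p padic) \<le> 1 / real ?p ^ l" by simp
            hence "int ?p ^ l dvd w j - int (c (w i) j)" by (simp only: vabs_of_int_le_iff)
            thus ?thesis using False w(1)[of j] by (simp add: S_def h_def)
          qed simp
          hence "w \<in> F a (w i)" unfolding F_def by (intro PiE_I) auto
          moreover have "w i \<in> W a" using w(1)[of i] w(2) unfolding W_def h_def by (simp add: abs_le_iff minus_le_iff)
          moreover have "a \<in> R" using False a by (simp add: R_def)
          ultimately have "(a, w i, w) \<in> I" by (simp add: I_def)
          hence "(?v, rad a) \<in> g ` I" by (intro image_eqI[of _ _ "(a, w i, w)"]) (simp_all add: g_def)
          moreover have "u \<in> cball ?v (rad a)" using dist by simp
          ultimately show ?thesis by blast
        qed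
      qed
      show ?case
      proof (intro exI[of _ "g ` I"] conjI)
        show "finite (g ` I)" using I by simp
        show "\<forall>(y, s)\<in>g ` I. y \<in> chart_cube i \<and> 0 < s"
        proof
          fix b assume "b \<in> g ` I"
          then obtain a w f where awf: "w \<in> W a" "f \<in> F a w" "b = g (a, w, f)" by (auto simp: I_def)
          have "f i = w" using PiE_mem[OF awf(2)[unfolded F_def], of i] by simp
          hence "\<not> int ?p dvd f i" using awf(1) by (simp add: W_def)
          hence "chart i (\<chi> j. of_int (f j)) \<in> (chart_cube i :: ('p padic ^ 'n) set)" by (rule cube)
          thus "case b of (y, s) \<Rightarrow> y \<in> chart_cube i \<and> 0 < s"
            unfolding awf(3) g_def by (simp add: rad)
        qed
        show "cball x r \<inter> chart_cube i \<subseteq>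
          (\<Union>y\<in>rational_points i (?p ^ (m * t)). cball y (?n * real ?p ^ j0 * (1 / real ?p ^ Suc m) ^ t)) \<union>
          (\<Union>(y, s)\<in>g ` I. cball y s)" using cover by blast
      qed (rule bad)
    qed
  qed
  show ?thesis
    unfolding m_def[symmetric]
  proof (intro exI[of _ "?n * real ?p ^ j0"] conjI ballI allI impI)
    show "0 < ?n * real ?p ^ j0" using p1 by simp
  qed (rule main[folded m(2)])
qed

lemma padic_grid:
  "\<exists>V :: 'p :: prime_card padic set. finite V \<and> CARD('p) ^ k \<le> card V \<and> card V \<le> 7 * CARD('p) ^ k \<and>
      (\<forall>v\<in>V. vabs v \<le> 3) \<and> (\<forall>v\<in>V. \<forall>w\<in>V. v \<noteq> w \<longrightarrow> 1 / real CARD('p) ^ k \<le> vabs (v - w)) \<and>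
      (\<forall>x y z. vabs x \<le> 1 \<longrightarrow> vabs (y - 1) \<le> 1 / 2 \<longrightarrow> vabs z \<le> 1 \<longrightarrow>
        (\<exists>v\<in>V. vabs (x - y * z - v) \<le> 1 / real CARD('p) ^ k))"
proof -
  let ?p = "CARD('p)"
  let ?V = "of_nat ` {..<?p ^ k} :: 'p padic set"
  have card: "card ?V = ?p ^ k" by (subst card_image) (auto simp: inj_on_def)
  have sep: "1 / real ?p ^ k \<le> vabs (of_nat a - of_nat b :: 'p padic)" if "a < ?p ^ k" "b < ?p ^ k" "a \<noteq> b" for a b
    using padic_residue_unique[of a b k, where 'p = 'p] that by linarith
  have cov: "\<exists>v\<in>?V. vabs (x - y * z - v) \<le> 1 / real ?p ^ k"
    if xyz: "vabs x \<le> 1" "vabs (y - 1) \<le> 1 / 2" "vabs z \<le> 1" for x y z :: "'p padic"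
  proof -
    have "vabs (y - 1) \<le> 1" using xyz(2) by simp
    hence "vabs (y - 1 + 1) \<le> 1" by (rule vabs_ultrametric_le(1)) simp
    hence "vabs (y * z) \<le> 1 * 1" unfolding vabs_mult using xyz(3) by (intro mult_mono) simp_all
    hence "vabs (x - y * z) \<le> 1" using xyz(1) by (intro vabs_ultrametric_le(2)) simp_all
    from padic_residue[OF this, of k] show ?thesis by blast
  qed
  show ?thesis
  proof (intro exI[of _ ?V] conjI)
    show "\<forall>v\<in>?V. vabs v \<le> 3" using vabs_of_nat_le_1[where 'p = 'p] by (auto intro: order_trans[of _ 1])
  qed (use card sep cov in auto)
qed

lemma approximation_place_padic:
  assumes "2 \<le> CARD('n :: finite)"
  shows "approximation_place (padic_haar :: ('p :: prime_card padic ^ 'n) measure) CARD('p)"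
proof
  let ?\<beta> = "padic_haar :: ('p padic ^ 'n) measure"
  let ?p = "CARD('p)"
  note haar = is_haar_padic_haar[where 'p = 'p and 'n = 'n]
  show sets: "sets ?\<beta> = sets borel" using haar by (simp add: is_haar_measure_def)
  show "emeasure ?\<beta> ((\<lambda>x. a + x) ` A) = emeasure ?\<beta> A" if "A \<in> sets borel" for a A
    using haar that by (simp add: is_haar_measure_def)
  show "emeasure ?\<beta> (coord_box s) < \<infinity>" for s
  proof -
    obtain j where j: "s \<le> real ?p ^ j"
      using real_arch_pow[OF CARD_real_gt_1[where 'p = 'p], of s] less_imp_le by blast
    let ?F = "\<Pi>\<^sub>E j'\<in>(UNIV :: 'n set). {..<?p ^ j}"
    let ?v = "\<lambda>f. (\<chi> j'. coset_rep (f j')) :: 'p padic ^ 'n"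
    have F: "finite ?F" by (intro finite_PiE) auto
    have "coord_box s \<subseteq> (\<Union>f\<in>?F. padic_box (?v f) 0)"
    proof
      fix x :: "'p padic ^ 'n" assume "x \<in> coord_box s"
      hence "vabs (x $ j') \<le> real ?p ^ j" for j' using j by (auto simp: coord_box_def intro: order_trans)
      hence "\<exists>N<?p ^ j. vabs (x $ j' - coset_rep N) \<le> 1" for j' by (rule coset_rep_surj)
      then obtain f where "\<And>j'. f j' < ?p ^ j" "\<And>j'. vabs (x $ j' - coset_rep (f j')) \<le> 1" by metis
      thus "x \<in> (\<Union>f\<in>?F. padic_box (?v f) 0)" by (intro UN_I[of f]) (auto simp: padic_box_def)
    qed
    hence "emeasure ?\<beta> (coord_box s) \<le> emeasure ?\<beta> (\<Union>f\<in>?F. padic_box (?v f) 0)"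
      by (rule emeasure_mono) (use F sets in auto)
    also have "\<dots> \<le> (\<Sum>f\<in>?F. emeasure ?\<beta> (padic_box (?v f) 0))"
      by (rule emeasure_subadditive_finite) (use F sets in auto)
    also have "\<dots> = of_nat (card ?F)" by (simp add: is_haar_measure_box[OF haar])
    also have "\<dots> < \<infinity>" by (simp add: ennreal_of_nat_eq_real_of_nat)
    finally show ?thesis .
  qed
  show "0 < emeasure ?\<beta> (coord_box s)" if "0 < s" for s
  proof -
    obtain k where k: "(1 / real ?p) ^ k < s"
      using real_arch_pow_inv[OF \<open>0 < s\<close>, of "1 / real ?p"] CARD_real_gt_1[where 'p = 'p] by auto
    have "0 < emeasure ?\<beta> (padic_box 0 k)" by (simp add: is_haar_measure_box[OF haar])
    also have "\<dots> \<le> emeasure ?\<beta> (coord_box s)"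
      by (rule emeasure_mono) (use k sets in \<open>auto simp: padic_box_def coord_box_def power_one_over intro: order_trans\<close>)
    finally show ?thesis .
  qed
  show "\<exists>x'. vabs (x' - x) \<le> r / 2 \<and> (\<forall>u. vabs (u - x') \<le> r / 2 \<longrightarrow> vabs u \<le> 1)"
    if "vabs x \<le> 1" "0 < r" "r \<le> 1" for x :: "'p padic" and r :: real
  proof (intro exI[of _ x] conjI allI impI)
    fix u assume "vabs (u - x) \<le> r / 2"
    hence "vabs (u - x) \<le> 1" using that by simp
    from vabs_ultrametric_le(1)[OF this that(1)] show "vabs u \<le> 1" by simp
  qed (use that in simp)
qed (use assms CARD_ge_2[where 'p = 'p] padic_grid[where 'p = 'p] padic_dirichlet[OF assms, where 'p = 'p] in auto)

section \<open>Heights and the divergence theorem\<close>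

lemma place_norm_ge:
  assumes "finite I" "i \<in> I" "\<And>x. 0 \<le> a x"
  shows "a (x i) \<le> place_norm v a I x"
proof (cases v)
  case (Prime_place p)
  thus ?thesis using assms by (simp add: place_norm_def)
next
  case Infinite_place
  thus ?thesis using member_le_L2_set[of I i "\<lambda>i. a (x i)"] assms by (simp add: place_norm_def)
qed

lemma place_norm_le:
  assumes "finite I" "\<And>i. i \<in> I \<Longrightarrow> a (x i) \<le> c" "\<And>x. 0 \<le> a x" "0 \<le> c"
  shows "place_norm v a I x \<le> (real (card I) + 1) * c"
proof (cases v)
  case (Prime_place p)
  have "place_norm v a I x \<le> c" using assms by (simp add: place_norm_def Prime_place)
  also have "\<dots> = 1 * c" by simp
  also have "\<dots> \<le> (real (card I) + 1) * c" using assms by (intro mult_right_mono) auto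
  finally show ?thesis .
next
  case Infinite_place
  have "place_norm v a I x \<le> (\<Sum>i\<in>I. a (x i))"
    using L2_set_le_sum[of I "\<lambda>i. a (x i)"] assms(3) by (simp add: place_norm_def Infinite_place)
  also have "\<dots> \<le> (\<Sum>i\<in>I. c)" using assms(2) by (rule sum_mono)
  also have "\<dots> \<le> (real (card I) + 1) * c" using assms by (simp add: distrib_right)
  finally show ?thesis .
qed

lemma place_norm_nonneg: "finite I \<Longrightarrow> 0 \<le> place_norm v a I x"
  by (cases v) (simp_all add: place_norm_def)

lemma borel_measurable_place_norm:
  assumes "finite I" "\<And>i. i \<in> I \<Longrightarrow> (\<lambda>x. a (f x i)) \<in> borel_measurable M"
  shows "(\<lambda>x. place_norm v a I (f x)) \<in> borel_measurable M"
proof (cases v)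
  case (Prime_place p)
  have "(\<lambda>x. Max (insert 0 ((\<lambda>i. a (f x i)) ` I))) \<in> borel_measurable M"
    using assms
  proof (induction I)
    case (insert i I)
    have "Max (insert 0 ((\<lambda>i. a (f x i)) ` insert i I)) = max (a (f x i)) (Max (insert 0 ((\<lambda>i. a (f x i)) ` I)))" for x
      using insert(1) by (simp add: insert_commute[of 0 "a (f x i)"])
    moreover have "(\<lambda>x. max (a (f x i)) (Max (insert 0 ((\<lambda>i. a (f x i)) ` I)))) \<in> borel_measurable M"
      using insert by (intro borel_measurable_max) auto
    ultimately show ?case by (simp only:)
  qed simp
  thus ?thesis by (simp add: place_norm_def Prime_place)
next
  case Infinite_place
  show ?thesis
    unfolding place_norm_def Infinite_place place.case L2_set_def using assms(2) by measurable
qed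

lemma borel_measurable_vec_vabs [measurable]:
  "(vec_vabs :: 'k :: rat_completion ^ 'n :: finite \<Rightarrow> real) \<in> borel_measurable borel"
  unfolding vec_vabs_def[abs_def] by (rule borel_measurable_place_norm) measurable

lemma borel_measurable_wedge_vabs [measurable]:
  "(\<lambda>x :: 'k :: rat_completion ^ 'n :: {finite, linorder}. wedge_vabs x z) \<in> borel_measurable borel"
  unfolding wedge_vabs_def
proof (rule borel_measurable_place_norm)
  show "finite {(i :: 'n, j). i < j}" by (rule finite_subset[OF subset_UNIV]) simp
qed (clarsimp, measurable)

lemma vabs_coord_le_vec_vabs: "vabs (x $ i) \<le> vec_vabs (x :: 'k :: rat_completion ^ 'n :: finite)"
  unfolding vec_vabs_def by (rule place_norm_ge) auto

lemma proj_rel_refl: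
  "x \<noteq> 0 \<Longrightarrow> x \<noteq> 0 \<and> x \<noteq> 0 \<and> (\<exists>c. c \<noteq> 0 \<and> x = c *s (x :: 'k :: field ^ 'n :: finite))"
  by (auto intro!: exI[of _ 1])

lemma abs_proj_eq_iff:
  fixes x y :: "'k :: field ^ 'n :: finite"
  assumes "x \<noteq> 0" "y \<noteq> 0"
  shows "abs_proj x = abs_proj y \<longleftrightarrow> (\<exists>c. c \<noteq> 0 \<and> y = c *s x)"
  using Quotient3_rel[OF Quotient3_proj, of x y] proj_rel_refl[OF assms(1)] proj_rel_refl[OF assms(2)] assms
  by (simp only: simp_thms)

lemma proj_dist_abs_proj:
  fixes x y :: "'k :: rat_completion ^ 'n :: {finite, linorder}"
  shows "x \<noteq> 0 \<Longrightarrow> y \<noteq> 0 \<Longrightarrow> proj_dist (abs_proj x) (abs_proj y) = wedge_vabs x y / (vec_vabs x * vec_vabs y)"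
  using proj_dist.abs_eq[OF proj_rel_refl proj_rel_refl] .

lemma proj_height_abs_proj: "y \<noteq> 0 \<Longrightarrow> proj_height (abs_proj y) = rat_vec_height (y :: rat ^ 'n :: finite)"
  using proj_height.abs_eq[OF proj_rel_refl] .

lemma proj_of_rat_abs_proj:
  "y \<noteq> 0 \<Longrightarrow> proj_of_rat (abs_proj y) = abs_proj (\<chi> j. of_rat (y $ j) :: 'k :: field_char_0 ^ 'n :: finite)"
  using proj_of_rat.abs_eq[OF proj_rel_refl] .

lemma proj_cases:
  obtains y where "y \<noteq> 0" "Y = abs_proj (y :: 'k :: field ^ 'n :: finite)"
  using that by (induct Y rule: proj.abs_induct) auto

lemma countable_rat_proj: "countable (UNIV :: (rat, 'n :: finite) proj set)"
proof -
  have "(UNIV :: (rat, 'n) proj set) = range abs_proj"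
  proof
    show "(UNIV :: (rat, 'n) proj set) \<subseteq> range abs_proj"
    proof
      fix Y :: "(rat, 'n) proj"
      obtain y where "Y = abs_proj y" by (rule proj_cases)
      thus "Y \<in> range abs_proj" by simp
    qed
  qed simp
  thus ?thesis by (metis countableI_type countable_image)
qed

lemma chart_cube_nonzero: "u \<in> chart_cube i \<Longrightarrow> u \<noteq> 0"
  by (auto simp: chart_cube_def)

lemma abs_proj_chart:
  fixes x :: "'k :: field ^ 'n :: finite"
  assumes "x $ i \<noteq> 0"
  shows "abs_proj (chart i x) = abs_proj x"
proof -
  have "x = x $ i *s chart i x" using assms by (simp add: chart_def vec_eq_iff)
  moreover have "x \<noteq> 0" using assms by auto
  moreover have "chart i x $ i \<noteq> 0" using assms by (simp add: chart_def)
  hence "chart i x \<noteq> 0" by auto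
  ultimately show ?thesis using abs_proj_eq_iff[of "chart i x" x] assms by metis
qed

lemma chart_cube_abs_proj_inj:
  assumes "u \<in> chart_cube i" "w \<in> chart_cube i" "abs_proj u = abs_proj w"
  shows "u = w"
proof -
  obtain c where c: "w = c *s u"
    using assms abs_proj_eq_iff[of u w] chart_cube_nonzero[of u i] chart_cube_nonzero[of w i] by auto
  hence "c = 1" using assms(1,2) by (auto simp: chart_cube_def dest: arg_cong[of _ _ "\<lambda>w. w $ i"])
  thus ?thesis using c by simp
qed

lemma proj_dist_chart_cube_le:
  fixes u w :: "'k :: rat_completion ^ 'n :: {finite, linorder}"
  assumes u: "u \<in> chart_cube i" and w: "w \<in> chart_cube i"
  shows "proj_dist (abs_proj u) (abs_proj w) \<le> 2 * (real (card {(a :: 'n, b). a < b}) + 1) * dist u w"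
proof -
  have ge: "1 \<le> vec_vabs z" if "z \<in> chart_cube i" for z :: "('k, 'n) vec"
    using vabs_coord_le_vec_vabs[of z i] that by (simp add: chart_cube_def)
  have fin: "finite {(a :: 'n, b). a < b}" by (rule finite_subset[OF subset_UNIV]) simp
  have W: "wedge_vabs u w \<le> (real (card {(a :: 'n, b). a < b}) + 1) * (2 * dist u w)"
    unfolding wedge_vabs_def
  proof (rule place_norm_le[OF fin])
    fix ab assume "ab \<in> {(a :: 'n, b). a < b}"
    obtain a b where ab: "ab = (a, b)" by fastforce
    have d: "vabs (w $ j - u $ j) \<le> dist u w" for j
      using vabs_coord_le_dist[of w j u] by (simp add: dist_commute)
    have u1: "vabs (u $ j) \<le> 1" for j using u by (simp add: chart_cube_def)
    have "u $ a * w $ b - u $ b * w $ a = u $ a * (w $ b - u $ b) - u $ b * (w $ a - u $ a)"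
      by (simp add: algebra_simps)
    also have "vabs \<dots> \<le> vabs (u $ a) * vabs (w $ b - u $ b) + vabs (u $ b) * vabs (w $ a - u $ a)"
      using vabs_triangle_minus by (simp flip: vabs_mult)
    also have "\<dots> \<le> 1 * dist u w + 1 * dist u w"
      by (intro add_mono mult_mono d u1) auto
    finally show "vabs (case ab of (a, b) \<Rightarrow> u $ a * w $ b - u $ b * w $ a) \<le> 2 * dist u w"
      by (simp add: ab)
  qed auto
  have W0: "0 \<le> wedge_vabs u w" unfolding wedge_vabs_def by (rule place_norm_nonneg[OF fin])
  have "1 * 1 \<le> vec_vabs u * vec_vabs w" using ge[OF u] ge[OF w] by (intro mult_mono) auto
  hence "wedge_vabs u w / (vec_vabs u * vec_vabs w) \<le> wedge_vabs u w / 1"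
    using W0 by (intro divide_left_mono) auto
  also have "\<dots> \<le> 2 * (real (card {(a :: 'n, b). a < b}) + 1) * dist u w"
    using W unfolding div_by_1 by (simp only: mult.assoc mult.left_commute)
  finally show ?thesis
    using proj_dist_abs_proj[OF chart_cube_nonzero[OF u] chart_cube_nonzero[OF w]] by simp
qed

lemma rat_vec_height_int_le:
  fixes y :: "int ^ 'n :: finite"
  assumes y: "y \<noteq> 0" "\<And>j. \<bar>y $ j\<bar> \<le> int N"
  shows "rat_vec_height (\<chi> j. of_int (y $ j)) \<le> (real CARD('n) + 1) * real N"
proof -
  let ?y = "(\<chi> j. of_int (y $ j)) :: rat ^ 'n"
  let ?S = "{v. v \<in> places \<and> rat_vec_norm v ?y \<noteq> 1}"
  obtain j where j: "y $ j \<noteq> 0" using y(1) by (auto simp: vec_eq_iff)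
  hence N: "1 \<le> real N" using y(2)[of j] by linarith
  have "?y $ j \<noteq> 0" using j by simp
  hence "?y \<noteq> 0" by (metis zero_index)
  hence fin: "finite ?S" using finite_rat_vec_norm_neq_1[of ?y] by simp
  have nonneg: "0 \<le> rat_vec_norm v ?y" for v unfolding rat_vec_norm_def by (rule place_norm_nonneg) simp
  have prime: "rat_vec_norm v ?y \<le> 1" if v: "v \<in> places" "v \<noteq> Infinite_place" for v
  proof -
    obtain p where v: "v = Prime_place p" "prime p" by (rule places_cases[OF v(1)]) (use v(2) in auto)
    have p1: "1 \<le> real p" using prime_ge_1_nat[OF v(2)] by simp
    have "rat_abs v (of_int z) \<le> 1" for z
    proof (cases "z = 0")
      case False
      have "rat_valuation p (of_int z) = int (multiplicity (int p) z)"
        using rat_valuation_frac[OF v(2) False, of 1] by simp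
      hence "rat_abs v (of_int z) = inverse (real p ^ multiplicity (int p) z)"
        using False by (simp add: v rat_abs.simps power_int_minus)
      also have "\<dots> \<le> 1" using p1 by (simp add: inverse_le_1_iff)
      finally show ?thesis .
    qed simp
    thus ?thesis by (simp add: rat_vec_norm_def place_norm_def v)
  qed
  have inf: "rat_vec_norm Infinite_place ?y \<le> (real CARD('n) + 1) * real N"
    unfolding rat_vec_norm_def
  proof (rule place_norm_le)
    fix j :: 'n
    have "\<bar>of_int (y $ j) :: real\<bar> \<le> of_int (int N)" using y(2)[of j] by (metis of_int_abs of_int_le_iff)
    thus "rat_abs Infinite_place (?y $ j) \<le> real N" by (simp add: rat_abs.simps)
  qed auto
  have D: "1 \<le> (real CARD('n) + 1) * real N"
  proof -
    have "1 * 1 \<le> (real CARD('n) + 1) * real N" using N by (intro mult_mono) auto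
    thus ?thesis by simp
  qed
  have rest: "(\<Prod>v\<in>?S - {Infinite_place}. rat_vec_norm v ?y) \<le> 1"
    using nonneg prime by (intro prod_le_1) auto
  show ?thesis
  proof (cases "Infinite_place \<in> ?S")
    case True
    have "rat_vec_height ?y = rat_vec_norm Infinite_place ?y * (\<Prod>v\<in>?S - {Infinite_place}. rat_vec_norm v ?y)"
      unfolding rat_vec_height_def using fin True by (rule prod.remove)
    also have "\<dots> \<le> ((real CARD('n) + 1) * real N) * 1"
      using inf rest nonneg D by (intro mult_mono prod_nonneg) auto
    finally show ?thesis by simp
  next
    case False
    hence "rat_vec_height ?y \<le> 1" unfolding rat_vec_height_def using rest by simp
    thus ?thesis using D by linarith
  qed
qed

lemma rat_vec_height_nonneg: "0 \<le> rat_vec_height y"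
  unfolding rat_vec_height_def rat_vec_norm_def by (intro prod_nonneg place_norm_nonneg) simp

lemma not_summable_condensed:
  fixes \<psi> :: "real \<Rightarrow> real" and b m D :: nat
  assumes nonneg: "\<And>t. 0 \<le> t \<Longrightarrow> 0 \<le> \<psi> t" and anti: "antimono_on {0..} \<psi>"
    and div: "(\<Sum>q. ennreal (real (Suc q) ^ m * \<psi> (real (Suc q)) ^ m)) = \<infinity>"
    and b: "2 \<le> b" and m: "0 < m" and D: "0 < D"
  shows "\<not> summable (\<lambda>t. (\<psi> (real (D * b ^ (m * t))) * (real b ^ Suc m) ^ t) ^ m)"
proof
  let ?N = "\<lambda>t. b ^ (m * t)"
  let ?f = "\<lambda>q. real (Suc q) ^ m * \<psi> (real (Suc q)) ^ m"
  let ?g = "\<lambda>t. (\<psi> (real (D * ?N t)) * (real b ^ Suc m) ^ t) ^ m"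
  assume sg: "summable ?g"
  have f0: "0 \<le> ?f q" for q using nonneg by simp
  have g0: "0 \<le> ?g t" for t using nonneg by simp
  let ?K = "(real D * real b ^ m) ^ Suc m"
  have bound: "(\<Sum>q<D * ?N T. ?f q) \<le> (\<Sum>q<D. ?f q) + ?K * (\<Sum>t<T. ?g t)" for T
  proof (induction T)
    case (Suc T)
    have le: "D * ?N T \<le> D * ?N (Suc T)" using b by (intro mult_left_mono power_increasing) auto
    have "(\<Sum>q<D * ?N (Suc T). ?f q) = (\<Sum>q<D * ?N T. ?f q) + (\<Sum>q\<in>{D * ?N T..<D * ?N (Suc T)}. ?f q)"
      using le by (simp add: lessThan_atLeast0 sum.atLeastLessThan_concat)
    also have "(\<Sum>q\<in>{D * ?N T..<D * ?N (Suc T)}. ?f q)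
        \<le> (\<Sum>q\<in>{D * ?N T..<D * ?N (Suc T)}. real (D * ?N (Suc T)) ^ m * \<psi> (real (D * ?N T)) ^ m)"
    proof (intro sum_mono mult_mono power_mono)
      fix q assume q: "q \<in> {D * ?N T..<D * ?N (Suc T)}"
      hence "Suc q \<le> D * ?N (Suc T)" by simp
      thus "real (Suc q) \<le> real (D * ?N (Suc T))" by (simp only: of_nat_le_iff)
      have "D * ?N T \<le> Suc q" using q by simp
      hence "real (D * ?N T) \<le> real (Suc q)" by (simp only: of_nat_le_iff)
      thus "\<psi> (real (Suc q)) \<le> \<psi> (real (D * ?N T))"
        using anti by (intro monotone_onD[OF anti]) auto
    qed (use nonneg in auto)
    also have "\<dots> = real (D * ?N (Suc T) - D * ?N T) * (real (D * ?N (Suc T)) ^ m * \<psi> (real (D * ?N T)) ^ m)"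
      by simp
    also have "\<dots> \<le> real (D * ?N (Suc T)) * (real (D * ?N (Suc T)) ^ m * \<psi> (real (D * ?N T)) ^ m)"
    proof (rule mult_right_mono)
      show "0 \<le> real (D * ?N (Suc T)) ^ m * \<psi> (real (D * ?N T)) ^ m"
        using nonneg[of "real (D * ?N T)"] by (intro mult_nonneg_nonneg zero_le_power) simp_all
    qed (simp only: of_nat_le_iff diff_le_self)
    also have "\<dots> = ?K * ?g T"
    proof -
      have 1: "real (D * ?N (Suc T)) = real D * real b ^ m * real b ^ (m * T)" by (simp add: power_add)
      have 2: "((real b ^ Suc m) ^ T) ^ m = (real b ^ (m * T)) ^ Suc m"
        by (simp only: power_mult[symmetric] mult.commute mult.left_commute)
      show ?thesis unfolding power_mult_distrib[of "\<psi> _"] 2 1 power_mult_distrib[of "real D * real b ^ m"]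
        by (simp only: power_Suc mult.assoc mult.commute mult.left_commute)
    qed
    finally show ?case using Suc by (simp add: distrib_left)
  qed simp
  have "summable ?f"
  proof (rule bounded_imp_summable[of _ "(\<Sum>q<D. ?f q) + ?K * suminf ?g"])
    fix M
    show "0 \<le> ?f M" by (rule f0)
    show "(\<Sum>q\<le>M. ?f q) \<le> (\<Sum>q<D. ?f q) + ?K * suminf ?g"
    proof -
      have "Suc M < 2 ^ Suc M" by (rule less_exp)
      also have "\<dots> \<le> ?N (Suc M)"
      proof -
        have "(2 :: nat) ^ Suc M \<le> b ^ Suc M" using b by (rule power_mono) simp
        also have "1 * Suc M \<le> m * Suc M" using m by (intro mult_right_mono) simp_all
        hence "b ^ Suc M \<le> b ^ (m * Suc M)" using b by (intro power_increasing) simp_all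
        finally show ?thesis .
      qed
      also have "\<dots> \<le> D * ?N (Suc M)" using D by simp
      finally have "{..M} \<subseteq> {..<D * ?N (Suc M)}" by auto
      hence "(\<Sum>q\<le>M. ?f q) \<le> (\<Sum>q<D * ?N (Suc M). ?f q)" using f0 by (intro sum_mono2) auto
      also have "\<dots> \<le> (\<Sum>q<D. ?f q) + ?K * (\<Sum>t<Suc M. ?g t)" by (rule bound)
      also have "\<dots> \<le> (\<Sum>q<D. ?f q) + ?K * suminf ?g"
        using sg g0 by (intro add_left_mono mult_left_mono sum_le_suminf) auto
      finally show ?thesis .
    qed
  qed
  hence "(\<Sum>q. ennreal (?f q)) = ennreal (suminf ?f)" using f0 by (intro suminf_ennreal2) auto
  thus False using div by simp
qed

lemma approximable_cone_borel:
  fixes \<psi> :: "real \<Rightarrow> real"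
  shows "{x :: 'k :: rat_completion ^ 'n :: {finite, linorder}. x \<noteq> 0 \<and> abs_proj x \<in> approximable \<psi>} \<in> sets borel"
proof -
  let ?E = "\<lambda>Y :: (rat, 'n) proj. {x :: ('k, 'n) vec. x \<noteq> 0 \<and> proj_dist (abs_proj x) (proj_of_rat Y) \<le> \<psi> (proj_height Y)}"
  have E: "?E Y \<in> sets borel" for Y
  proof -
    obtain y where y: "y \<noteq> 0" "Y = abs_proj y" by (rule proj_cases)
    let ?z = "(\<chi> j. of_rat (y $ j)) :: ('k, 'n) vec"
    have z: "?z \<noteq> 0" using y(1) by (auto simp: vec_eq_iff)
    have "?E Y = (- {0}) \<inter> {x. wedge_vabs x ?z / (vec_vabs x * vec_vabs ?z) \<le> \<psi> (proj_height Y)}"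
      unfolding y(2) proj_of_rat_abs_proj[OF y(1)] using proj_dist_abs_proj[OF _ z] by auto
    also have "\<dots> \<in> sets borel"
    proof (rule sets.Int)
      show "- {0 :: ('k, 'n) vec} \<in> sets borel" by (intro borel_open) auto
      show "{x :: ('k, 'n) vec. wedge_vabs x ?z / (vec_vabs x * vec_vabs ?z) \<le> \<psi> (proj_height Y)} \<in> sets borel" by measurable
    qed
    finally show ?thesis .
  qed
  let ?\<F> = "{F :: (rat, 'n) proj set. finite F \<and> F \<subseteq> UNIV}"
  have "infinite S \<longleftrightarrow> (\<forall>F\<in>?\<F>. \<exists>Y\<in>- F. Y \<in> S)" for S :: "(rat, 'n) proj set"
  proof
    assume "infinite S"
    show "\<forall>F\<in>?\<F>. \<exists>Y\<in>- F. Y \<in> S"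
    proof
      fix F assume "F \<in> ?\<F>"
      hence "\<not> S \<subseteq> F" using \<open>infinite S\<close> finite_subset by blast
      thus "\<exists>Y\<in>- F. Y \<in> S" by blast
    qed
  next
    assume "\<forall>F\<in>?\<F>. \<exists>Y\<in>- F. Y \<in> S"
    thus "infinite S" by blast
  qed
  hence "{x :: ('k, 'n) vec. x \<noteq> 0 \<and> abs_proj x \<in> approximable \<psi>} = (\<Inter>F\<in>?\<F>. \<Union>Y\<in>- F. ?E Y)"
    unfolding approximable_def by auto
  also have "\<dots> \<in> sets borel"
  proof (rule sets.countable_INT'')
    show "countable ?\<F>" by (rule countable_Collect_finite_subset[OF countable_rat_proj])
    show "(\<Union>Y\<in>- F. ?E Y) \<in> sets borel" for F
      by (rule sets.countable_UN'') (use E countable_subset[OF subset_UNIV countable_rat_proj] in auto)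
  qed simp
  finally show ?thesis .
qed

lemma approximation_place_origin_null:
  fixes \<beta> :: "('k :: {rat_completion, second_countable_topology} ^ 'n :: finite) measure"
  assumes "approximation_place \<beta> b"
  shows "emeasure \<beta> {0} = 0"
proof -
  interpret approximation_place \<beta> b by fact
  fix i :: 'n
  let ?m = "CARD('n) - 1" and ?\<mu> = "measure \<beta> {0}"
  have bound: "real b ^ k * ?\<mu> \<le> measure \<beta> (coord_box 3)" for k
  proof -
    obtain V :: "'k set" where V: "finite V" "b ^ k \<le> card V" "\<forall>v\<in>V. vabs v \<le> 3"
      using grid[of k] by blast
    let ?W = "grid_vectors i V :: (('k, 'n) vec) set"
    have "real (card ?W) * ?\<mu> \<le> measure \<beta> (coord_box 3)"
    proof (rule packing)
      show "finite ?W" by (rule grid_vectors(1)[OF V(1)])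
      fix w x assume w: "w \<in> ?W" "x \<in> {0 :: ('k, 'n) vec}"
      have "vabs (w $ j) \<le> 3" for j using w V(3) by (cases "j = i") (auto simp: grid_vectors_def)
      thus "w + x \<in> coord_box 3" using w(2) by (simp add: coord_box_def)
    qed (use coord_box_finite in auto)
    moreover have "real b ^ k \<le> real (card ?W)"
    proof -
      have "b ^ k \<le> card V ^ 1" using V(2) by simp
      also have "\<dots> \<le> card V ^ ?m"
      proof (rule power_increasing)
        show "1 \<le> ?m" using dim by simp
        have "0 < b ^ k" using base by simp
        thus "1 \<le> card V" using V(2) by linarith
      qed
      also have "\<dots> = card ?W" by (rule grid_vectors(2)[OF V(1), symmetric])
      finally have "real (b ^ k) \<le> real (card ?W)" by (simp only: of_nat_le_iff)
      thus ?thesis by simp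
    qed
    ultimately show ?thesis by (meson measure_nonneg mult_right_mono order_trans)
  qed
  have "?\<mu> = 0"
  proof (rule ccontr)
    assume "?\<mu> \<noteq> 0"
    hence \<mu>: "0 < ?\<mu>" using zero_less_measure_iff by blast
    obtain k where "measure \<beta> (coord_box 3) / ?\<mu> < real b ^ k"
      using real_arch_pow[of "real b"] base by auto
    hence "measure \<beta> (coord_box 3) < real b ^ k * ?\<mu>" using \<mu> by (simp add: pos_divide_less_eq)
    with bound[of k] show False by simp
  qed
  moreover have "emeasure \<beta> {0} < \<infinity>" by (rule box_subset_finite[of _ 1]) (simp add: coord_box_def)
  ultimately show ?thesis by (auto simp: measure_def enn2real_eq_0_iff)
qed

theorem proj_measure_approximable:
  fixes \<beta> :: "('k :: {rat_completion, second_countable_topology} ^ 'n :: {finite, linorder}) measure"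
    and \<psi> :: "real \<Rightarrow> real"
  assumes place: "approximation_place \<beta> b"
    and nonneg: "\<forall>t\<ge>0. 0 \<le> \<psi> t" and anti: "antimono_on {0..} \<psi>"
    and div: "(\<Sum>q. ennreal (real (Suc q) ^ (CARD('n) - 1) * \<psi> (real (Suc q)) ^ (CARD('n) - 1))) = \<infinity>"
  shows "proj_measure \<beta> (approximable \<psi> :: ('k, 'n) proj set) = 1"
proof -
  interpret approximation_place \<beta> b by fact
  define m where "m = CARD('n) - 1"
  have m: "0 < m" "CARD('n) = Suc m" using dim by (auto simp: m_def)
  define C where "C = 2 * (real (card {(a :: 'n, b). a < b}) + 1)"
  have C: "0 < C" by (simp add: C_def)
  define D where "D = CARD('n) + 1"
  define \<theta> where "\<theta> = (\<lambda>t. \<psi> (real (D * b ^ (m * t))) / C)"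
  have theta0: "0 \<le> \<theta> t" for t using nonneg C by (simp add: \<theta>_def)
  have theta_div: "\<not> summable (\<lambda>t. (\<theta> t * (real b ^ CARD('n)) ^ t) ^ m)"
  proof
    assume "summable (\<lambda>t. (\<theta> t * (real b ^ CARD('n)) ^ t) ^ m)"
    hence "summable (\<lambda>t. C ^ m * (\<theta> t * (real b ^ CARD('n)) ^ t) ^ m)" by (rule summable_mult)
    also have "(\<lambda>t. C ^ m * (\<theta> t * (real b ^ CARD('n)) ^ t) ^ m)
        = (\<lambda>t. (\<psi> (real (D * b ^ (m * t))) * (real b ^ Suc m) ^ t) ^ m)"
      using C unfolding power_mult_distrib[symmetric] m(2) by (simp add: \<theta>_def)
    finally show False
      using not_summable_condensed[OF _ anti div[folded m_def] base m(1), of D] nonneg by (simp add: D_def)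
  qed
  have approx: "abs_proj x \<in> approximable \<psi>"
    if x: "x \<in> chart_cone i"
      and inf: "infinite {y. \<exists>t. y \<in> rational_points i (b ^ (m * t)) \<and> dist (chart i x) y \<le> \<theta> t}"
    for x :: "('k, 'n) vec" and i
  proof -
    let ?S = "{y. \<exists>t. y \<in> rational_points i (b ^ (m * t)) \<and> dist (chart i x) y \<le> \<theta> t}"
    have xi: "x $ i \<noteq> 0" using x by (simp add: chart_cone_def)
    have ex: "\<exists>Y. proj_of_rat Y = abs_proj y \<and> proj_dist (abs_proj x) (proj_of_rat Y) \<le> \<psi> (proj_height Y)"
      if y: "y \<in> ?S" for y
    proof -
      obtain t where t: "y \<in> rational_points i (b ^ (m * t))" "dist (chart i x) y \<le> \<theta> t" using y by blast
      obtain w :: "(int, 'n) vec" where w: "y \<in> chart_cube i" "w $ i \<noteq> 0" "\<And>j. \<bar>w $ j\<bar> \<le> int (b ^ (m * t))"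
        "y = chart i (\<chi> j. of_int (w $ j))"
        using t(1) unfolding rational_points_def by blast
      let ?q = "(\<chi> j. of_int (w $ j)) :: (rat, 'n) vec"
      have "?q $ i \<noteq> 0" using w(2) by simp
      hence q: "?q \<noteq> 0" by (metis zero_index)
      have w0: "w \<noteq> 0" using w(2) by auto
      have Y: "proj_of_rat (abs_proj ?q) = abs_proj y"
        unfolding proj_of_rat_abs_proj[OF q] w(4) by (subst abs_proj_chart) (use w(2) in simp_all)
      have "proj_dist (abs_proj x) (proj_of_rat (abs_proj ?q)) = proj_dist (abs_proj (chart i x)) (abs_proj y)"
        unfolding Y abs_proj_chart[OF xi] ..
      also have "\<dots> \<le> C * dist (chart i x) y"
        unfolding C_def by (rule proj_dist_chart_cube_le[OF chart_in_cube[OF x] w(1)])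
      also have "\<dots> \<le> C * \<theta> t" using t(2) C by (intro mult_left_mono) auto
      also have "\<dots> = \<psi> (real (D * b ^ (m * t)))" using C by (simp add: \<theta>_def)
      also have "\<dots> \<le> \<psi> (proj_height (abs_proj ?q))"
      proof (rule monotone_onD[OF anti])
        show "proj_height (abs_proj ?q) \<in> {0..}"
          unfolding proj_height_abs_proj[OF q] by (simp add: rat_vec_height_nonneg)
        have "rat_vec_height ?q \<le> (real CARD('n) + 1) * real (b ^ (m * t))"
          by (rule rat_vec_height_int_le[OF w0 w(3)])
        thus "proj_height (abs_proj ?q) \<le> real (D * b ^ (m * t))"
          unfolding proj_height_abs_proj[OF q] by (simp add: D_def distrib_right)
      qed simp
      finally show ?thesis using Y by blast
    qed
    hence "\<forall>y\<in>?S. \<exists>Y. proj_of_rat Y = abs_proj y \<and> proj_dist (abs_proj x) (proj_of_rat Y) \<le> \<psi> (proj_height Y)"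
      by (rule ballI)
    from bchoice[OF this] obtain Y where Y:
      "\<forall>y\<in>?S. proj_of_rat (Y y) = abs_proj y \<and> proj_dist (abs_proj x) (proj_of_rat (Y y)) \<le> \<psi> (proj_height (Y y))" ..
    have Y1: "proj_of_rat (Y y) = abs_proj y" if "y \<in> ?S" for y by (rule conjunct1[OF bspec[OF Y that]])
    have Y2: "proj_dist (abs_proj x) (proj_of_rat (Y y)) \<le> \<psi> (proj_height (Y y))" if "y \<in> ?S" for y
      by (rule conjunct2[OF bspec[OF Y that]])
    have "inj_on Y ?S"
    proof (rule inj_onI)
      fix y z assume yz: "y \<in> ?S" "z \<in> ?S" "Y y = Y z"
      have "y \<in> chart_cube i" "z \<in> chart_cube i" using yz(1,2) by (auto simp: rational_points_def)
      moreover have "abs_proj y = abs_proj z" using Y1[OF yz(1)] Y1[OF yz(2)] yz(3) by simp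
      ultimately show "y = z" by (rule chart_cube_abs_proj_inj)
    qed
    hence "infinite (Y ` ?S)" using inf finite_image_iff by blast
    moreover have "Y ` ?S \<subseteq> {Y. proj_dist (abs_proj x) (proj_of_rat Y) \<le> \<psi> (proj_height Y)}"
      using Y2 by blast
    ultimately show ?thesis unfolding approximable_def using infinite_super by blast
  qed
  have "AE x in \<beta>. \<forall>i. x \<in> chart_cone i \<longrightarrow>
      infinite {y. \<exists>t. y \<in> rational_points i (b ^ (m * t)) \<and> dist (chart i x) y \<le> \<theta> t}"
    using AE_chart[OF theta0 theta_div[unfolded m_def]] unfolding m_def[symmetric]
    by (simp add: AE_all_countable)
  moreover have "AE x in \<beta>. x \<noteq> 0"
    using approximation_place_origin_null[OF place] sets_\<beta>
    by (intro AE_I'[of "{0}"]) (auto intro!: null_setsI borel_closed)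
  ultimately have AE: "AE x in \<beta>. x \<in> unit_ball \<longrightarrow> x \<noteq> 0 \<and> abs_proj x \<in> approximable \<psi>"
  proof eventually_elim
    case (elim x)
    show ?case
    proof
      assume xb: "x \<in> unit_ball"
      obtain i where i: "\<And>j. vabs (x $ j) \<le> vabs (x $ i)"
      proof -
        have "Max (range (\<lambda>j. vabs (x $ j))) \<in> range (\<lambda>j. vabs (x $ j))" by (rule Max_in) auto
        then obtain i where "Max (range (\<lambda>j. vabs (x $ j))) = vabs (x $ i)" by blast
        moreover have "vabs (x $ j) \<le> Max (range (\<lambda>j. vabs (x $ j)))" for j by (rule Max_ge) auto
        ultimately show ?thesis using that[of i] by metis
      qed
      have "x $ i \<noteq> 0"
      proof
        assume "x $ i = 0"
        hence "vabs (x $ j) \<le> 0" for j using i[of j] by simp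
        hence "vabs (x $ j) = 0" for j using vabs_nonneg[of "x $ j"] by (intro antisym)
        hence "x = 0" by (simp add: vec_eq_iff)
        thus False using elim by simp
      qed
      moreover have "vabs (x $ i) \<le> 2"
        using vabs_coord_le_vec_vabs[of x i] xb by (simp add: unit_ball_def)
      ultimately have "x \<in> chart_cone i" using i by (simp add: chart_cone_def)
      thus "x \<noteq> 0 \<and> abs_proj x \<in> approximable \<psi>" using approx elim by blast
    qed
  qed
  have ball_borel: "(unit_ball :: (('k, 'n) vec) set) \<in> sets borel" unfolding unit_ball_def by measurable
  have "measure \<beta> ({x. x \<noteq> 0 \<and> abs_proj x \<in> approximable \<psi>} \<inter> unit_ball) = measure \<beta> unit_ball"
  proof (rule measure_eq_AE)
    show "AE x in \<beta>. x \<in> {x. x \<noteq> 0 \<and> abs_proj x \<in> approximable \<psi>} \<inter> unit_ball \<longleftrightarrow> x \<in> unit_ball"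
      using AE by eventually_elim auto
  qed (use approximable_cone_borel ball_borel sets_\<beta> in auto)
  moreover have "0 < measure \<beta> unit_ball"
  proof -
    have sub: "(unit_ball :: (('k, 'n) vec) set) \<subseteq> coord_box 1"
      using vabs_coord_le_vec_vabs order_trans by (fastforce simp: unit_ball_def coord_box_def)
    have "0 < emeasure \<beta> (coord_box (1 / (real CARD('n) + 1)))" by (rule coord_box_pos) simp
    also have "\<dots> \<le> emeasure \<beta> unit_ball"
    proof (rule emeasure_mono)
      show "coord_box (1 / (real CARD('n) + 1)) \<subseteq> (unit_ball :: (('k, 'n) vec) set)"
      proof
        fix x :: "('k, 'n) vec" assume x: "x \<in> coord_box (1 / (real CARD('n) + 1))"
        have "vec_vabs x \<le> (real CARD('n) + 1) * (1 / (real CARD('n) + 1))"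
          unfolding vec_vabs_def by (rule place_norm_le) (use x in \<open>auto simp: coord_box_def\<close>)
        thus "x \<in> unit_ball" by (simp add: unit_ball_def)
      qed
    qed (use ball_borel sets_\<beta> in simp)
    finally show ?thesis
      using box_subset_finite[OF sub] by (simp add: measure_def enn2real_positive_iff)
  qed
  ultimately show ?thesis by (simp add: proj_measure_def)
qed

theorem theorem3:
  fixes \<psi> :: "real \<Rightarrow> real"
  assumes "2 \<le> CARD('n :: {finite, linorder})"
    and "\<forall>t\<ge>0. 0 \<le> \<psi> t"
    and "antimono_on {0..} \<psi>"
    and "(\<Sum>q. ennreal (real (Suc q) ^ (CARD('n) - 1) * \<psi> (real (Suc q)) ^ (CARD('n) - 1))) = \<infinity>"
  shows "proj_measure lborel (approximable \<psi> :: (real, 'n) proj set) = 1 \<and>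
         proj_measure padic_haar (approximable \<psi> :: ('p :: prime_card padic, 'n) proj set) = 1"
  using proj_measure_approximable[OF approximation_place_real[OF assms(1)] assms(2-4)]
    proj_measure_approximable[OF approximation_place_padic[OF assms(1)] assms(2-4)] ..

end
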